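(* Let $C=\bigcup_{j=1}^r C_j$ be a reduced curve with $r\ge 1$ branches, embedded in $k^n$ by a surjection $k[[X_1,\dots,X_n]]\to\mathcal O$, $X_i\mapsto x_i$, where $x_1,\dots,x_n$ generate the maximal ideal of the local ring $\mathcal O$ of $C$. Then there exist $m\ge 1$ and functions $y_1,\dots,y_m\in k[[X_1,\dots,X_n]]$ such that: (1) $y_1,\dots,y_m$ generate the maximal ideal of $k[[X_1,\dots,X_n]]$; (2) $y_1,\dots,y_m\notin I_{C_j}$ for $1\le j\le r$; (3) for each $1\le j\le r$ the numbers $\mathrm{ord}_{t_j}(y_s\circ\eta_{C_j})\in\mathbb Z_{>0}$, $s=1,\dots,m$, generate the group $\mathbb Z$; (4) the vectors $(\mathrm{ord}_{t_j}(y_1\circ\eta_{C_j}),\dots,\mathrm{ord}_{t_j}(y_m\circ\eta_{C_j}))$, $j=1,\dots,r$, are pairwise different. Moreover, for such functions, let $C\hookrightarrow k^m$ be the embedding defined by $y_1,\dots,y_m$, and let $\Sigma$ be any regular subdivision of the fan $\Sigma_{0,m}$ containing, for each $1\le j\le r$, the ray $\rho_j$ spanned by $\mathrm{ord}(\eta_j)=(\mathrm{ord}_{t_j}(y_1\circ\eta_{C_j}),\dots,\mathrm{ord}_{t_j}(y_m\circ\eta_{C_j}))$. Then the toric modification $\pi_{\Sigma_{0,m}}^{\Sigma}\colon X_\Sigma\to k^m$ is a toric embedded resolution of $C\subset k^m$.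
   Context: $k$ is an algebraically closed field of arbitrary characteristic. A curve is $\mathrm{Spec}\,\mathcal O$ with $\mathcal O$ a complete Noetherian local ring of dimension one over $k$ with residue field $k$; it is reduced if $\mathcal O$ is reduced and a branch if $\mathcal O$ is a domain. The branches $C_j$ of a reduced curve correspond to the minimal primes of $\mathcal O$. If $C\subset k^n$ is embedded as in the claim, $I_{C_j}\subset k[[X_1,\dots,X_n]]$ is the defining prime ideal of $C_j$, and $\eta_{C_j}\colon \mathrm{Spec}\,k[[t_j]]\to k^n$ is the composition of a normalization of $C_j$ with the inclusion $C_j\subset k^n$; $h\circ\eta_{C_j}\in k[[t_j]]$ is the image of $h$. If $y_1,\dots,y_m$ generate the maximal ideal of $k[[X_1,\dots,X_n]]$, the surjection $k[[Y_1,\dots,Y_m]]\to k[[X_1,\dots,X_n]]$, $Y_i\mapsto y_i$, gives an embedding $k^n\hookrightarrow k^m$ and, by composition, an embedding $C\hookrightarrow k^m$; $\eta_j$ is the composition of $\eta_{C_j}$ with $k^n\hookrightarrow k^m$. $\Sigma_{0,m}$ is the fan of faces of $\mathbb R_{\ge0}^m$ with respect to the lattice $\mathbb Z^m$, so $X_{\Sigma_{0,m}}=k^m$. A regular subdivision $\Sigma$ of $\Sigma_{0,m}$ is a fan with support $\mathbb R^m_{\ge 0}$ all of whose cones are spanned by part of a basis of $\mathbb Z^m$; $\pi_{\Sigma_{0,m}}^\Sigma\colon X_\Sigma\to k^m$ is the associated toric modification. Its exceptional locus is the union of the orbits $O(\sigma)_\Sigma$ with $\sigma\in\Sigma\setminus\Sigma_{0,m}$;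 its discriminant locus is the union of the orbits $O(\tau)_{\Sigma_{0,m}}$ with $\tau\in\Sigma_{0,m}\setminus\Sigma$. The strict transform $\tilde C$ of $C$ is the closure of the preimage of $C$ minus the exceptional locus. $\pi_{\Sigma_{0,m}}^\Sigma$ is a toric embedded resolution of $C$ if no branch of $C$ is contained in the discriminant locus, and $\tilde C$ is smooth and transversal to the orbit stratification of the exceptional locus. Transversality of a branch is tested inside the minimal coordinate subspace containing it: if this subspace is the closure of $O(\sigma)_{\Sigma_{0,m}}$ (then $\sigma\in\Sigma$), one considers the toric modification from the closure of $O(\sigma)_\Sigma$ onto it. *)

theory Defs
  imports
    "HOL-Algebra.Algebra"
    "HOL-Algebra.Algebraic_Closure_Type"
    "HOL-Computational_Algebra.Formal_Laurent_Series"
    "HOL-Library.Extended_Nat"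
begin

section \<open>Commutative algebra\<close>

abbreviation base_field :: "'k::alg_closed_field ring" where
  "base_field \<equiv> ring_of_type_algebra"

definition local_ring :: "('a, 'b) ring_scheme \<Rightarrow> bool" where
  "local_ring R \<longleftrightarrow> cring R \<and> (\<exists>!M. maximalideal M R)"

definition max_ideal :: "('a, 'b) ring_scheme \<Rightarrow> 'a set" where
  "max_ideal R = (THE M. maximalideal M R)"

definition minimal_primes :: "('a, 'b) ring_scheme \<Rightarrow> 'a set set" where
  "minimal_primes R = {P. primeideal P R \<and> (\<forall>Q. primeideal Q R \<and> Q \<subseteq> P \<longrightarrow> Q = P)}"

text \<open>Krull dimension. The zero ring, which has no prime ideal, gets dimension \<open>0\<close>.\<close>

definition krull_dim :: "('a, 'b) ring_scheme \<Rightarrow> enat" where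
  "krull_dim R = Sup {enat d | d. \<exists>P. (\<forall>i\<le>d. primeideal (P i) R) \<and> (\<forall>i<d. P i \<subset> P (Suc i))}"

definition reduced_ring :: "('a, 'b) ring_scheme \<Rightarrow> bool" where
  "reduced_ring R \<longleftrightarrow>
     (\<forall>a\<in>carrier R. \<forall>e::nat. a [^]\<^bsub>R\<^esub> e = \<zero>\<^bsub>R\<^esub> \<longrightarrow> a = \<zero>\<^bsub>R\<^esub>)"

text \<open>Completeness, including separatedness, for the \<open>I\<close>-adic topology.\<close>

definition adically_complete :: "('a, 'b) ring_scheme \<Rightarrow> 'a set \<Rightarrow> bool" where
  "adically_complete R I \<longleftrightarrow>
     (\<Inter>N::nat. I [^]\<^bsub>ideals_set R\<^esub> N) = {\<zero>\<^bsub>R\<^esub>} \<and>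
     (\<forall>a::nat \<Rightarrow> 'a. (\<forall>i. a i \<in> carrier R) \<longrightarrow>
        (\<forall>N::nat. \<exists>i0. \<forall>i\<ge>i0. \<forall>j\<ge>i0. a i \<ominus>\<^bsub>R\<^esub> a j \<in> I [^]\<^bsub>ideals_set R\<^esub> N) \<longrightarrow>
        (\<exists>l\<in>carrier R. \<forall>N::nat. \<exists>i0. \<forall>i\<ge>i0. a i \<ominus>\<^bsub>R\<^esub> l \<in> I [^]\<^bsub>ideals_set R\<^esub> N))"

text \<open>The fraction \<open>a / s\<close>, as an equivalence class of pairs, and the localization of \<open>R\<close> at
  the prime ideal \<open>Q\<close>.\<close>

definition fraction :: "('a, 'b) ring_scheme \<Rightarrow> 'a set \<Rightarrow> 'a \<Rightarrow> 'a \<Rightarrow> ('a \<times> 'a) set" where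
  "fraction R Q a s = {(b, t). b \<in> carrier R \<and> t \<in> carrier R - Q \<and>
     (\<exists>u\<in>carrier R - Q. u \<otimes>\<^bsub>R\<^esub> (t \<otimes>\<^bsub>R\<^esub> a \<ominus>\<^bsub>R\<^esub> s \<otimes>\<^bsub>R\<^esub> b) = \<zero>\<^bsub>R\<^esub>)}"

definition localization :: "('a, 'b) ring_scheme \<Rightarrow> 'a set \<Rightarrow> ('a \<times> 'a) set ring" where
  "localization R Q = \<lparr>
     carrier = {fraction R Q a s | a s. a \<in> carrier R \<and> s \<in> carrier R - Q},
     monoid.mult = (\<lambda>x y. \<Union>(a, s)\<in>x. \<Union>(b, t)\<in>y. fraction R Q (a \<otimes>\<^bsub>R\<^esub> b) (s \<otimes>\<^bsub>R\<^esub> t)),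
     one = fraction R Q \<one>\<^bsub>R\<^esub> \<one>\<^bsub>R\<^esub>,
     ring.zero = fraction R Q \<zero>\<^bsub>R\<^esub> \<one>\<^bsub>R\<^esub>,
     add = (\<lambda>x y. \<Union>(a, s)\<in>x. \<Union>(b, t)\<in>y.
       fraction R Q (t \<otimes>\<^bsub>R\<^esub> a \<oplus>\<^bsub>R\<^esub> s \<otimes>\<^bsub>R\<^esub> b) (s \<otimes>\<^bsub>R\<^esub> t)) \<rparr>"

definition regular_local_ring :: "('a, 'b) ring_scheme \<Rightarrow> bool" where
  "regular_local_ring R \<longleftrightarrow> local_ring R \<and> noetherian_ring R \<and>
     (\<exists>G\<subseteq>carrier R. finite G \<and> enat (card G) = krull_dim R \<and> genideal R G = max_ideal R)"

text \<open>A \<open>k\<close>-algebra is a ring \<open>A\<close> with a structure map \<open>\<iota>\<close> from \<open>k\<close> to \<open>A\<close>.\<close>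

definition kalg_hom ::
  "('a, 'x) ring_scheme \<Rightarrow> ('k \<Rightarrow> 'a) \<Rightarrow> ('b, 'y) ring_scheme \<Rightarrow> ('k \<Rightarrow> 'b) \<Rightarrow> ('a \<Rightarrow> 'b) set" where
  "kalg_hom A \<iota> B \<kappa> = {h \<in> ring_hom A B. \<forall>c. h (\<iota> c) = \<kappa> c}"

section \<open>Curves\<close>

text \<open>A curve is the spectrum of a complete Noetherian local \<open>k\<close>-algebra of dimension one with
  residue field \<open>k\<close>.\<close>

definition curve :: "('a, 'b) ring_scheme \<Rightarrow> ('k::alg_closed_field \<Rightarrow> 'a) \<Rightarrow> bool" where
  "curve R \<iota> \<longleftrightarrow>
     local_ring R \<and> noetherian_ring R \<and> adically_complete R (max_ideal R) \<and>
     \<iota> \<in> ring_hom base_field R \<and>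
     bij_betw (\<lambda>c. max_ideal R +>\<^bsub>R\<^esub> \<iota> c) UNIV (carrier (R Quot max_ideal R)) \<and>
     krull_dim R = 1"

text \<open>\<open>mps n\<close> is \<open>k[[X\<^sub>0,\<dots>,X\<^sub>n\<^sub>-\<^sub>1]]\<close>. A series is the function mapping each exponent to its
  coefficient; the multiset \<open>a\<close> stands for the monomial in which \<open>X\<^sub>i\<close> has exponent
  \<open>count a i\<close>.\<close>

definition mps :: "nat \<Rightarrow> (nat multiset \<Rightarrow> 'k::comm_ring_1) ring" where
  "mps n = \<lparr>
     carrier = {f. \<forall>a. f a \<noteq> 0 \<longrightarrow> set_mset a \<subseteq> {..<n}},
     monoid.mult = (\<lambda>f g a. \<Sum>b | b \<subseteq># a. f b * g (a - b)),
     one = (\<lambda>a. if a = {#} then 1 else 0),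
     ring.zero = (\<lambda>a. 0),
     add = (\<lambda>f g a. f a + g a) \<rparr>"

definition mps_const :: "'k \<Rightarrow> nat multiset \<Rightarrow> 'k::comm_ring_1" where
  "mps_const c = (\<lambda>a. if a = {#} then c else 0)"

definition mps_var :: "nat \<Rightarrow> nat multiset \<Rightarrow> 'k::comm_ring_1" where
  "mps_var i = (\<lambda>a. if a = {#i#} then 1 else 0)"

text \<open>The substitution homomorphism from \<open>k[[Y\<^sub>0,\<dots>,Y\<^sub>m\<^sub>-\<^sub>1]]\<close> to \<open>k[[X\<^sub>0,\<dots>,X\<^sub>n\<^sub>-\<^sub>1]]\<close> that maps
  \<open>Y\<^sub>i\<close> to \<open>y i\<close>, where all \<open>y i\<close> lie in the maximal ideal. A monomial of degree exceeding that
  of \<open>a\<close> does not contribute to the coefficient at \<open>a\<close>, so the sum is the full one.\<close>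

definition mps_subst ::
  "nat \<Rightarrow> nat \<Rightarrow> (nat \<Rightarrow> nat multiset \<Rightarrow> 'k) \<Rightarrow> (nat multiset \<Rightarrow> 'k) \<Rightarrow> nat multiset \<Rightarrow> 'k::comm_ring_1"
  where
  "mps_subst m n y F = (\<lambda>a. \<Sum>b | set_mset b \<subseteq> {..<m} \<and> size b \<le> size a.
     F b * finprod (mps n) (\<lambda>i. y i [^]\<^bsub>mps n\<^esub> count b i) {..<m} a)"

text \<open>The data of an embedding of a curve \<open>C\<close>, with ring \<open>R\<close>, in \<open>k\<^sup>n\<close>: \<open>\<phi>\<close> is the surjection
  and \<open>x\<close> the tuple of images of the variables.\<close>

definition curve_embedding ::
  "('a, 'b) ring_scheme \<Rightarrow> ('k::alg_closed_field \<Rightarrow> 'a) \<Rightarrow> nat \<Rightarrow> (nat \<Rightarrow> 'a) \<Rightarrow>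
   ((nat multiset \<Rightarrow> 'k) \<Rightarrow> 'a) \<Rightarrow> bool" where
  "curve_embedding R \<iota> n x \<phi> \<longleftrightarrow>
     x ` {..<n} \<subseteq> carrier R \<and> genideal R (x ` {..<n}) = max_ideal R \<and>
     \<phi> \<in> kalg_hom (mps n) mps_const R \<iota> \<and> \<phi> ` carrier (mps n) = carrier R \<and>
     (\<forall>i<n. \<phi> (mps_var i) = x i)"

text \<open>The ideal in \<open>k[[X\<^sub>0,\<dots>,X\<^sub>n\<^sub>-\<^sub>1]]\<close> of the closed subscheme of \<open>C\<close> given by the ideal \<open>P\<close> of
  the ring of \<open>C\<close>.\<close>

definition embedded_ideal ::
  "nat \<Rightarrow> ((nat multiset \<Rightarrow> 'k::comm_ring_1) \<Rightarrow> 'a) \<Rightarrow> 'a set \<Rightarrow> (nat multiset \<Rightarrow> 'k) set" where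
  "embedded_ideal n \<phi> P = {f \<in> carrier (mps n). \<phi> f \<in> P}"

definition integral_over :: "'a::comm_ring_1 set \<Rightarrow> 'a \<Rightarrow> bool" where
  "integral_over A g \<longleftrightarrow>
     (\<exists>p. lead_coeff p = 1 \<and> (\<forall>i. poly.coeff p i \<in> A) \<and> poly p g = 0)"

text \<open>\<open>\<eta>\<close> is (the ring map of) a normalization \<open>Spec k[[t]] \<rightarrow> B\<close>, followed by the inclusion of
  \<open>B\<close> in \<open>k\<^sup>n\<close>, where \<open>B\<close> is the branch with prime ideal \<open>I\<close>: the ring of \<open>B\<close> is
  identified with a subring \<open>A\<close> of \<open>k[[t]]\<close> such that \<open>k((t))\<close> is the field of fractions of
  \<open>A\<close>, and \<open>k[[t]]\<close> is the integral closure of \<open>A\<close> in this field.\<close>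

definition normalization_map ::
  "nat \<Rightarrow> (nat multiset \<Rightarrow> 'k) set \<Rightarrow> ((nat multiset \<Rightarrow> 'k::alg_closed_field) \<Rightarrow> 'k fps) \<Rightarrow> bool" where
  "normalization_map n I \<eta> \<longleftrightarrow>
     \<eta> \<in> kalg_hom (mps n) mps_const ring_of_type_algebra fps_const \<and>
     {f \<in> carrier (mps n). \<eta> f = 0} = I \<and>
     (let A = (\<lambda>f. fps_to_fls (\<eta> f)) ` carrier (mps n) in
        (\<forall>g. \<exists>a\<in>A. \<exists>b\<in>A. b \<noteq> 0 \<and> g = a / b) \<and>
        {g. integral_over A g} = range fps_to_fls)"

section \<open>Fans\<close>

text \<open>Vectors with \<open>m\<close> coordinates are functions vanishing at all \<open>i \<ge> m\<close>. Cones are subsets of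
  \<open>\<real>\<^sup>m\<close>; \<open>N\<close> and its dual \<open>M\<close> are both \<open>\<int>\<^sup>m\<close>.\<close>

definition lattice_vectors :: "nat \<Rightarrow> (nat \<Rightarrow> int) set" where
  "lattice_vectors m = {v. \<forall>i\<ge>m. v i = 0}"

definition real_vec :: "(nat \<Rightarrow> int) \<Rightarrow> nat \<Rightarrow> real" where
  "real_vec v = (\<lambda>i. real_of_int (v i))"

definition pairing :: "nat \<Rightarrow> (nat \<Rightarrow> real) \<Rightarrow> (nat \<Rightarrow> real) \<Rightarrow> real" where
  "pairing m u v = (\<Sum>i<m. u i * v i)"

definition lattice_basis :: "nat \<Rightarrow> (nat \<Rightarrow> int) set \<Rightarrow> bool" where
  "lattice_basis m B \<longleftrightarrow> finite B \<and> B \<subseteq> lattice_vectors m \<and>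
     (\<forall>w\<in>lattice_vectors m. \<exists>!c::(nat \<Rightarrow> int) \<Rightarrow> int.
        (\<forall>v. v \<notin> B \<longrightarrow> c v = 0) \<and> w = (\<lambda>i. \<Sum>v\<in>B. c v * v i))"

definition cone_spanned :: "(nat \<Rightarrow> int) set \<Rightarrow> (nat \<Rightarrow> real) set" where
  "cone_spanned G = {x. \<exists>c::(nat \<Rightarrow> int) \<Rightarrow> real.
     (\<forall>v\<in>G. 0 \<le> c v) \<and> x = (\<lambda>i. \<Sum>v\<in>G. c v * real_of_int (v i))}"

definition regular_cone :: "nat \<Rightarrow> (nat \<Rightarrow> real) set \<Rightarrow> bool" where
  "regular_cone m \<sigma> \<longleftrightarrow> (\<exists>B G. lattice_basis m B \<and> G \<subseteq> B \<and> \<sigma> = cone_spanned G)"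

definition is_face :: "nat \<Rightarrow> (nat \<Rightarrow> real) set \<Rightarrow> (nat \<Rightarrow> real) set \<Rightarrow> bool" where
  "is_face m \<tau> \<sigma> \<longleftrightarrow>
     (\<exists>u. (\<forall>v\<in>\<sigma>. 0 \<le> pairing m u v) \<and> \<tau> = {v\<in>\<sigma>. pairing m u v = 0})"

definition orthant :: "nat \<Rightarrow> (nat \<Rightarrow> real) set" where
  "orthant m = {v. (\<forall>i. 0 \<le> v i) \<and> (\<forall>i\<ge>m. v i = 0)}"

definition orthant_fan :: "nat \<Rightarrow> (nat \<Rightarrow> real) set set" where
  "orthant_fan m = {\<tau>. is_face m \<tau> (orthant m)}"

definition regular_subdivision :: "nat \<Rightarrow> (nat \<Rightarrow> real) set set \<Rightarrow> bool" where
  "regular_subdivision m \<Sigma> \<longleftrightarrow>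
     finite \<Sigma> \<and>
     (\<forall>\<sigma>\<in>\<Sigma>. regular_cone m \<sigma>) \<and>
     (\<forall>\<sigma>\<in>\<Sigma>. \<forall>\<tau>. is_face m \<tau> \<sigma> \<longrightarrow> \<tau> \<in> \<Sigma>) \<and>
     (\<forall>\<sigma>\<in>\<Sigma>. \<forall>\<tau>\<in>\<Sigma>. is_face m (\<sigma> \<inter> \<tau>) \<sigma> \<and> is_face m (\<sigma> \<inter> \<tau>) \<tau>) \<and>
     \<Union>\<Sigma> = orthant m"

definition perp :: "nat \<Rightarrow> (nat \<Rightarrow> real) set \<Rightarrow> (nat \<Rightarrow> int) set" where
  "perp m \<tau> = {u \<in> lattice_vectors m. \<forall>v\<in>\<tau>. pairing m (real_vec u) v = 0}"

text \<open>The monoid \<open>S\<^sub>\<sigma>\<close> of lattice points of the dual cone of \<open>\<sigma>\<close>; the affine toric chart of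
  \<open>\<sigma>\<close> is \<open>U\<^sub>\<sigma> = Spec k[S\<^sub>\<sigma>]\<close>.\<close>

definition dual_monoid :: "nat \<Rightarrow> (nat \<Rightarrow> real) set \<Rightarrow> (nat \<Rightarrow> int) set" where
  "dual_monoid m \<sigma> = {u \<in> lattice_vectors m. \<forall>v\<in>\<sigma>. 0 \<le> pairing m (real_vec u) v}"

definition unit_vec :: "nat \<Rightarrow> nat \<Rightarrow> int" where
  "unit_vec i = (\<lambda>j. if j = i then 1 else 0)"

text \<open>The algebra \<open>R[S]\<close> of a submonoid \<open>S\<close> of \<open>\<int>\<^sup>m\<close>; \<open>character R c u\<close> is \<open>c \<chi>\<^sup>u\<close>.\<close>

definition monoid_algebra ::
  "('a, 'b) ring_scheme \<Rightarrow> (nat \<Rightarrow> int) set \<Rightarrow> ((nat \<Rightarrow> int) \<Rightarrow> 'a) ring" where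
  "monoid_algebra R S = \<lparr>
     carrier = {f. (\<forall>u. f u \<in> carrier R) \<and> finite {u. f u \<noteq> \<zero>\<^bsub>R\<^esub>} \<and> {u. f u \<noteq> \<zero>\<^bsub>R\<^esub>} \<subseteq> S},
     monoid.mult = (\<lambda>f g w. finsum R (\<lambda>u. f u \<otimes>\<^bsub>R\<^esub> g (w - u)) {u. f u \<noteq> \<zero>\<^bsub>R\<^esub>}),
     one = (\<lambda>u. if u = (\<lambda>_. 0) then \<one>\<^bsub>R\<^esub> else \<zero>\<^bsub>R\<^esub>),
     ring.zero = (\<lambda>u. \<zero>\<^bsub>R\<^esub>),
     add = (\<lambda>f g u. f u \<oplus>\<^bsub>R\<^esub> g u) \<rparr>"

definition character :: "('a, 'b) ring_scheme \<Rightarrow> 'a \<Rightarrow> (nat \<Rightarrow> int) \<Rightarrow> (nat \<Rightarrow> int) \<Rightarrow> 'a" where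
  "character R c u = (\<lambda>v. if v = u then c else \<zero>\<^bsub>R\<^esub>)"

definition alg_const :: "('a, 'b) ring_scheme \<Rightarrow> 'a \<Rightarrow> (nat \<Rightarrow> int) \<Rightarrow> 'a" where
  "alg_const R c = character R c (\<lambda>_. 0)"

section \<open>Strict transforms\<close>

text \<open>In this section \<open>C = Spec R\<close> is a curve embedded in \<open>k\<^sup>m\<close>, and \<open>z i \<in> R\<close> is the
  restriction to \<open>C\<close> of the \<open>i\<close>-th coordinate function. Over the chart \<open>U\<^sub>\<sigma>\<close>, the preimage of
  \<open>C\<close> under the toric modification is the fibre product of \<open>U\<^sub>\<sigma>\<close> and \<open>C\<close> over \<open>k\<^sup>m\<close>.
  The coordinates of \<open>k\<^sup>m\<close> pull back to the characters of the unit vectors, so the fibre product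
  is the closed subscheme of \<open>U\<^sub>\<sigma> \<times> C = Spec R[S\<^sub>\<sigma>]\<close> with ideal \<open>preimage_ideal m R z \<sigma>\<close>.
  Its points are the primes of \<open>R[S\<^sub>\<sigma>]\<close> that contain this ideal.\<close>

abbreviation chart_ring ::
  "nat \<Rightarrow> ('a, 'b) ring_scheme \<Rightarrow> (nat \<Rightarrow> real) set \<Rightarrow> ((nat \<Rightarrow> int) \<Rightarrow> 'a) ring" where
  "chart_ring m R \<sigma> \<equiv> monoid_algebra R (dual_monoid m \<sigma>)"

definition preimage_ideal ::
  "nat \<Rightarrow> ('a, 'b) ring_scheme \<Rightarrow> (nat \<Rightarrow> 'a) \<Rightarrow> (nat \<Rightarrow> real) set \<Rightarrow> ((nat \<Rightarrow> int) \<Rightarrow> 'a) set" where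
  "preimage_ideal m R z \<sigma> = genideal (chart_ring m R \<sigma>)
     {character R \<one>\<^bsub>R\<^esub> (unit_vec i) \<ominus>\<^bsub>chart_ring m R \<sigma>\<^esub> alg_const R (z i) | i. i < m}"

text \<open>The orbit of a face \<open>\<tau>\<close> of \<open>\<sigma>\<close> consists of the points of \<open>U\<^sub>\<sigma>\<close> at which precisely
  the characters orthogonal to \<open>\<tau>\<close> do not vanish.\<close>

definition in_orbit ::
  "nat \<Rightarrow> ('a, 'b) ring_scheme \<Rightarrow> (nat \<Rightarrow> real) set \<Rightarrow> (nat \<Rightarrow> real) set \<Rightarrow>
   ((nat \<Rightarrow> int) \<Rightarrow> 'a) set \<Rightarrow> bool" where
  "in_orbit m R \<sigma> \<tau> Q \<longleftrightarrow> is_face m \<tau> \<sigma> \<and>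
     (\<forall>u\<in>dual_monoid m \<sigma>. character R \<one>\<^bsub>R\<^esub> u \<notin> Q \<longleftrightarrow> u \<in> perp m \<tau>)"

definition in_exceptional ::
  "nat \<Rightarrow> ('a, 'b) ring_scheme \<Rightarrow> (nat \<Rightarrow> real) set set \<Rightarrow> (nat \<Rightarrow> real) set \<Rightarrow>
   ((nat \<Rightarrow> int) \<Rightarrow> 'a) set \<Rightarrow> bool" where
  "in_exceptional m R \<Sigma> \<sigma> Q \<longleftrightarrow> (\<exists>\<tau>\<in>\<Sigma> - orthant_fan m. in_orbit m R \<sigma> \<tau> Q)"

text \<open>The ideal of \<open>R[S\<^sub>\<sigma>]\<close> that defines, over \<open>U\<^sub>\<sigma>\<close>, the strict transform of the closed subset
  \<open>V(P)\<close> of \<open>C\<close>. It is the intersection of all points of the preimage of \<open>V(P)\<close> outside the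
  exceptional locus, that is, the ideal of the closure of the set of these points with its reduced
  structure.\<close>

definition strict_transform_ideal ::
  "nat \<Rightarrow> ('a, 'b) ring_scheme \<Rightarrow> (nat \<Rightarrow> 'a) \<Rightarrow> (nat \<Rightarrow> real) set set \<Rightarrow> (nat \<Rightarrow> real) set \<Rightarrow>
   'a set \<Rightarrow> ((nat \<Rightarrow> int) \<Rightarrow> 'a) set" where
  "strict_transform_ideal m R z \<Sigma> \<sigma> P = carrier (chart_ring m R \<sigma>) \<inter>
     \<Inter>{Q. primeideal Q (chart_ring m R \<sigma>) \<and> preimage_ideal m R z \<sigma> \<subseteq> Q \<and>
          alg_const R ` P \<subseteq> Q \<and> \<not> in_exceptional m R \<Sigma> \<sigma> Q}"

text \<open>The point \<open>q\<close> of \<open>C\<close> lies in the orbit of \<open>\<tau>\<close> in \<open>k\<^sup>m\<close>: the coordinates vanishing at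
  \<open>q\<close> are those whose unit vectors lie in \<open>\<tau>\<close>.\<close>

definition in_coordinate_orbit ::
  "nat \<Rightarrow> (nat \<Rightarrow> 'a) \<Rightarrow> (nat \<Rightarrow> real) set \<Rightarrow> 'a set \<Rightarrow> bool" where
  "in_coordinate_orbit m z \<tau> q \<longleftrightarrow> (\<forall>i<m. z i \<in> q \<longleftrightarrow> real_vec (unit_vec i) \<in> \<tau>)"

definition contained_in_discriminant ::
  "nat \<Rightarrow> ('a, 'b) ring_scheme \<Rightarrow> (nat \<Rightarrow> 'a) \<Rightarrow> (nat \<Rightarrow> real) set set \<Rightarrow> 'a set \<Rightarrow> bool" where
  "contained_in_discriminant m R z \<Sigma> P \<longleftrightarrow>
     (\<forall>q. primeideal q R \<and> P \<subseteq> q \<longrightarrow> (\<exists>\<tau>\<in>orthant_fan m - \<Sigma>. in_coordinate_orbit m z \<tau> q))"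

text \<open>Smoothness means that all local rings are regular; the strict transform of a formal curve is
  not of finite type over \<open>k\<close>.\<close>

definition smooth_strict_transform ::
  "nat \<Rightarrow> ('a, 'b) ring_scheme \<Rightarrow> (nat \<Rightarrow> 'a) \<Rightarrow> (nat \<Rightarrow> real) set set \<Rightarrow> bool" where
  "smooth_strict_transform m R z \<Sigma> \<longleftrightarrow>
     (\<forall>\<sigma>\<in>\<Sigma>. let B = chart_ring m R \<sigma> Quot strict_transform_ideal m R z \<Sigma> \<sigma> {\<zero>\<^bsub>R\<^esub>} in
        \<forall>Q. primeideal Q B \<longrightarrow> regular_local_ring (localization B Q))"

section \<open>Transversality\<close>

text \<open>The Zariski tangent space, at a \<open>k\<close>-rational point given by the homomorphism \<open>p\<close> from
  \<open>A\<close> to \<open>k\<close>, of the closed subscheme of \<open>Spec A\<close> with ideal \<open>I\<close>, as a space of point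
  derivations of \<open>A\<close>.\<close>

definition tangent_space ::
  "('a, 'b) ring_scheme \<Rightarrow> ('k::alg_closed_field \<Rightarrow> 'a) \<Rightarrow> 'a set \<Rightarrow> ('a \<Rightarrow> 'k) \<Rightarrow> ('a \<Rightarrow> 'k) set" where
  "tangent_space A \<iota> I p = {D \<in> extensional (carrier A).
     (\<forall>f\<in>carrier A. \<forall>g\<in>carrier A. D (f \<oplus>\<^bsub>A\<^esub> g) = D f + D g) \<and>
     (\<forall>f\<in>carrier A. \<forall>g\<in>carrier A. D (f \<otimes>\<^bsub>A\<^esub> g) = p f * D g + p g * D f) \<and>
     (\<forall>c. D (\<iota> c) = 0) \<and> (\<forall>f\<in>I. D f = 0)}"

text \<open>The ideal in \<open>k[S\<^sub>\<sigma>]\<close> of the closure of the orbit of a face \<open>\<tau>\<close> of \<open>\<sigma>\<close>. The orbit is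
  open in its closure, so it has the same tangent spaces at its own points.\<close>

definition orbit_closure_ideal ::
  "nat \<Rightarrow> (nat \<Rightarrow> real) set \<Rightarrow> (nat \<Rightarrow> real) set \<Rightarrow> ((nat \<Rightarrow> int) \<Rightarrow> 'k::alg_closed_field) set" where
  "orbit_closure_ideal m \<sigma> \<tau> = genideal (chart_ring m base_field \<sigma>)
     {character base_field 1 u | u. u \<in> dual_monoid m \<sigma> \<and> u \<notin> perp m \<tau>}"

text \<open>Let \<open>p\<close> be a \<open>k\<close>-rational point of \<open>U\<^sub>\<sigma> \<times> C\<close>, and let \<open>q\<close> be its image in \<open>U\<^sub>\<sigma>\<close>.
  Precomposition with \<open>\<lambda>f u. \<iota> (f u)\<close>, the inclusion of \<open>k[S\<^sub>\<sigma>]\<close> in \<open>R[S\<^sub>\<sigma>]\<close>, maps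
  tangent vectors at \<open>p\<close> to tangent vectors at \<open>q\<close>. The condition is that the images of the
  tangent vectors at \<open>p\<close> of the closed subscheme with ideal \<open>J\<close>, together with the tangent space
  of the orbit of \<open>\<tau>\<close>, span the tangent space at \<open>q\<close> of the closure of the orbit of \<open>\<sigma>0\<close>.\<close>

definition transversal_at ::
  "nat \<Rightarrow> ('a, 'b) ring_scheme \<Rightarrow> ('k::alg_closed_field \<Rightarrow> 'a) \<Rightarrow> (nat \<Rightarrow> real) set \<Rightarrow>
   (nat \<Rightarrow> real) set \<Rightarrow> (nat \<Rightarrow> real) set \<Rightarrow> ((nat \<Rightarrow> int) \<Rightarrow> 'a) set \<Rightarrow>
   (((nat \<Rightarrow> int) \<Rightarrow> 'a) \<Rightarrow> 'k) \<Rightarrow> bool" where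
  "transversal_at m R \<iota> \<sigma> \<sigma>0 \<tau> J p \<longleftrightarrow>
     (let A = chart_ring m base_field \<sigma>;
          q = (\<lambda>f. p (\<lambda>u. \<iota> (f u)));
          T = (\<lambda>I. tangent_space A (alg_const base_field) I q);
          TC = (\<lambda>D. \<lambda>f\<in>carrier A. D (\<lambda>u. \<iota> (f u))) `
                 tangent_space (chart_ring m R \<sigma>) (\<lambda>c. alg_const R (\<iota> c)) J p
      in {\<lambda>f\<in>carrier A. D f + E f | D E. D \<in> TC \<and> E \<in> T (orbit_closure_ideal m \<sigma> \<tau>)}
         = T (orbit_closure_ideal m \<sigma> \<sigma>0))"

text \<open>For a set \<open>S\<close> of coordinates, the cone whose orbit closure in \<open>k\<^sup>m\<close> is the coordinate
  subspace where the coordinates in \<open>S\<close> vanish.\<close>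

definition coordinate_cone :: "nat \<Rightarrow> nat set \<Rightarrow> (nat \<Rightarrow> real) set" where
  "coordinate_cone m S = {v \<in> orthant m. \<forall>i. i \<notin> S \<longrightarrow> v i = 0}"

text \<open>The cones of \<open>\<Sigma>\<close> whose orbits form the exceptional locus of the toric modification from the
  closure of the orbit of \<open>\<sigma>0 = coordinate_cone m S\<close> in \<open>X\<^sub>\<Sigma>\<close> onto its closure in \<open>k\<^sup>m\<close>.
  The fans of these two toric varieties consist of the images of the cones with face \<open>\<sigma>0\<close> in the
  quotient of \<open>\<real>\<^sup>m\<close> by the span of \<open>\<sigma>0\<close>. Setting the coordinates in \<open>S\<close> to zero identifies this
  quotient with a subspace of \<open>\<real>\<^sup>m\<close>.\<close>

definition exceptional_cones ::
  "nat \<Rightarrow> (nat \<Rightarrow> real) set set \<Rightarrow> nat set \<Rightarrow> (nat \<Rightarrow> real) set set" where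
  "exceptional_cones m \<Sigma> S =
     (let \<sigma>0 = coordinate_cone m S; pr = (\<lambda>v i. if i \<in> S then 0 else v i) in
      {\<tau>\<in>\<Sigma>. is_face m \<sigma>0 \<tau> \<and>
        pr ` \<tau> \<notin> {pr ` \<tau>' | \<tau>'. \<tau>' \<in> orthant_fan m \<and> is_face m \<sigma>0 \<tau>'}})"

text \<open>Transversality of the strict transform of the branch with minimal prime \<open>P\<close>. The set \<open>S\<close>
  consists of all coordinates vanishing on the branch, so the minimal coordinate subspace
  containing the branch is the closure of the orbit of \<open>coordinate_cone m S\<close>.\<close>

definition transversal_branch ::
  "nat \<Rightarrow> ('a, 'b) ring_scheme \<Rightarrow> ('k::alg_closed_field \<Rightarrow> 'a) \<Rightarrow> (nat \<Rightarrow> 'a) \<Rightarrow>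
   (nat \<Rightarrow> real) set set \<Rightarrow> 'a set \<Rightarrow> bool" where
  "transversal_branch m R \<iota> z \<Sigma> P \<longleftrightarrow>
     (let S = {i. i < m \<and> z i \<in> P} in
      \<forall>\<sigma>\<in>\<Sigma>. \<forall>\<tau>\<in>exceptional_cones m \<Sigma> S.
        \<forall>p\<in>kalg_hom (chart_ring m R \<sigma>) (\<lambda>c. alg_const R (\<iota> c)) base_field id.
          let J = strict_transform_ideal m R z \<Sigma> \<sigma> P in
          J \<subseteq> a_kernel (chart_ring m R \<sigma>) base_field p \<and>
          in_orbit m R \<sigma> \<tau> (a_kernel (chart_ring m R \<sigma>) base_field p) \<longrightarrow>
          transversal_at m R \<iota> \<sigma> (coordinate_cone m S) \<tau> J p)"

text \<open>The toric modification of \<open>k\<^sup>m\<close> given by the subdivision \<open>\<Sigma>\<close> is a toric embedded resolution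
  of the curve \<open>C = Spec R\<close>, embedded in \<open>k\<^sup>m\<close> by the surjection \<open>\<psi>\<close> from
  \<open>k[[Y\<^sub>0,\<dots>,Y\<^sub>m\<^sub>-\<^sub>1]]\<close> to \<open>R\<close>.\<close>

definition toric_embedded_resolution ::
  "('a, 'b) ring_scheme \<Rightarrow> ('k::alg_closed_field \<Rightarrow> 'a) \<Rightarrow> nat \<Rightarrow>
   ((nat multiset \<Rightarrow> 'k) \<Rightarrow> 'a) \<Rightarrow> (nat \<Rightarrow> real) set set \<Rightarrow> bool" where
  "toric_embedded_resolution R \<iota> m \<psi> \<Sigma> \<longleftrightarrow>
     (let z = (\<lambda>i. \<psi> (mps_var i)) in
      (\<forall>P\<in>minimal_primes R. \<not> contained_in_discriminant m R z \<Sigma> P) \<and>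
      smooth_strict_transform m R z \<Sigma> \<and>
      (\<forall>P\<in>minimal_primes R. transversal_branch m R \<iota> z \<Sigma> P))"

section \<open>Orders along the branches\<close>

text \<open>The vector of orders of \<open>y 0, \<dots>, y (m - 1)\<close> along a parametrized branch.\<close>

definition ord_vector ::
  "nat \<Rightarrow> ((nat multiset \<Rightarrow> 'k::zero) \<Rightarrow> 'k fps) \<Rightarrow> (nat \<Rightarrow> nat multiset \<Rightarrow> 'k) \<Rightarrow> nat \<Rightarrow> int" where
  "ord_vector m \<eta> y = (\<lambda>s. if s < m then int (subdegree (\<eta> (y s))) else 0)"

text \<open>The conditions on \<open>y\<close> for branches with ideals \<open>I j\<close> and parametrizations \<open>\<eta> j\<close>,
  \<open>j < r\<close>.\<close>

definition torifying_functions ::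
  "nat \<Rightarrow> nat \<Rightarrow> (nat \<Rightarrow> (nat multiset \<Rightarrow> 'k) set) \<Rightarrow>
   (nat \<Rightarrow> (nat multiset \<Rightarrow> 'k::alg_closed_field) \<Rightarrow> 'k fps) \<Rightarrow>
   nat \<Rightarrow> (nat \<Rightarrow> nat multiset \<Rightarrow> 'k) \<Rightarrow> bool" where
  "torifying_functions n r I \<eta> m y \<longleftrightarrow>
     y ` {..<m} \<subseteq> carrier (mps n) \<and>
     genideal (mps n) (y ` {..<m}) = max_ideal (mps n) \<and>
     (\<forall>j<r. \<forall>s<m. y s \<notin> I j) \<and>
     (\<forall>j<r. (\<forall>s<m. 0 < ord_vector m (\<eta> j) y s) \<and>
        generate integer_group (ord_vector m (\<eta> j) y ` {..<m}) = carrier integer_group) \<and>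
     (\<forall>j<r. \<forall>j'<r. j \<noteq> j' \<longrightarrow> ord_vector m (\<eta> j) y \<noteq> ord_vector m (\<eta> j') y)"

end

theory Submission
  imports Defs "HOL-Library.Function_Algebras"
begin

text \<open>For a branch \<open>j\<close> with parametrization \<open>\<eta> j\<close>, let \<open>v j\<close> be the vector of orders of the coordinates.

  Suitable coordinates exist because \<open>t\<close> is a quotient of two functions on the branch, which yields
  functions whose orders differ by one (\<open>consecutive_orders\<close>), and because the prime ideals of the
  branches are incomparable, which yields functions that vanish on all branches but one
  (\<open>branch_isolating_function\<close>). Adding a high power of a function that vanishes on no branch makes
  the infinite orders finite and large without changing the finite ones.

  The resolution is studied in the chart of a cone \<open>\<sigma>\<close>. A point of the preimage of the curve lies over a
  prime ideal of its ring, which in dimension one is the prime ideal of a branch or the maximal ideal.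
  Over the maximal ideal all coordinates vanish, so such points are exceptional, unless the chart is
  the affine space. Hence the strict transform of a branch has as its ideal the kernel of the map \<open>H j\<close>
  from the chart ring to \<open>k((t))\<close> that restricts functions to the branch (\<open>strict_transform_curve\<close>,
  \<open>strict_transform_branch\<close>).

  Under \<open>H j\<close>, the character with exponent \<open>u\<close> gets the pairing of \<open>u\<close> with \<open>v j\<close> as its order. The vector
  \<open>v j\<close> is primitive and spans a cone of the fan, so either it is a generator of \<open>\<sigma>\<close>, or it lies outside
  \<open>\<sigma>\<close>. In both cases there is a character of order one. Powers of a uniformizer generate
  \<open>k[[t]]\<close> over the ring of the branch (\<open>powers_of_uniformizer_generate\<close>), so the image of \<open>H j\<close> is
  \<open>k[[t]]\<close> in the first case; in the second case there is also a character of negative order and the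
  image is \<open>k((t))\<close>. Branches with closed points in the same chart belong to different generators of
  \<open>\<sigma>\<close> and do not meet (\<open>disjoint_branches\<close>). So the local rings of the strict transform are \<open>k[[t]]\<close>
  and \<open>k((t))\<close>, which are regular.

  The closed point of a branch is the evaluation at \<open>t = 0\<close>. The character dual to the generator \<open>v j\<close> has
  a nonzero derivative along the branch there, and it divides all characters vanishing at this point.
  Therefore the tangent line of the branch and the tangent space of the orbit span the tangent space
  of the chart (\<open>transversal_strict_transform\<close>).\<close>

section \<open>Commutative algebra\<close>

lemma ring_of_type_algebra_simps [simp]:
  "carrier ring_of_type_algebra = UNIV"
  "x \<otimes>\<^bsub>ring_of_type_algebra\<^esub> y = x * y"
  "\<one>\<^bsub>ring_of_type_algebra\<^esub> = 1"
  "\<zero>\<^bsub>ring_of_type_algebra\<^esub> = 0"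
  "x \<oplus>\<^bsub>ring_of_type_algebra\<^esub> y = x + y"
  by (simp_all add: ring_of_type_algebra_def)

text \<open>A product of elements outside a prime ideal stays outside, and it lies in all ideals that
  contain one of the factors.\<close>

lemma (in cring) exists_in_ideals_avoiding_prime:
  assumes "primeideal Q R" and "finite F"
    and "\<And>j. j \<in> F \<Longrightarrow> ideal (I j) R" and "\<And>j. j \<in> F \<Longrightarrow> \<not> I j \<subseteq> Q"
  shows "\<exists>a\<in>carrier R. a \<notin> Q \<and> (\<forall>j\<in>F. a \<in> I j)"
  using assms(2-4)
proof (induction F rule: finite_induct)
  case empty
  interpret primeideal Q R by fact
  show ?case using one_imp_carrier I_notcarr by (intro bexI[of _ \<one>]) auto
next
  case (insert j F)
  interpret primeideal Q R by fact
  obtain a where a: "a \<in> carrier R" "a \<notin> Q" "\<forall>i\<in>F. a \<in> I i" using insert by auto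
  obtain b where b: "b \<in> I j" "b \<notin> Q" using insert.prems(2)[of j] by auto
  have "b \<in> carrier R" using b(1) ideal.Icarr insert.prems(1) by fastforce
  show ?case
  proof (intro bexI[of _ "a \<otimes> b"] conjI ballI)
    show "a \<otimes> b \<notin> Q" using I_prime a b \<open>b \<in> carrier R\<close> by blast
    fix i assume "i \<in> insert j F"
    then show "a \<otimes> b \<in> I i"
      using a b \<open>b \<in> carrier R\<close> insert.prems(1)
      by (metis ideal.I_l_closed ideal.I_r_closed insert_iff)
  qed (use a \<open>b \<in> carrier R\<close> in auto)
qed

text \<open>This replaces the binomial theorem in the proof that the elements annihilated by a
  multiplicative set form an ideal.\<close>

lemma (in cring) annihilating_powers_add:
  assumes "x \<in> carrier R" "y \<in> carrier R" "w \<in> carrier R"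
    and "x [^] (n::nat) \<otimes> w = \<zero>" "y [^] (l::nat) \<otimes> w = \<zero>"
  shows "(x \<oplus> y) [^] (n + l) \<otimes> w = \<zero>"
  using assms
proof (induction "n + l" arbitrary: n l w)
  case 0
  then show ?case by simp
next
  case (Suc k)
  show ?case
  proof (cases "n = 0 \<or> l = 0")
    case True
    then have "w = \<zero>" using Suc.prems by auto
    then show ?thesis using Suc.prems by simp
  next
    case False
    then obtain n' l' where nl: "n = Suc n'" "l = Suc l'" by (meson not0_implies_Suc)
    have 1: "(x \<oplus> y) [^] (n' + l) \<otimes> (x \<otimes> w) = \<zero>"
    proof (rule Suc.hyps(1))
      show "x [^] n' \<otimes> (x \<otimes> w) = \<zero>" using Suc.prems nl by (simp add: m_assoc[symmetric])
      have "y [^] l \<otimes> (x \<otimes> w) = x \<otimes> (y [^] l \<otimes> w)"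
        using Suc.prems by (simp add: m_lcomm)
      then show "y [^] l \<otimes> (x \<otimes> w) = \<zero>" using Suc.prems by simp
    qed (use Suc nl in auto)
    have 2: "(x \<oplus> y) [^] (n + l') \<otimes> (y \<otimes> w) = \<zero>"
    proof (rule Suc.hyps(1))
      show "y [^] l' \<otimes> (y \<otimes> w) = \<zero>" using Suc.prems nl by (simp add: m_assoc[symmetric])
      have "x [^] n \<otimes> (y \<otimes> w) = y \<otimes> (x [^] n \<otimes> w)"
        using Suc.prems by (simp add: m_lcomm)
      then show "x [^] n \<otimes> (y \<otimes> w) = \<zero>" using Suc.prems by simp
    qed (use Suc nl in auto)
    have "(x \<oplus> y) [^] (n + l) \<otimes> w = (x \<oplus> y) [^] (n' + l) \<otimes> ((x \<oplus> y) \<otimes> w)"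
      using Suc.prems nl by (simp add: m_assoc)
    also have "\<dots> = (x \<oplus> y) [^] (n' + l) \<otimes> (x \<otimes> w) \<oplus> (x \<oplus> y) [^] (n + l') \<otimes> (y \<otimes> w)"
      using Suc.prems nl by (simp add: l_distr r_distr)
    finally show ?thesis using 1 2 by simp
  qed
qed

text \<open>The complement of a maximal multiplicative set avoiding \<open>\<zero>\<close> is a minimal prime.\<close>

lemma (in cring) minimal_prime_avoiding_nonnilpotent:
  assumes a: "a \<in> carrier R" and nonnil: "\<And>e::nat. a [^] e \<noteq> \<zero>"
  shows "\<exists>P\<in>minimal_primes R. a \<notin> P"
proof -
  define A where "A = {S. S \<subseteq> carrier R \<and> \<one> \<in> S \<and> a \<in> S \<and> (\<forall>x\<in>S. \<forall>y\<in>S. x \<otimes> y \<in> S) \<and> \<zero> \<notin> S}"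
  have "range (\<lambda>e::nat. a [^] e) \<in> A"
  proof -
    have "\<one> = a [^] (0::nat)" "a = a [^] (1::nat)" using a by auto
    moreover have "a [^] (i::nat) \<otimes> a [^] (j::nat) = a [^] (i + j)" for i j
      using a by (simp add: nat_pow_mult)
    ultimately show ?thesis unfolding A_def using a nonnil[symmetric]
      by (auto intro: range_eqI[of _ _ "0::nat"] range_eqI[of _ _ "1::nat"])
  qed
  moreover have "\<Union>C \<in> A" if "C \<noteq> {}" "subset.chain A C" for C
  proof -
    have C: "C \<subseteq> A" "\<And>K L. K \<in> C \<Longrightarrow> L \<in> C \<Longrightarrow> K \<subseteq> L \<or> L \<subseteq> K"
      using that by (auto simp: subset_chain_def)
    have "x \<otimes> y \<in> \<Union>C" if xy: "x \<in> \<Union>C" "y \<in> \<Union>C" for x y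
    proof -
      obtain K L where K: "x \<in> K" "K \<in> C" and L: "y \<in> L" "L \<in> C" using xy by auto
      then obtain W where "W \<in> C" "x \<in> W" "y \<in> W" using C(2)[OF K(2) L(2)] by auto
      then show ?thesis using C(1) unfolding A_def by auto
    qed
    then show ?thesis using C(1) \<open>C \<noteq> {}\<close> unfolding A_def by auto
  qed
  ultimately obtain S where S: "S \<in> A" and max: "\<And>K. K \<in> A \<Longrightarrow> S \<subseteq> K \<Longrightarrow> K = S"
    using subset_Zorn_nonempty[of A] by blast
  have S1: "S \<subseteq> carrier R" "\<one> \<in> S" "a \<in> S" "\<zero> \<notin> S" and Sm: "\<And>x y. x \<in> S \<Longrightarrow> y \<in> S \<Longrightarrow> x \<otimes> y \<in> S"
    using S unfolding A_def by auto
  have Spow: "x [^] (n::nat) \<in> S" if "x \<in> S" for x n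
    by (induction n) (use that S1 Sm in auto)
  have notinS: "x \<notin> S \<longleftrightarrow> (\<exists>n::nat. \<exists>s\<in>S. x [^] n \<otimes> s = \<zero>)" if x: "x \<in> carrier R" for x
  proof
    assume "\<exists>n::nat. \<exists>s\<in>S. x [^] n \<otimes> s = \<zero>"
    then show "x \<notin> S" using Spow Sm S1 by metis
  next
    assume "x \<notin> S"
    define K where "K = {x [^] n \<otimes> s | (n::nat) s. s \<in> S}"
    have SX: "S \<subseteq> K"
    proof
      fix s assume "s \<in> S"
      then have "s = x [^] (0::nat) \<otimes> s" using S1 by auto
      then show "s \<in> K" unfolding K_def using \<open>s \<in> S\<close> by blast
    qed
    have "x = x [^] (1::nat) \<otimes> \<one>" using x by simp
    then have "x \<in> K" unfolding K_def using S1 by blast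
    then have "K \<notin> A" using max SX \<open>x \<notin> S\<close> by blast
    moreover have "u \<otimes> v \<in> K" if uv: "u \<in> K" "v \<in> K" for u v
    proof -
      obtain n s where 1: "s \<in> S" "u = x [^] (n::nat) \<otimes> s" using uv(1) unfolding K_def by blast
      obtain l s' where 2: "s' \<in> S" "v = x [^] (l::nat) \<otimes> s'" using uv(2) unfolding K_def by blast
      note 1 2
      moreover from 1 2 have "u \<otimes> v = x [^] (n + l) \<otimes> (s \<otimes> s')"
        using x S1 by (subst nat_pow_mult[symmetric]) (auto simp: subset_iff m_ac)
      ultimately show ?thesis unfolding K_def using Sm by blast
    qed
    moreover have "K \<subseteq> carrier R" unfolding K_def using x S1 by auto
    ultimately have "\<zero> \<in> K" unfolding A_def using SX S1 by auto
    then show "\<exists>n::nat. \<exists>s\<in>S. x [^] n \<otimes> s = \<zero>" unfolding K_def by force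
  qed
  define P where "P = carrier R - S"
  have "primeideal P R"
  proof (rule primeidealI[OF idealI])
    show "cring R" "ring R" by unfold_locales
    show "subgroup P (add_monoid R)"
    proof (rule add.subgroupI)
      show "P \<subseteq> carrier R" "P \<noteq> {}" unfolding P_def using S1 by auto
      fix x assume "x \<in> P"
      then have x: "x \<in> carrier R" "x \<notin> S" by (auto simp: P_def)
      then obtain n :: nat and s where ns: "s \<in> S" "x [^] n \<otimes> s = \<zero>" using notinS by blast
      have "(\<ominus> x) [^] n \<otimes> s = (\<ominus> \<one>) [^] n \<otimes> (x [^] n \<otimes> s)"
      proof -
        have "\<ominus> x = \<ominus> \<one> \<otimes> x" using x by (simp add: l_minus)
        then show ?thesis using x ns S1 by (auto simp: nat_pow_distrib m_assoc subset_iff)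
      qed
      then have "(\<ominus> x) [^] n \<otimes> s = \<zero>" using ns by simp
      then show "\<ominus> x \<in> P" unfolding P_def using notinS x ns by auto
      fix y assume "y \<in> P"
      then have y: "y \<in> carrier R" "y \<notin> S" by (auto simp: P_def)
      then obtain l :: nat and s' where ls: "s' \<in> S" "y [^] l \<otimes> s' = \<zero>" using notinS by blast
      have c: "s \<in> carrier R" "s' \<in> carrier R" using ns ls S1 by auto
      have "x [^] n \<otimes> (s \<otimes> s') = \<zero>" using ns ls x c by (simp add: m_assoc[symmetric])
      moreover have "y [^] l \<otimes> (s \<otimes> s') = s \<otimes> (y [^] l \<otimes> s')" using y c by (simp add: m_lcomm)
      then have "y [^] l \<otimes> (s \<otimes> s') = \<zero>" using ls c by simp
      ultimately have "(x \<oplus> y) [^] (n + l) \<otimes> (s \<otimes> s') = \<zero>"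
        using annihilating_powers_add x y c by simp
      then show "x \<oplus> y \<in> P" unfolding P_def using notinS x y Sm ns ls by blast
    qed
    fix x b assume "x \<in> P" and b: "b \<in> carrier R"
    then have x: "x \<in> carrier R" "x \<notin> S" by (auto simp: P_def)
    then obtain n :: nat and s where ns: "s \<in> S" "x [^] n \<otimes> s = \<zero>" using notinS by blast
    have "(b \<otimes> x) [^] n \<otimes> s = b [^] n \<otimes> (x [^] n \<otimes> s)"
      using b x ns S1 by (auto simp: nat_pow_distrib m_assoc subset_iff)
    then have "(b \<otimes> x) [^] n \<otimes> s = \<zero>" using ns b by simp
    then show "b \<otimes> x \<in> P" unfolding P_def using notinS x ns b by blast
    then show "x \<otimes> b \<in> P" using b x by (simp add: m_comm)
  next
    show "carrier R \<noteq> P" unfolding P_def using S1 by auto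
    show "x \<in> P \<or> y \<in> P" if "x \<in> carrier R" "y \<in> carrier R" "x \<otimes> y \<in> P" for x y
      using that Sm unfolding P_def by auto
  qed
  moreover have "Q = P" if Q: "primeideal Q R" "Q \<subseteq> P" for Q
  proof -
    interpret Q: primeideal Q R by (rule Q)
    have "carrier R - Q \<in> A"
      unfolding A_def using Q.I_prime Q.zero_closed Q.one_imp_carrier Q.I_notcarr Q(2) S1 a
      unfolding P_def by auto
    moreover have "S \<subseteq> carrier R - Q" using Q(2) S1 unfolding P_def by auto
    ultimately have "carrier R - Q = S" by (rule max)
    then show ?thesis unfolding P_def using Q.Icarr by auto
  qed
  ultimately have "P \<in> minimal_primes R" unfolding minimal_primes_def by auto
  moreover have "a \<notin> P" using S1 unfolding P_def by auto
  ultimately show ?thesis by blast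
qed


text \<open>In a reduced ring the minimal primes intersect in \<open>\<zero>\<close>, and a prime containing a finite
  intersection of ideals contains one of them.\<close>

lemma (in cring) prime_over_minimal_prime:
  assumes red: "reduced_ring R" and fin: "finite (minimal_primes R)" and Q: "primeideal Q R"
  shows "\<exists>P\<in>minimal_primes R. P \<subseteq> Q"
proof (rule ccontr)
  assume "\<not> ?thesis"
  moreover have "ideal P R" if "P \<in> minimal_primes R" for P
    using that by (auto simp: minimal_primes_def primeideal_def)
  ultimately obtain a where a: "a \<in> carrier R" "a \<notin> Q" "\<forall>P\<in>minimal_primes R. a \<in> P"
    using exists_in_ideals_avoiding_prime[OF Q fin, of "\<lambda>P. P"] by blast
  then obtain e :: nat where "a [^] e = \<zero>" using minimal_prime_avoiding_nonnilpotent by blast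
  then have "a = \<zero>" using red a unfolding reduced_ring_def by blast
  moreover have "\<zero> \<in> Q"
    using Q by (meson additive_subgroup.zero_closed ideal_def primeideal_def)
  ultimately show False using a by blast
qed

text \<open>A chain of primes has at most the two members \<open>P\<close> and \<open>M\<close>.\<close>

lemma krull_dim_eq_1:
  assumes primes: "\<And>Q. primeideal Q R \<longleftrightarrow> Q = P \<or> Q = M" and PM: "P \<subset> M"
  shows "krull_dim R = 1"
proof -
  define D where "D = {enat d | d. \<exists>p. (\<forall>i\<le>d. primeideal (p i) R) \<and> (\<forall>i<d. p i \<subset> p (Suc i))}"
  have "enat 1 \<in> D"
    unfolding D_def
    by (intro CollectI exI[of _ "1::nat"] conjI refl exI[of _ "\<lambda>i::nat. if i = 0 then P else M"])
      (use PM in \<open>simp_all add: primes\<close>)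
  moreover have "x \<le> 1" if x: "x \<in> D" for x
  proof -
    obtain d p where d: "x = enat d" "\<forall>i\<le>d. primeideal (p i) R" "\<forall>i<d. p i \<subset> p (Suc i)"
      using x unfolding D_def by blast
    have "d \<le> 1"
    proof (rule ccontr)
      assume "\<not> d \<le> 1"
      then have "primeideal (p 0) R" "primeideal (p 1) R" "primeideal (p 2) R"
        "p 0 \<subset> p 1" "p 1 \<subset> p 2"
        using d(2,3) by (auto simp: numeral_2_eq_2)
      then have "p 0 = P \<or> p 0 = M" "p 1 = P \<or> p 1 = M" "p 2 = P \<or> p 2 = M"
        unfolding primes by simp_all
      with \<open>p 0 \<subset> p 1\<close> \<open>p 1 \<subset> p 2\<close> PM show False by auto
    qed
    then show ?thesis using d(1) by (metis enat_ord_simps(1) one_enat_def)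
  qed
  ultimately have "Sup D = 1"
    by (metis Sup_least Sup_upper antisym one_enat_def)
  then show ?thesis unfolding krull_dim_def D_def .
qed

lemma krull_dim_eq_0:
  assumes primes: "\<And>Q. primeideal Q R \<longleftrightarrow> Q = P"
  shows "krull_dim R = 0"
proof -
  define D where "D = {enat d | d. \<exists>p. (\<forall>i\<le>d. primeideal (p i) R) \<and> (\<forall>i<d. p i \<subset> p (Suc i))}"
  have "x \<le> 0" if x: "x \<in> D" for x
  proof -
    obtain d p where d: "x = enat d" "\<forall>i\<le>d. primeideal (p i) R" "\<forall>i<d. p i \<subset> p (Suc i)"
      using x unfolding D_def by blast
    have "d = 0"
    proof (rule ccontr)
      assume "d \<noteq> 0"
      then have "primeideal (p 0) R" "primeideal (p 1) R" "p 0 \<subset> p 1"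
        using d(2,3) by auto
      then show False using primes by blast
    qed
    then show ?thesis unfolding d(1) zero_enat_def by simp
  qed
  then have "Sup D = 0"
    by (intro antisym Sup_least) auto
  then show ?thesis unfolding krull_dim_def D_def .
qed

lemma (in cring) local_ringI:
  assumes "maximalideal M R" and "\<And>N. maximalideal N R \<Longrightarrow> N = M"
  shows "local_ring R" "max_ideal R = M"
proof -
  show "local_ring R" unfolding local_ring_def using assms is_cring by blast
  show "max_ideal R = M" unfolding max_ideal_def
    by (rule the_equality) (fact assms)+
qed

lemma regular_local_ring_field:
  fixes R :: "('a, 'b) ring_scheme"
  assumes "field R"
  shows "regular_local_ring R"
proof -
  interpret field R by fact
  have ideals: "I = {\<zero>\<^bsub>R\<^esub>} \<or> I = carrier R" if "ideal I R" for I using all_ideals that by blast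
  have max: "maximalideal {\<zero>\<^bsub>R\<^esub>} R" by (rule zeromaximalideal)
  have uniq: "N = {\<zero>\<^bsub>R\<^esub>}" if "maximalideal N R" for N
    using ideals[of N] that by (auto simp: maximalideal_def maximalideal_axioms_def)
  have "primeideal Q R \<longleftrightarrow> Q = {\<zero>\<^bsub>R\<^esub>}" for Q
    using ideals[of Q] zeroprimeideal by (auto simp: primeideal_def primeideal_axioms_def)
  then have dim: "krull_dim R = 0" by (rule krull_dim_eq_0)
  have "noetherian_ring R"
  proof (rule noetherian_ringI)
    fix I assume "ideal I R"
    then show "\<exists>A\<subseteq>carrier R. finite A \<and> I = Idl\<^bsub>R\<^esub> A"
      using ideals[of I] genideal_zero genideal_one
      by (metis empty_subsetI finite.emptyI finite_insert insert_subset one_closed zero_closed)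
  qed
  moreover have "Idl\<^bsub>R\<^esub> {} = {\<zero>\<^bsub>R\<^esub>}"
    using genideal_minimal[OF zeroideal, of "{}"] genideal_ideal[of "{}"]
    by (metis Diff_cancel Diff_eq_empty_iff additive_subgroup.zero_closed empty_subsetI
        ideal_def insert_subset subset_antisym)
  moreover have "enat (card ({} :: 'a set)) = krull_dim R" unfolding dim zero_enat_def by simp
  moreover have "local_ring R" "max_ideal R = {\<zero>\<^bsub>R\<^esub>}"
    using local_ringI[OF max] uniq by blast+
  ultimately show ?thesis
    unfolding regular_local_ring_def by (metis empty_subsetI finite.emptyI)
qed

text \<open>Such a ring is a discrete valuation ring with uniformizer \<open>t\<close>: its nonzero ideals are generated
  by the powers of \<open>t\<close>.\<close>

lemma regular_local_ring_dvr:
  assumes "domain R" and t: "t \<in> carrier R" "t \<noteq> \<zero>\<^bsub>R\<^esub>" "t \<notin> Units R"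
    and powers: "\<And>x. x \<in> carrier R \<Longrightarrow> x \<noteq> \<zero>\<^bsub>R\<^esub> \<Longrightarrow>
      \<exists>n::nat. \<exists>u\<in>Units R. x = u \<otimes>\<^bsub>R\<^esub> t [^]\<^bsub>R\<^esub> n"
  shows "regular_local_ring R"
proof -
  interpret domain R by fact
  let ?M = "PIdl\<^bsub>R\<^esub> t"
  have in_M: "x \<in> ?M \<longleftrightarrow> (\<exists>y\<in>carrier R. x = y \<otimes>\<^bsub>R\<^esub> t)" for x
    unfolding cgenideal_def by blast
  have M_ideal: "ideal ?M R" using t by (rule_tac cgenideal_ideal)
  have power_in: "t [^]\<^bsub>R\<^esub> n \<in> I"
    if "ideal I R" "u \<in> Units R" "u \<otimes>\<^bsub>R\<^esub> t [^]\<^bsub>R\<^esub> n \<in> I" for I u and n :: nat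
  proof -
    have "inv\<^bsub>R\<^esub> u \<otimes>\<^bsub>R\<^esub> (u \<otimes>\<^bsub>R\<^esub> t [^]\<^bsub>R\<^esub> n) = t [^]\<^bsub>R\<^esub> n"
      using that(2) t(1)
      by (metis Units_closed Units_inv_closed Units_l_inv l_one m_assoc nat_pow_closed)
    then show ?thesis using ideal.I_l_closed[OF that(1,3), of "inv\<^bsub>R\<^esub> u"] that(2) by simp
  qed
  have M_proper: "?M \<noteq> carrier R"
  proof
    assume "?M = carrier R"
    then obtain y where y: "y \<in> carrier R" "y \<otimes>\<^bsub>R\<^esub> t = \<one>\<^bsub>R\<^esub>" using in_M by (metis one_closed)
    then have "t \<otimes>\<^bsub>R\<^esub> y = \<one>\<^bsub>R\<^esub>" using m_comm[OF t(1) y(1)] by simp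
    then show False using t y unfolding Units_def by blast
  qed
  have proper_sub: "I \<subseteq> ?M" if I: "ideal I R" "I \<noteq> carrier R" for I
  proof
    fix x assume x: "x \<in> I"
    then have xc: "x \<in> carrier R" using ideal.Icarr[OF I(1)] by blast
    show "x \<in> ?M"
    proof (cases "x = \<zero>\<^bsub>R\<^esub>")
      case True
      then show ?thesis using M_ideal by (meson additive_subgroup.zero_closed ideal_def)
    next
      case False
      then obtain n :: nat and u where u: "u \<in> Units R" "x = u \<otimes>\<^bsub>R\<^esub> t [^]\<^bsub>R\<^esub> n"
        using powers xc by blast
      show ?thesis
      proof (cases n)
        case 0
        then have "\<one>\<^bsub>R\<^esub> \<in> I" using power_in[OF I(1) u(1), of n] u x by simp
        then show ?thesis using ideal.one_imp_carrier[OF I(1)] I(2) by simp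
      next
        case (Suc l)
        then have "x = (u \<otimes>\<^bsub>R\<^esub> t [^]\<^bsub>R\<^esub> l) \<otimes>\<^bsub>R\<^esub> t"
          using u t Units_closed[OF u(1)] by (simp add: m_assoc)
        then show ?thesis using in_M Units_closed[OF u(1)] t by blast
      qed
    qed
  qed
  have max: "maximalideal ?M R"
  proof (rule maximalidealI[OF M_ideal])
    show "carrier R \<noteq> ?M" using M_proper by simp
    show "J = ?M \<or> J = carrier R" if "ideal J R" "?M \<subseteq> J" for J
      using proper_sub[OF that(1)] that(2) by auto
  qed
  have uniq: "N = ?M" if N: "maximalideal N R" for N
  proof -
    interpret N: maximalideal N R by (rule N)
    have "N \<subseteq> ?M" using proper_sub[OF N.is_ideal] N.I_notcarr by blast
    moreover have "?M \<subseteq> carrier R" using ideal.Icarr[OF M_ideal] by blast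
    ultimately show ?thesis using N.I_maximal[OF M_ideal] M_proper by blast
  qed
  have primes: "primeideal Q R \<longleftrightarrow> Q = {\<zero>\<^bsub>R\<^esub>} \<or> Q = ?M" for Q
  proof
    assume Q: "primeideal Q R"
    interpret Q: primeideal Q R by (rule Q)
    have "t \<in> Q" if nz: "Q \<noteq> {\<zero>\<^bsub>R\<^esub>}"
    proof -
      obtain x where x: "x \<in> Q" "x \<noteq> \<zero>\<^bsub>R\<^esub>" using nz Q.zero_closed unfolding set_eq_iff by auto
      then obtain n :: nat and u where u: "u \<in> Units R" "x = u \<otimes>\<^bsub>R\<^esub> t [^]\<^bsub>R\<^esub> n"
        using powers Q.Icarr by blast
      then have "t [^]\<^bsub>R\<^esub> n \<in> Q" using power_in[OF Q.is_ideal] x by blast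
      then show "t \<in> Q"
      proof (induction n)
        case 0
        then show ?case using Q.one_imp_carrier Q.I_notcarr by simp
      next
        case (Suc n)
        then show ?case using Q.I_prime[of "t [^]\<^bsub>R\<^esub> n" t] t by auto
      qed
    qed
    then have "?M \<subseteq> Q" if "Q \<noteq> {\<zero>\<^bsub>R\<^esub>}" using that cgenideal_minimal[OF Q.is_ideal] by blast
    then show "Q = {\<zero>\<^bsub>R\<^esub>} \<or> Q = ?M"
      using proper_sub[OF Q.is_ideal] Q.I_notcarr by blast
  next
    assume "Q = {\<zero>\<^bsub>R\<^esub>} \<or> Q = ?M"
    then show "primeideal Q R" using zeroprimeideal maximalideal_prime[OF max] by blast
  qed
  have "t \<in> ?M" by (rule cgenideal_self[OF t(1)])
  moreover have "\<zero>\<^bsub>R\<^esub> \<in> ?M" using M_ideal by (meson additive_subgroup.zero_closed ideal_def)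
  ultimately have "{\<zero>\<^bsub>R\<^esub>} \<subset> ?M" using t by blast
  with primes have dim: "krull_dim R = 1" by (rule krull_dim_eq_1)
  have "noetherian_ring R"
  proof (rule noetherian_ringI)
    fix I assume I: "ideal I R"
    show "\<exists>A\<subseteq>carrier R. finite A \<and> I = Idl\<^bsub>R\<^esub> A"
    proof (cases "I = {\<zero>\<^bsub>R\<^esub>}")
      case True
      then show ?thesis using genideal_zero by (intro exI[of _ "{\<zero>\<^bsub>R\<^esub>}"]) auto
    next
      case False
      define n where "n = (LEAST n. t [^]\<^bsub>R\<^esub> (n::nat) \<in> I)"
      obtain x where x: "x \<in> I" "x \<noteq> \<zero>\<^bsub>R\<^esub>"
        using False additive_subgroup.zero_closed[of I R] I unfolding set_eq_iff ideal_def by auto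
      then obtain l :: nat where "t [^]\<^bsub>R\<^esub> l \<in> I"
        using powers[of x] ideal.Icarr[OF I] power_in[OF I] by blast
      then have n: "t [^]\<^bsub>R\<^esub> n \<in> I" unfolding n_def by (rule LeastI)
      have "I \<subseteq> Idl\<^bsub>R\<^esub> {t [^]\<^bsub>R\<^esub> n}"
      proof
        fix y assume y: "y \<in> I"
        have gi: "ideal (Idl\<^bsub>R\<^esub> {t [^]\<^bsub>R\<^esub> n}) R" using t by (intro genideal_ideal) auto
        have g: "t [^]\<^bsub>R\<^esub> n \<in> Idl\<^bsub>R\<^esub> {t [^]\<^bsub>R\<^esub> n}" using t by (intro genideal_self') auto
        show "y \<in> Idl\<^bsub>R\<^esub> {t [^]\<^bsub>R\<^esub> n}"
        proof (cases "y = \<zero>\<^bsub>R\<^esub>")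
          case True
          then show ?thesis using gi by (meson additive_subgroup.zero_closed ideal_def)
        next
          case False
          then obtain l :: nat and u where u: "u \<in> Units R" "y = u \<otimes>\<^bsub>R\<^esub> t [^]\<^bsub>R\<^esub> l"
            using powers y ideal.Icarr[OF I] by blast
          then have "t [^]\<^bsub>R\<^esub> l \<in> I" using power_in[OF I] y by blast
          then have "n \<le> l" unfolding n_def by (rule Least_le)
          then have "y = (u \<otimes>\<^bsub>R\<^esub> t [^]\<^bsub>R\<^esub> (l - n)) \<otimes>\<^bsub>R\<^esub> t [^]\<^bsub>R\<^esub> n"
            using u t Units_closed[OF u(1)] by (simp add: m_assoc nat_pow_mult)
          then show ?thesis using ideal.I_l_closed[OF gi g] Units_closed[OF u(1)] t by simp
        qed
      qed
      moreover have "Idl\<^bsub>R\<^esub> {t [^]\<^bsub>R\<^esub> n} \<subseteq> I" using genideal_minimal[OF I] n by blast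
      ultimately show ?thesis using t by (intro exI[of _ "{t [^]\<^bsub>R\<^esub> n}"]) auto
    qed
  qed
  moreover have "Idl\<^bsub>R\<^esub> {t} = ?M" using cgenideal_eq_genideal t by simp
  moreover have "enat (card {t}) = krull_dim R"
    using dim by (metis One_nat_def card_1_singleton_iff one_enat_def)
  moreover have "local_ring R" "max_ideal R = ?M"
    using local_ringI[OF max] uniq by blast+
  ultimately show ?thesis
    unfolding regular_local_ring_def using t(1)
    by (metis empty_subsetI finite.emptyI finite_insert insert_subset)
qed

text \<open>Under these conditions the fraction \<open>a / s\<close> depends only on the quotient of \<open>\<theta> a\<close> by \<open>\<theta> s\<close>, and every
  element of \<open>E\<close> is such a quotient.\<close>

lemma localization_iso:
  fixes \<theta> :: "'a \<Rightarrow> 'e::comm_ring_1"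
  assumes "cring R" and "primeideal Q R" and hom: "\<theta> \<in> ring_hom R ring_of_type_algebra"
    and units: "\<And>s. s \<in> carrier R - Q \<Longrightarrow> \<theta> s dvd 1"
    and fractions: "\<And>e. \<exists>a\<in>carrier R. \<exists>s\<in>carrier R - Q. e * \<theta> s = \<theta> a"
    and kernel: "\<And>a. a \<in> carrier R \<Longrightarrow> \<theta> a = 0 \<Longrightarrow> \<exists>u\<in>carrier R - Q. u \<otimes>\<^bsub>R\<^esub> a = \<zero>\<^bsub>R\<^esub>"
  shows "\<exists>h. h \<in> ring_iso (ring_of_type_algebra :: 'e ring) (localization R Q) \<and>
    h 0 = \<zero>\<^bsub>localization R Q\<^esub>"
proof -
  interpret cring R by fact
  interpret Q: primeideal Q R by fact
  have h_simps: "\<And>x y. x \<in> carrier R \<Longrightarrow> y \<in> carrier R \<Longrightarrow> \<theta> (x \<otimes>\<^bsub>R\<^esub> y) = \<theta> x * \<theta> y"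
    "\<And>x y. x \<in> carrier R \<Longrightarrow> y \<in> carrier R \<Longrightarrow> \<theta> (x \<oplus>\<^bsub>R\<^esub> y) = \<theta> x + \<theta> y" "\<theta> \<one>\<^bsub>R\<^esub> = 1"
    using ring_hom_mult[OF hom] ring_hom_add[OF hom] ring_hom_one[OF hom] by auto
  have h0: "\<theta> \<zero>\<^bsub>R\<^esub> = 0" using h_simps(2)[of "\<zero>\<^bsub>R\<^esub>" "\<zero>\<^bsub>R\<^esub>"] by simp
  have hminus: "\<theta> (x \<ominus>\<^bsub>R\<^esub> y) = \<theta> x - \<theta> y" if "x \<in> carrier R" "y \<in> carrier R" for x y
  proof -
    have "\<theta> (x \<ominus>\<^bsub>R\<^esub> y) + \<theta> y = \<theta> (x \<ominus>\<^bsub>R\<^esub> y \<oplus>\<^bsub>R\<^esub> y)" using that h_simps by simp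
    also have "x \<ominus>\<^bsub>R\<^esub> y \<oplus>\<^bsub>R\<^esub> y = x" using that by algebra
    finally show ?thesis by (simp add: algebra_simps)
  qed
  have cancel: "x = y" if xy: "s \<in> carrier R - Q" "x * \<theta> s = y * \<theta> s" for x y s
  proof -
    obtain w where w: "\<theta> s * w = 1" using units[OF xy(1)] by (metis dvdE)
    then show ?thesis using xy(2) by (metis mult.assoc mult.right_neutral)
  qed
  define F where "F e = {(b, t). b \<in> carrier R \<and> t \<in> carrier R - Q \<and> e * \<theta> t = \<theta> b}" for e
  have frac: "fraction R Q a s = F e"
    if as: "a \<in> carrier R" "s \<in> carrier R - Q" "e * \<theta> s = \<theta> a" for a s e
  proof -
    have "(\<exists>u\<in>carrier R - Q. u \<otimes>\<^bsub>R\<^esub> (t \<otimes>\<^bsub>R\<^esub> a \<ominus>\<^bsub>R\<^esub> s \<otimes>\<^bsub>R\<^esub> b) = \<zero>\<^bsub>R\<^esub>) \<longleftrightarrow> e * \<theta> t = \<theta> b"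
      if bt: "b \<in> carrier R" "t \<in> carrier R - Q" for b t
    proof -
      have "\<theta> (t \<otimes>\<^bsub>R\<^esub> a \<ominus>\<^bsub>R\<^esub> s \<otimes>\<^bsub>R\<^esub> b) = \<theta> t * \<theta> a - \<theta> s * \<theta> b"
        using as(1,2) bt by (simp add: hminus h_simps)
      then have d: "\<theta> (t \<otimes>\<^bsub>R\<^esub> a \<ominus>\<^bsub>R\<^esub> s \<otimes>\<^bsub>R\<^esub> b) = (e * \<theta> t - \<theta> b) * \<theta> s"
        by (simp add: algebra_simps flip: as(3))
      show ?thesis
      proof
        assume "\<exists>u\<in>carrier R - Q. u \<otimes>\<^bsub>R\<^esub> (t \<otimes>\<^bsub>R\<^esub> a \<ominus>\<^bsub>R\<^esub> s \<otimes>\<^bsub>R\<^esub> b) = \<zero>\<^bsub>R\<^esub>"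
        then obtain u where u: "u \<in> carrier R - Q" "u \<otimes>\<^bsub>R\<^esub> (t \<otimes>\<^bsub>R\<^esub> a \<ominus>\<^bsub>R\<^esub> s \<otimes>\<^bsub>R\<^esub> b) = \<zero>\<^bsub>R\<^esub>" by blast
        have "\<theta> u * \<theta> (t \<otimes>\<^bsub>R\<^esub> a \<ominus>\<^bsub>R\<^esub> s \<otimes>\<^bsub>R\<^esub> b) = 0"
          using u as bt h_simps(1)[of u "t \<otimes>\<^bsub>R\<^esub> a \<ominus>\<^bsub>R\<^esub> s \<otimes>\<^bsub>R\<^esub> b"] h0 by simp
        then have "(e * \<theta> t - \<theta> b) * \<theta> s = 0 * \<theta> u"
          using cancel[OF u(1), of "\<theta> (t \<otimes>\<^bsub>R\<^esub> a \<ominus>\<^bsub>R\<^esub> s \<otimes>\<^bsub>R\<^esub> b)" 0] d by (simp add: mult.commute)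
        then show "e * \<theta> t = \<theta> b" using cancel[OF as(2), of "e * \<theta> t - \<theta> b" 0] by simp
      next
        assume "e * \<theta> t = \<theta> b"
        then show "\<exists>u\<in>carrier R - Q. u \<otimes>\<^bsub>R\<^esub> (t \<otimes>\<^bsub>R\<^esub> a \<ominus>\<^bsub>R\<^esub> s \<otimes>\<^bsub>R\<^esub> b) = \<zero>\<^bsub>R\<^esub>"
          using kernel d as bt by simp
      qed
    qed
    then show ?thesis unfolding fraction_def F_def by auto
  qed
  have F_ne: "F e \<noteq> {}" for e using fractions[of e] unfolding F_def by auto
  have val: "\<exists>e. e * \<theta> s = \<theta> a" if s: "s \<in> carrier R - Q" for a s
  proof -
    obtain w where w: "\<theta> s * w = 1" using units[OF s] by (metis dvdE)
    then have "(\<theta> a * w) * \<theta> s = \<theta> a" by (metis mult.assoc mult.commute mult.right_neutral)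
    then show ?thesis by blast
  qed
  have prod: "s \<otimes>\<^bsub>R\<^esub> t \<in> carrier R - Q" if "s \<in> carrier R - Q" "t \<in> carrier R - Q" for s t
    using that Q.I_prime by blast
  have one: "\<one>\<^bsub>R\<^esub> \<in> carrier R - Q" using Q.one_imp_carrier Q.I_notcarr by blast
  have UN: "(\<Union>(a, s)\<in>F e. \<Union>(b, t)\<in>F e'. G a s b t) = F e''"
    if "\<And>a s b t. (a, s) \<in> F e \<Longrightarrow> (b, t) \<in> F e' \<Longrightarrow> G a s b t = F e''" for e e' e'' G
  proof -
    have "(\<Union>(b, t)\<in>F e'. G a s b t) = F e''" if "(a, s) \<in> F e" for a s
      using \<open>\<And>a s b t. (a, s) \<in> F e \<Longrightarrow> (b, t) \<in> F e' \<Longrightarrow> G a s b t = F e''\<close>[OF that] F_ne[of e'] by auto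
    then show ?thesis using F_ne[of e] by auto
  qed
  have F_carrier: "F e \<in> carrier (localization R Q)" for e
  proof -
    obtain a s where as: "a \<in> carrier R" "s \<in> carrier R - Q" "e * \<theta> s = \<theta> a"
      using fractions[of e] by blast
    then have "F e = fraction R Q a s" using frac by simp
    then show ?thesis unfolding localization_def using as by auto
  qed
  have F_iso: "F \<in> ring_iso ring_of_type_algebra (localization R Q)"
  proof (rule ring_iso_memI)
    show "F x \<in> carrier (localization R Q)" for x by (rule F_carrier)
    show "F (x \<otimes>\<^bsub>ring_of_type_algebra\<^esub> y) = F x \<otimes>\<^bsub>localization R Q\<^esub> F y" for x y
      unfolding localization_def monoid.simps ring_of_type_algebra_simps
    proof (rule UN[symmetric], goal_cases)
      case (1 a s b t)
      then have *: "a \<in> carrier R" "s \<in> carrier R - Q" "x * \<theta> s = \<theta> a"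
        "b \<in> carrier R" "t \<in> carrier R - Q" "y * \<theta> t = \<theta> b" by (auto simp: F_def)
      show ?case
        by (rule frac) (use * prod h_simps in \<open>auto simp: algebra_simps simp flip: *(3,6)\<close>)
    qed
    show "F (x \<oplus>\<^bsub>ring_of_type_algebra\<^esub> y) = F x \<oplus>\<^bsub>localization R Q\<^esub> F y" for x y
      unfolding localization_def ring.simps ring_of_type_algebra_simps
    proof (rule UN[symmetric], goal_cases)
      case (1 a s b t)
      then have *: "a \<in> carrier R" "s \<in> carrier R - Q" "x * \<theta> s = \<theta> a"
        "b \<in> carrier R" "t \<in> carrier R - Q" "y * \<theta> t = \<theta> b" by (auto simp: F_def)
      show ?case
        by (rule frac) (use * prod h_simps in \<open>auto simp: algebra_simps simp flip: *(3,6)\<close>)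
    qed
    show "F \<one>\<^bsub>ring_of_type_algebra\<^esub> = \<one>\<^bsub>localization R Q\<^esub>"
      unfolding localization_def using one h_simps frac[of "\<one>\<^bsub>R\<^esub>" "\<one>\<^bsub>R\<^esub>" 1] by simp
    show "bij_betw F (carrier ring_of_type_algebra) (carrier (localization R Q))"
    proof (rule bij_betw_imageI)
      show "inj_on F (carrier ring_of_type_algebra)"
      proof (rule inj_onI)
        fix x y assume "F x = F y"
        then obtain a s where "(a, s) \<in> F x" "(a, s) \<in> F y" using F_ne[of x] by auto
        then show "x = y" using cancel unfolding F_def by auto
      qed
      show "F ` carrier ring_of_type_algebra = carrier (localization R Q)"
      proof (intro equalityI subsetI)
        fix z assume "z \<in> F ` carrier ring_of_type_algebra"
        then obtain e where "z = F e" by auto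
        then show "z \<in> carrier (localization R Q)" using F_carrier by simp
      next
        fix z assume "z \<in> carrier (localization R Q)"
        then obtain a s where as: "a \<in> carrier R" "s \<in> carrier R - Q" "z = fraction R Q a s"
          unfolding localization_def by auto
        obtain e where "e * \<theta> s = \<theta> a" using val[OF as(2)] by blast
        then have "z = F e" using frac as by simp
        then show "z \<in> F ` carrier ring_of_type_algebra" by simp
      qed
    qed
  qed
  moreover have "F 0 = \<zero>\<^bsub>localization R Q\<^esub>"
    unfolding localization_def using one h0 frac[of "\<zero>\<^bsub>R\<^esub>" "\<one>\<^bsub>R\<^esub>" 0] by simp
  ultimately show ?thesis by blast
qed

lemma regular_local_ring_iso_field:
  assumes h: "h \<in> ring_iso (ring_of_type_algebra :: 'e::field ring) L" and h0: "h 0 = \<zero>\<^bsub>L\<^esub>"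
  shows "regular_local_ring (L :: 'l ring)"
proof -
  interpret E: field "ring_of_type_algebra :: 'e ring" by (rule field_from_type_algebra)
  have "field (L \<lparr> zero := h \<zero>\<^bsub>(ring_of_type_algebra :: 'e ring)\<^esub> \<rparr>)" by (rule E.ring_iso_imp_img_field[OF h])
  then show ?thesis using regular_local_ring_field h0 by simp
qed

lemma regular_local_ring_iso_fps:
  assumes h: "h \<in> ring_iso (ring_of_type_algebra :: 'k::field fps ring) L" and h0: "h 0 = \<zero>\<^bsub>L\<^esub>"
  shows "regular_local_ring (L :: 'l ring)"
proof -
  let ?E = "ring_of_type_algebra :: 'k fps ring"
  interpret E: cring ?E by (rule cring_from_type_algebra)
  have "domain ?E"
    by unfold_locales auto
  then have "domain (L \<lparr> zero := h \<zero>\<^bsub>?E\<^esub> \<rparr>)" by (rule domain.ring_iso_imp_img_domain[OF _ h])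
  then have dom: "domain L" using h0 by simp
  interpret L: domain L by (rule dom)
  have hom: "h \<in> ring_hom ?E L" and bij: "bij_betw h UNIV (carrier L)"
    using h unfolding ring_iso_def by auto
  have closed: "h x \<in> carrier L" for x using bij by (auto simp: bij_betw_def)
  have mult: "h (x * y) = h x \<otimes>\<^bsub>L\<^esub> h y" for x y using ring_hom_mult[OF hom, of x y] by simp
  have one: "h 1 = \<one>\<^bsub>L\<^esub>" using ring_hom_one[OF hom] by simp
  have inj: "h x = h y \<Longrightarrow> x = y" for x y using bij by (auto simp: bij_betw_def inj_def)
  have pow: "h (x ^ n) = h x [^]\<^bsub>L\<^esub> n" for x and n :: nat
    by (induction n) (simp_all add: one mult closed L.m_comm)
  have unit: "h x \<in> Units L" if x: "fps_nth x 0 \<noteq> 0" for x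
  proof -
    have "x * inverse x = 1" using x by (rule inverse_mult_eq_1')
    then have "h x \<otimes>\<^bsub>L\<^esub> h (inverse x) = \<one>\<^bsub>L\<^esub>" using mult one by metis
    moreover from this have "h (inverse x) \<otimes>\<^bsub>L\<^esub> h x = \<one>\<^bsub>L\<^esub>" using L.m_comm[OF closed closed] by metis
    ultimately show ?thesis using closed unfolding Units_def by blast
  qed
  show ?thesis
  proof (rule regular_local_ring_dvr[OF dom])
    show "h fps_X \<in> carrier L" by (rule closed)
    show "h fps_X \<noteq> \<zero>\<^bsub>L\<^esub>" using inj[of fps_X 0] h0 by auto
    show "h fps_X \<notin> Units L"
    proof
      assume "h fps_X \<in> Units L"
      then obtain y where y: "y \<in> carrier L" "h fps_X \<otimes>\<^bsub>L\<^esub> y = \<one>\<^bsub>L\<^esub>" unfolding Units_def by auto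
      then obtain x where "y = h x" using bij by (auto simp: bij_betw_def)
      then have "h (fps_X * x) = h 1" using y mult one by simp
      then have "fps_X * x = 1" by (rule inj)
      then have "fps_nth (fps_X * x) 0 = 1" by simp
      then show False by simp
    qed
    fix y assume y: "y \<in> carrier L" "y \<noteq> \<zero>\<^bsub>L\<^esub>"
    then obtain x where x: "y = h x" using bij by (auto simp: bij_betw_def)
    then have "x \<noteq> 0" using y h0 by auto
    then have "fps_nth (fps_shift (subdegree x) x) 0 \<noteq> 0" by simp
    moreover have "x = fps_shift (subdegree x) x * fps_X ^ subdegree x" by (rule subdegree_decompose)
    then have "y = h (fps_shift (subdegree x) x) \<otimes>\<^bsub>L\<^esub> h fps_X [^]\<^bsub>L\<^esub> subdegree x"
      unfolding x using mult pow by metis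
    ultimately show "\<exists>n::nat. \<exists>u\<in>Units L. y = u \<otimes>\<^bsub>L\<^esub> h fps_X [^]\<^bsub>L\<^esub> n" using unit by blast
  qed
qed

text \<open>A homomorphism vanishing on \<open>J\<close> descends to the quotient, so the criterion can be checked in
  the original ring.\<close>

lemma localization_quotient_iso:
  fixes \<theta> :: "'a \<Rightarrow> 'e::comm_ring_1"
  assumes "cring A" and "ideal J A" and Q': "primeideal Q' (A Quot J)"
    and Q: "Q = {f \<in> carrier A. J +>\<^bsub>A\<^esub> f \<in> Q'}"
    and hom: "\<theta> \<in> ring_hom A ring_of_type_algebra" and J0: "\<And>f. f \<in> J \<Longrightarrow> \<theta> f = 0"
    and units: "\<And>s. s \<in> carrier A - Q \<Longrightarrow> \<theta> s dvd 1"
    and fractions: "\<And>e. \<exists>a\<in>carrier A. \<exists>s\<in>carrier A - Q. e * \<theta> s = \<theta> a"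
    and kernel: "\<And>a. a \<in> carrier A \<Longrightarrow> \<theta> a = 0 \<Longrightarrow> \<exists>u\<in>carrier A - Q. u \<otimes>\<^bsub>A\<^esub> a \<in> J"
  shows "\<exists>h. h \<in> ring_iso (ring_of_type_algebra :: 'e ring) (localization (A Quot J) Q') \<and>
    h 0 = \<zero>\<^bsub>localization (A Quot J) Q'\<^esub>"
proof -
  interpret A: cring A by fact
  interpret J: ideal J A by fact
  have cr: "cring (A Quot J)" by (rule J.quotient_is_cring) (rule A.cring_axioms)
  have proj: "(+>\<^bsub>A\<^esub>) J \<in> ring_hom A (A Quot J)" by (rule J.rcos_ring_hom)
  have surj: "\<exists>f\<in>carrier A. x = J +>\<^bsub>A\<^esub> f" if "x \<in> carrier (A Quot J)" for x
    using that unfolding FactRing_def A_RCOSETS_def' by auto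
  have h_simps: "\<And>x y. x \<in> carrier A \<Longrightarrow> y \<in> carrier A \<Longrightarrow> \<theta> (x \<otimes>\<^bsub>A\<^esub> y) = \<theta> x * \<theta> y"
    "\<And>x y. x \<in> carrier A \<Longrightarrow> y \<in> carrier A \<Longrightarrow> \<theta> (x \<oplus>\<^bsub>A\<^esub> y) = \<theta> x + \<theta> y" "\<theta> \<one>\<^bsub>A\<^esub> = 1"
    using ring_hom_mult[OF hom] ring_hom_add[OF hom] ring_hom_one[OF hom] by auto
  define \<psi> where "\<psi> x = the_elem (\<theta> ` x)" for x
  have \<psi>: "\<psi> (J +>\<^bsub>A\<^esub> f) = \<theta> f" if f: "f \<in> carrier A" for f
  proof -
    have "J +>\<^bsub>A\<^esub> f = (\<lambda>x. x \<oplus>\<^bsub>A\<^esub> f) ` J" unfolding a_r_coset_def' by auto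
    then have "\<theta> ` (J +>\<^bsub>A\<^esub> f) = {\<theta> f}"
      using J0 f J.Icarr h_simps(2) J.zero_closed by (auto simp: image_iff)
    then show ?thesis by (simp add: \<psi>_def)
  qed
  have proj_simps: "\<And>x y. x \<in> carrier A \<Longrightarrow> y \<in> carrier A \<Longrightarrow>
      (J +>\<^bsub>A\<^esub> x) \<otimes>\<^bsub>A Quot J\<^esub> (J +>\<^bsub>A\<^esub> y) = J +>\<^bsub>A\<^esub> (x \<otimes>\<^bsub>A\<^esub> y)"
    "\<And>x y. x \<in> carrier A \<Longrightarrow> y \<in> carrier A \<Longrightarrow>
      (J +>\<^bsub>A\<^esub> x) \<oplus>\<^bsub>A Quot J\<^esub> (J +>\<^bsub>A\<^esub> y) = J +>\<^bsub>A\<^esub> (x \<oplus>\<^bsub>A\<^esub> y)"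
    "\<And>x. x \<in> carrier A \<Longrightarrow> J +>\<^bsub>A\<^esub> x \<in> carrier (A Quot J)"
    using ring_hom_mult[OF proj] ring_hom_add[OF proj] ring_hom_closed[OF proj] by auto
  have notQ: "s \<in> carrier A - Q" if "s \<in> carrier A" "J +>\<^bsub>A\<^esub> s \<in> carrier (A Quot J) - Q'" for s
    using that Q by auto
  show ?thesis
  proof (rule localization_iso[OF cr Q'])
    show "\<psi> \<in> ring_hom (A Quot J) ring_of_type_algebra"
    proof (rule ring_hom_memI)
      fix x y assume "x \<in> carrier (A Quot J)" "y \<in> carrier (A Quot J)"
      then obtain f g where fg: "f \<in> carrier A" "x = J +>\<^bsub>A\<^esub> f" "g \<in> carrier A" "y = J +>\<^bsub>A\<^esub> g"
        using surj by metis
      then show "\<psi> (x \<otimes>\<^bsub>A Quot J\<^esub> y) = \<psi> x \<otimes>\<^bsub>ring_of_type_algebra\<^esub> \<psi> y"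
        "\<psi> (x \<oplus>\<^bsub>A Quot J\<^esub> y) = \<psi> x \<oplus>\<^bsub>ring_of_type_algebra\<^esub> \<psi> y"
        using proj_simps \<psi> h_simps by simp_all
    next
      have "\<one>\<^bsub>A Quot J\<^esub> = J +>\<^bsub>A\<^esub> \<one>\<^bsub>A\<^esub>" by (simp add: FactRing_def)
      then show "\<psi> \<one>\<^bsub>A Quot J\<^esub> = \<one>\<^bsub>ring_of_type_algebra\<^esub>" using \<psi> h_simps by simp
    qed simp
    show "\<psi> s dvd 1" if s: "s \<in> carrier (A Quot J) - Q'" for s
    proof -
      obtain f where f: "f \<in> carrier A" "s = J +>\<^bsub>A\<^esub> f" using surj[of s] s by blast
      then show ?thesis using units[OF notQ[OF f(1)]] \<psi> s by simp
    qed
    show "\<exists>a\<in>carrier (A Quot J). \<exists>s\<in>carrier (A Quot J) - Q'. e * \<psi> s = \<psi> a" for e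
    proof -
      obtain a s where as: "a \<in> carrier A" "s \<in> carrier A - Q" "e * \<theta> s = \<theta> a" using fractions by blast
      then have "J +>\<^bsub>A\<^esub> s \<in> carrier (A Quot J) - Q'" using Q proj_simps by auto
      then show ?thesis using as proj_simps(3) \<psi> by (metis DiffD1)
    qed
    fix x assume x: "x \<in> carrier (A Quot J)" "\<psi> x = 0"
    then obtain a where a: "a \<in> carrier A" "x = J +>\<^bsub>A\<^esub> a" using surj by blast
    then obtain u where u: "u \<in> carrier A - Q" "u \<otimes>\<^bsub>A\<^esub> a \<in> J" using kernel[of a] x \<psi> by auto
    have "(J +>\<^bsub>A\<^esub> u) \<otimes>\<^bsub>A Quot J\<^esub> x = J +>\<^bsub>A\<^esub> (u \<otimes>\<^bsub>A\<^esub> a)" using a u proj_simps by simp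
    also have "\<dots> = J" using u(2) by (rule J.a_rcos_const)
    finally have "(J +>\<^bsub>A\<^esub> u) \<otimes>\<^bsub>A Quot J\<^esub> x = \<zero>\<^bsub>A Quot J\<^esub>" by (simp add: FactRing_def)
    moreover have "J +>\<^bsub>A\<^esub> u \<in> carrier (A Quot J) - Q'" using u Q proj_simps by auto
    ultimately show "\<exists>u\<in>carrier (A Quot J) - Q'. u \<otimes>\<^bsub>A Quot J\<^esub> x = \<zero>\<^bsub>A Quot J\<^esub>" by blast
  qed
qed

section \<open>Algebras of monoids of lattice points\<close>

locale submonoid_algebra = cring R for R (structure) +
  fixes S :: "(nat \<Rightarrow> int) set"
  assumes zero_in [simp]: "0 \<in> S" and plus_in [simp]: "u \<in> S \<Longrightarrow> v \<in> S \<Longrightarrow> u + v \<in> S"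
begin

abbreviation A where "A \<equiv> monoid_algebra R S"

lemma carrier_A: "f \<in> carrier A \<longleftrightarrow>
    (\<forall>u. f u \<in> carrier R) \<and> finite {u. f u \<noteq> \<zero>} \<and> {u. f u \<noteq> \<zero>} \<subseteq> S"
  by (simp add: monoid_algebra_def)

lemma coeff_closed [simp]: "f \<in> carrier A \<Longrightarrow> f u \<in> carrier R"
  by (simp add: carrier_A)

lemma add_A: "f \<oplus>\<^bsub>A\<^esub> g = (\<lambda>u. f u \<oplus> g u)" and zero_A: "\<zero>\<^bsub>A\<^esub> = (\<lambda>u. \<zero>)"
  by (simp_all only: monoid_algebra_def ring.simps)

lemma one_A: "\<one>\<^bsub>A\<^esub> = alg_const R \<one>"
  unfolding monoid_algebra_def alg_const_def character_def by (simp only: monoid.simps)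

lemma character_closed [simp]: "c \<in> carrier R \<Longrightarrow> u \<in> S \<Longrightarrow> character R c u \<in> carrier A"
  unfolding carrier_A character_def by (auto intro: finite_subset[of _ "{u}"])

lemma alg_const_character: "alg_const R c = character R c 0"
  unfolding alg_const_def by (simp add: zero_fun_def)

lemma alg_const_closed [simp]: "c \<in> carrier R \<Longrightarrow> alg_const R c \<in> carrier A"
  by (simp add: alg_const_character)

lemma add_closed_A: "f \<in> carrier A \<Longrightarrow> g \<in> carrier A \<Longrightarrow> f \<oplus>\<^bsub>A\<^esub> g \<in> carrier A"
proof -
  assume f: "f \<in> carrier A" and g: "g \<in> carrier A"
  have "{u. f u \<oplus> g u \<noteq> \<zero>} \<subseteq> {u. f u \<noteq> \<zero>} \<union> {u. g u \<noteq> \<zero>}" by auto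
  then show ?thesis using f g unfolding carrier_A add_A by (auto dest: finite_subset)
qed

lemma mult_apply:
  assumes f: "f \<in> carrier A" and g: "g \<in> carrier A" and U: "finite U" "{u. f u \<noteq> \<zero>} \<subseteq> U"
  shows "(f \<otimes>\<^bsub>A\<^esub> g) w = (\<Oplus>u\<in>U. f u \<otimes> g (w - u))"
proof -
  have "(f \<otimes>\<^bsub>A\<^esub> g) w = (\<Oplus>u\<in>{u. f u \<noteq> \<zero>}. f u \<otimes> g (w - u))"
    by (simp only: monoid_algebra_def monoid.simps)
  also have "\<dots> = (\<Oplus>u\<in>U. f u \<otimes> g (w - u))"
    by (rule add.finprod_mono_neutral_cong_left) (use assms in auto)
  finally show ?thesis .
qed

lemma finite_support: "f \<in> carrier A \<Longrightarrow> finite {u. f u \<noteq> \<zero>}"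
  by (simp add: carrier_A)

lemma support_in: "f \<in> carrier A \<Longrightarrow> f u \<noteq> \<zero> \<Longrightarrow> u \<in> S"
  unfolding carrier_A by blast

lemma mult_closed_A:
  assumes f: "f \<in> carrier A" and g: "g \<in> carrier A"
  shows "f \<otimes>\<^bsub>A\<^esub> g \<in> carrier A"
proof -
  have sub: "{w. (f \<otimes>\<^bsub>A\<^esub> g) w \<noteq> \<zero>} \<subseteq> (\<lambda>(u, v). u + v) ` ({u. f u \<noteq> \<zero>} \<times> {u. g u \<noteq> \<zero>})"
  proof
    fix w assume w: "w \<in> {w. (f \<otimes>\<^bsub>A\<^esub> g) w \<noteq> \<zero>}"
    have "\<exists>u. f u \<noteq> \<zero> \<and> g (w - u) \<noteq> \<zero>"
    proof (rule ccontr)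
      assume "\<not> ?thesis"
      then have "(f \<otimes>\<^bsub>A\<^esub> g) w = \<zero>"
        unfolding mult_apply[OF f g finite_support[OF f] subset_refl]
        using f g by (intro add.finprod_one_eqI) auto
      then show False using w by simp
    qed
    then obtain u where "f u \<noteq> \<zero>" "g (w - u) \<noteq> \<zero>" by blast
    moreover have "w = u + (w - u)" by simp
    ultimately show "w \<in> (\<lambda>(u, v). u + v) ` ({u. f u \<noteq> \<zero>} \<times> {u. g u \<noteq> \<zero>})"
      by (intro image_eqI[of _ _ "(u, w - u)"]) auto
  qed
  moreover have "finite ((\<lambda>(u, v). u + v) ` ({u. f u \<noteq> \<zero>} \<times> {u. g u \<noteq> \<zero>}))"
    using finite_support f g by blast
  moreover have "(\<lambda>(u, v). u + v) ` ({u. f u \<noteq> \<zero>} \<times> {u. g u \<noteq> \<zero>}) \<subseteq> S"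
    using support_in[OF f] support_in[OF g] by (auto intro!: plus_in)
  moreover have "(f \<otimes>\<^bsub>A\<^esub> g) w \<in> carrier R" for w
    unfolding mult_apply[OF f g finite_support[OF f] subset_refl] using f g by (intro finsum_closed) auto
  ultimately show ?thesis unfolding carrier_A by (meson finite_subset order_trans)
qed

lemma l_distr_A:
  assumes f: "f \<in> carrier A" "f' \<in> carrier A" and g: "g \<in> carrier A"
  shows "(f \<oplus>\<^bsub>A\<^esub> f') \<otimes>\<^bsub>A\<^esub> g = f \<otimes>\<^bsub>A\<^esub> g \<oplus>\<^bsub>A\<^esub> f' \<otimes>\<^bsub>A\<^esub> g"
proof
  fix w
  let ?U = "{u. f u \<noteq> \<zero>} \<union> {u. f' u \<noteq> \<zero>}"
  have U: "finite ?U" "{u. f u \<noteq> \<zero>} \<subseteq> ?U" "{u. f' u \<noteq> \<zero>} \<subseteq> ?U"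
    "{u. (f \<oplus>\<^bsub>A\<^esub> f') u \<noteq> \<zero>} \<subseteq> ?U"
    using finite_support f by (auto simp: add_A)
  have "((f \<oplus>\<^bsub>A\<^esub> f') \<otimes>\<^bsub>A\<^esub> g) w = (\<Oplus>u\<in>?U. (f u \<otimes> g (w - u)) \<oplus> (f' u \<otimes> g (w - u)))"
    unfolding mult_apply[OF add_closed_A[OF f] g U(1,4)]
    using f g by (intro finsum_cong) (auto simp: add_A l_distr)
  also have "\<dots> = (f \<otimes>\<^bsub>A\<^esub> g \<oplus>\<^bsub>A\<^esub> f' \<otimes>\<^bsub>A\<^esub> g) w"
    unfolding add_A mult_apply[OF f(1) g U(1,2)] mult_apply[OF f(2) g U(1,3)]
    using f g by (intro finsum_addf) auto
  finally show "((f \<oplus>\<^bsub>A\<^esub> f') \<otimes>\<^bsub>A\<^esub> g) w = (f \<otimes>\<^bsub>A\<^esub> g \<oplus>\<^bsub>A\<^esub> f' \<otimes>\<^bsub>A\<^esub> g) w" .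
qed

lemma r_distr_A:
  assumes f: "f \<in> carrier A" and g: "g \<in> carrier A" "g' \<in> carrier A"
  shows "f \<otimes>\<^bsub>A\<^esub> (g \<oplus>\<^bsub>A\<^esub> g') = f \<otimes>\<^bsub>A\<^esub> g \<oplus>\<^bsub>A\<^esub> f \<otimes>\<^bsub>A\<^esub> g'"
proof
  fix w
  let ?U = "{u. f u \<noteq> \<zero>}"
  have U: "finite ?U" "?U \<subseteq> ?U" using finite_support f by auto
  have "(f \<otimes>\<^bsub>A\<^esub> (g \<oplus>\<^bsub>A\<^esub> g')) w = (\<Oplus>u\<in>?U. (f u \<otimes> g (w - u)) \<oplus> (f u \<otimes> g' (w - u)))"
    unfolding mult_apply[OF f add_closed_A[OF g] U]
    using f g by (intro finsum_cong) (auto simp: add_A r_distr)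
  also have "\<dots> = (f \<otimes>\<^bsub>A\<^esub> g \<oplus>\<^bsub>A\<^esub> f \<otimes>\<^bsub>A\<^esub> g') w"
    unfolding add_A mult_apply[OF f g(1) U] mult_apply[OF f g(2) U]
    using f g by (intro finsum_addf) auto
  finally show "(f \<otimes>\<^bsub>A\<^esub> (g \<oplus>\<^bsub>A\<^esub> g')) w = (f \<otimes>\<^bsub>A\<^esub> g \<oplus>\<^bsub>A\<^esub> f \<otimes>\<^bsub>A\<^esub> g') w" .
qed

lemma character_mult_left:
  assumes "c \<in> carrier R" "u \<in> S" and g: "g \<in> carrier A"
  shows "character R c u \<otimes>\<^bsub>A\<^esub> g = (\<lambda>w. c \<otimes> g (w - u))"
proof
  fix w
  have "{v. character R c u v \<noteq> \<zero>} \<subseteq> {u}" by (auto simp: character_def)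
  then show "(character R c u \<otimes>\<^bsub>A\<^esub> g) w = c \<otimes> g (w - u)"
    using assms mult_apply[OF character_closed[OF assms(1,2)] g, of "{u}" w]
    by (simp add: character_def)
qed

lemma character_mult:
  assumes "c \<in> carrier R" "u \<in> S" "d \<in> carrier R" "v \<in> S"
  shows "character R c u \<otimes>\<^bsub>A\<^esub> character R d v = character R (c \<otimes> d) (u + v)"
  unfolding character_mult_left[OF assms(1,2) character_closed[OF assms(3,4)]]
  using assms by (auto simp: character_def fun_eq_iff algebra_simps)

lemma character_add:
  "c \<in> carrier R \<Longrightarrow> d \<in> carrier R \<Longrightarrow>
    character R c u \<oplus>\<^bsub>A\<^esub> character R d u = character R (c \<oplus> d) u"
  by (auto simp: character_def add_A)

text \<open>Biadditive identities between elements of the algebra need only be verified on characters.\<close>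

lemma character_induct [consumes 1, case_names zero character add]:
  assumes "f \<in> carrier A" and zero: "Q \<zero>\<^bsub>A\<^esub>"
    and char: "\<And>c u. c \<in> carrier R \<Longrightarrow> u \<in> S \<Longrightarrow> Q (character R c u)"
    and add: "\<And>f g. f \<in> carrier A \<Longrightarrow> g \<in> carrier A \<Longrightarrow> Q f \<Longrightarrow> Q g \<Longrightarrow> Q (f \<oplus>\<^bsub>A\<^esub> g)"
  shows "Q f"
proof -
  define U where "U = {u. f u \<noteq> \<zero>}"
  have "finite U" using finite_support assms(1) unfolding U_def by blast
  moreover have "{u. f u \<noteq> \<zero>} \<subseteq> U" unfolding U_def by simp
  ultimately show ?thesis using assms(1)
  proof (induction U arbitrary: f rule: finite_induct)
    case empty
    then have "f = \<zero>\<^bsub>A\<^esub>" by (auto simp: zero_A)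
    then show ?case using zero by simp
  next
    case (insert u U)
    show ?case
    proof (cases "f u = \<zero>")
      case True
      then show ?thesis using insert by (intro insert.IH) auto
    next
      case False
      define g where "g = f(u := \<zero>)"
      have uS: "u \<in> S" using False insert.prems(2) unfolding carrier_A by blast
      have "{v. g v \<noteq> \<zero>} \<subseteq> {v. f v \<noteq> \<zero>}" unfolding g_def by auto
      moreover have "g v \<in> carrier R" for v using insert.prems(2) unfolding g_def by simp
      ultimately have g: "g \<in> carrier A"
        using insert.prems(2) unfolding carrier_A by (meson finite_subset order_trans)
      have "f = character R (f u) u \<oplus>\<^bsub>A\<^esub> g"
        unfolding add_A g_def character_def using insert.prems(2) by (auto simp: carrier_A)
      moreover have "Q g" using insert.prems(1) by (intro insert.IH[OF _ g]) (auto simp: g_def)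
      ultimately show ?thesis
        using add[OF character_closed g] char insert.prems(2) uS by (metis coeff_closed)
    qed
  qed
qed

lemma abelian_group_A: "abelian_group A"
proof (rule abelian_groupI)
  fix f assume f: "f \<in> carrier A"
  have "{u. \<ominus> f u \<noteq> \<zero>} \<subseteq> {u. f u \<noteq> \<zero>}" by auto
  then have "(\<lambda>u. \<ominus> f u) \<in> carrier A"
    using f unfolding carrier_A by (auto dest: finite_subset)
  then show "\<exists>g\<in>carrier A. g \<oplus>\<^bsub>A\<^esub> f = \<zero>\<^bsub>A\<^esub>"
    using f by (intro bexI[of _ "\<lambda>u. \<ominus> f u"]) (auto simp: add_A zero_A l_neg)
qed (use add_closed_A in \<open>auto simp: add_A zero_A a_ac carrier_A\<close>)

sublocale A: abelian_group A by (rule abelian_group_A)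

lemma zero_mult_A: "f \<in> carrier A \<Longrightarrow> \<zero>\<^bsub>A\<^esub> \<otimes>\<^bsub>A\<^esub> f = \<zero>\<^bsub>A\<^esub>"
  and mult_zero_A: "f \<in> carrier A \<Longrightarrow> f \<otimes>\<^bsub>A\<^esub> \<zero>\<^bsub>A\<^esub> = \<zero>\<^bsub>A\<^esub>"
proof -
  assume f: "f \<in> carrier A"
  have "\<zero>\<^bsub>A\<^esub> \<otimes>\<^bsub>A\<^esub> f = \<zero>\<^bsub>A\<^esub> \<otimes>\<^bsub>A\<^esub> f \<oplus>\<^bsub>A\<^esub> \<zero>\<^bsub>A\<^esub> \<otimes>\<^bsub>A\<^esub> f"
    using l_distr_A[OF A.zero_closed A.zero_closed f] by simp
  then show "\<zero>\<^bsub>A\<^esub> \<otimes>\<^bsub>A\<^esub> f = \<zero>\<^bsub>A\<^esub>" using mult_closed_A[OF A.zero_closed f]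
    by (metis A.add.r_cancel_one')
  have "f \<otimes>\<^bsub>A\<^esub> \<zero>\<^bsub>A\<^esub> = f \<otimes>\<^bsub>A\<^esub> \<zero>\<^bsub>A\<^esub> \<oplus>\<^bsub>A\<^esub> f \<otimes>\<^bsub>A\<^esub> \<zero>\<^bsub>A\<^esub>"
    using r_distr_A[OF f A.zero_closed A.zero_closed] by simp
  then show "f \<otimes>\<^bsub>A\<^esub> \<zero>\<^bsub>A\<^esub> = \<zero>\<^bsub>A\<^esub>" using mult_closed_A[OF f A.zero_closed]
    by (metis A.add.r_cancel_one')
qed

lemmas biadditive = l_distr_A r_distr_A zero_mult_A mult_zero_A mult_closed_A add_closed_A

lemma mult_comm_A:
  assumes f: "f \<in> carrier A" and g: "g \<in> carrier A"
  shows "f \<otimes>\<^bsub>A\<^esub> g = g \<otimes>\<^bsub>A\<^esub> f"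
  using f
proof (induction f rule: character_induct)
  case (character c u)
  show ?case using g
    by (induction g rule: character_induct)
      (use character in \<open>auto simp: biadditive character_mult m_comm add.commute\<close>)
qed (use g in \<open>auto simp: biadditive\<close>)

lemma mult_assoc_A:
  assumes f: "f \<in> carrier A" and g: "g \<in> carrier A" and h: "h \<in> carrier A"
  shows "(f \<otimes>\<^bsub>A\<^esub> g) \<otimes>\<^bsub>A\<^esub> h = f \<otimes>\<^bsub>A\<^esub> (g \<otimes>\<^bsub>A\<^esub> h)"
  using f
proof (induction f rule: character_induct)
  case (character c u)
  show ?case using g
  proof (induction g rule: character_induct)
    case (character d v)
    show ?case using h
      by (induction h rule: character_induct)
        (use character \<open>c \<in> carrier R\<close> \<open>u \<in> S\<close> in
          \<open>auto simp: biadditive character_mult m_assoc add.assoc\<close>)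
  qed (use h character in \<open>auto simp: biadditive\<close>)
qed (use g h in \<open>auto simp: biadditive\<close>)

lemma cring_A: "cring A"
proof (rule cringI)
  show "comm_monoid A"
  proof (rule comm_monoidI)
    fix f assume f: "f \<in> carrier A"
    show "\<one>\<^bsub>A\<^esub> \<otimes>\<^bsub>A\<^esub> f = f"
      unfolding one_A alg_const_character using f by (simp add: character_mult_left)
      show "f \<otimes>\<^bsub>A\<^esub> g = g \<otimes>\<^bsub>A\<^esub> f" if "f \<in> carrier A" "g \<in> carrier A" for f g
      using that by (rule mult_comm_A)
  qed (auto simp: biadditive mult_assoc_A one_A)
qed (auto simp: abelian_group_A l_distr_A)

sublocale A: cring A by (rule cring_A)

lemma alg_const_hom: "alg_const R \<in> ring_hom R A"
  by (rule ring_hom_memI)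
    (auto simp: alg_const_character character_add character_mult one_A)

text \<open>A ring homomorphism if \<open>Z\<close> is multiplicative on \<open>S\<close>.\<close>

definition evaluation :: "('a \<Rightarrow> 'e::comm_ring_1) \<Rightarrow> ((nat \<Rightarrow> int) \<Rightarrow> 'e) \<Rightarrow> ((nat \<Rightarrow> int) \<Rightarrow> 'a) \<Rightarrow> 'e" where
  "evaluation \<theta> Z f = (\<Sum>u | f u \<noteq> \<zero>. \<theta> (f u) * Z u)"

context
  fixes \<theta> :: "'a \<Rightarrow> 'e::comm_ring_1" and Z :: "(nat \<Rightarrow> int) \<Rightarrow> 'e"
  assumes hom: "\<theta> \<in> ring_hom R ring_of_type_algebra"
    and Z0: "Z 0 = 1" and Zadd: "\<And>u v. u \<in> S \<Longrightarrow> v \<in> S \<Longrightarrow> Z (u + v) = Z u * Z v"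
begin

lemma coeff_hom: "x \<in> carrier R \<Longrightarrow> y \<in> carrier R \<Longrightarrow> \<theta> (x \<otimes> y) = \<theta> x * \<theta> y"
    "x \<in> carrier R \<Longrightarrow> y \<in> carrier R \<Longrightarrow> \<theta> (x \<oplus> y) = \<theta> x + \<theta> y" "\<theta> \<one> = 1"
  using ring_hom_mult[OF hom] ring_hom_add[OF hom] ring_hom_one[OF hom] by auto

lemma coeff_hom_zero: "\<theta> \<zero> = 0"
  using coeff_hom(2)[of \<zero> \<zero>] by simp

lemma evaluation_eq:
  assumes "finite U" "{u. f u \<noteq> \<zero>} \<subseteq> U"
  shows "evaluation \<theta> Z f = (\<Sum>u\<in>U. \<theta> (f u) * Z u)"
  unfolding evaluation_def
  by (rule sum.mono_neutral_left) (use assms coeff_hom_zero in auto)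

lemma evaluation_character:
  "evaluation \<theta> Z (character R c u) = \<theta> c * Z u"
  by (subst evaluation_eq[of "{u}"]) (auto simp: character_def)

lemma evaluation_add:
  assumes "f \<in> carrier A" "g \<in> carrier A"
  shows "evaluation \<theta> Z (f \<oplus>\<^bsub>A\<^esub> g) = evaluation \<theta> Z f + evaluation \<theta> Z g"
proof -
  let ?U = "{u. f u \<noteq> \<zero>} \<union> {u. g u \<noteq> \<zero>}"
  have "finite ?U" "{u. (f \<oplus>\<^bsub>A\<^esub> g) u \<noteq> \<zero>} \<subseteq> ?U"
    using assms finite_support by (auto simp: add_A)
  then have "evaluation \<theta> Z (f \<oplus>\<^bsub>A\<^esub> g) = (\<Sum>u\<in>?U. \<theta> (f u) * Z u + \<theta> (g u) * Z u)"
    using assms by (subst evaluation_eq[of ?U]) (auto simp: add_A coeff_hom algebra_simps)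
  also have "\<dots> = evaluation \<theta> Z f + evaluation \<theta> Z g"
    using \<open>finite ?U\<close> by (simp add: sum.distrib evaluation_eq[of ?U])
  finally show ?thesis .
qed

lemma evaluation_zero: "evaluation \<theta> Z \<zero>\<^bsub>A\<^esub> = 0"
  by (simp add: evaluation_def zero_A)

lemma evaluation_mult:
  assumes f: "f \<in> carrier A" and g: "g \<in> carrier A"
  shows "evaluation \<theta> Z (f \<otimes>\<^bsub>A\<^esub> g) = evaluation \<theta> Z f * evaluation \<theta> Z g"
  using f
proof (induction f rule: character_induct)
  case (character c u)
  show ?case using g
    by (induction g rule: character_induct)
      (use character in \<open>auto simp: evaluation_character evaluation_zero evaluation_add biadditive
         character_mult coeff_hom Zadd algebra_simps\<close>)
qed (use g in \<open>auto simp: evaluation_zero evaluation_add biadditive algebra_simps\<close>)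

lemma evaluation_hom: "evaluation \<theta> Z \<in> ring_hom A ring_of_type_algebra"
  by (rule ring_hom_memI)
    (auto simp: evaluation_add evaluation_mult one_A alg_const_character evaluation_character
      coeff_hom Z0)

end

end

text \<open>Both sides of multiplicativity are biadditive, so it suffices to compare them on characters.\<close>

lemma coefficient_extension_hom:
  assumes "submonoid_algebra R S" "submonoid_algebra R' S" and h: "h \<in> ring_hom R R'"
  shows "(\<lambda>f u. h (f u)) \<in> ring_hom (monoid_algebra R S) (monoid_algebra R' S)"
proof -
  interpret R: submonoid_algebra R S by fact
  interpret R': submonoid_algebra R' S by fact
  interpret h: ring_hom_cring R R' h
    by unfold_locales (rule h)
  let ?e = "\<lambda>f u. h (f u)"
  have closed: "?e f \<in> carrier R'.A" if f: "f \<in> carrier R.A" for f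
  proof -
    have "{u. h (f u) \<noteq> \<zero>\<^bsub>R'\<^esub>} \<subseteq> {u. f u \<noteq> \<zero>\<^bsub>R\<^esub>}" by auto
    then show ?thesis using f unfolding R.carrier_A R'.carrier_A by (auto dest: finite_subset)
  qed
  have char: "?e (character R c u) = character R' (h c) u" for c u
    by (auto simp: character_def)
  have add: "?e (f \<oplus>\<^bsub>R.A\<^esub> g) = ?e f \<oplus>\<^bsub>R'.A\<^esub> ?e g" if "f \<in> carrier R.A" "g \<in> carrier R.A" for f g
    using that by (auto simp: R.add_A R'.add_A)
  have zero: "?e \<zero>\<^bsub>R.A\<^esub> = \<zero>\<^bsub>R'.A\<^esub>" by (auto simp: R.zero_A R'.zero_A)
  have mult: "?e (f \<otimes>\<^bsub>R.A\<^esub> g) = ?e f \<otimes>\<^bsub>R'.A\<^esub> ?e g" if f: "f \<in> carrier R.A" and g: "g \<in> carrier R.A" for f g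
    using f
  proof (induction f rule: R.character_induct)
    case (character c u)
    show ?case using g
    proof (induction g rule: R.character_induct)
      case (character d v)
      then show ?case using \<open>c \<in> carrier R\<close> \<open>u \<in> S\<close>
        by (simp only: char R.character_mult R'.character_mult h.hom_closed h.hom_mult)
    qed (use character in \<open>simp_all only: zero add R.biadditive R'.biadditive closed
        R.character_closed\<close>)
  qed (use g in \<open>simp_all only: zero add R.biadditive R'.biadditive closed\<close>)
  show ?thesis
    by (rule ring_hom_memI)
      (auto simp: closed add mult R.one_A R'.one_A alg_const_def char simp del: R.A.add.m_comm)
qed

section \<open>Formal power series in several variables\<close>

lemma finite_submultisets [simp]: "finite {b. b \<subseteq># (a :: 'a multiset)}"
proof (induction a)
  case (add x a)
  have "b \<in> {b. b \<subseteq># a} \<union> add_mset x ` {b. b \<subseteq># a}" if "b \<subseteq># add_mset x a" for b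
  proof (cases "x \<in># b")
    case True
    then obtain c where "b = add_mset x c" by (metis multi_member_split)
    then show ?thesis using that by auto
  next
    case False
    then show ?thesis using that
      by (auto simp: subseteq_mset_def not_in_iff split: if_splits) (metis le0)
  qed
  then have "{b. b \<subseteq># add_mset x a} \<subseteq> {b. b \<subseteq># a} \<union> add_mset x ` {b. b \<subseteq># a}" by blast
  then show ?case using add by (auto dest: finite_subset)
qed simp

lemma carrier_mps: "f \<in> carrier (mps n) \<longleftrightarrow> (\<forall>a. f a \<noteq> 0 \<longrightarrow> set_mset a \<subseteq> {..<n})"
  by (simp add: mps_def)

lemma mult_mps: "(f \<otimes>\<^bsub>mps n\<^esub> g) a = (\<Sum>b | b \<subseteq># a. f b * g (a - b))"
  and add_mps: "f \<oplus>\<^bsub>mps n\<^esub> g = (\<lambda>a. f a + g a)"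
  and zero_mps: "\<zero>\<^bsub>mps n\<^esub> = (\<lambda>a. 0)"
  and one_mps: "\<one>\<^bsub>mps n\<^esub> = mps_const 1"
  by (simp_all add: mps_def mps_const_def)

lemma mult_mps_closed:
  assumes f: "f \<in> carrier (mps n)" and g: "g \<in> carrier (mps n)"
  shows "f \<otimes>\<^bsub>mps n\<^esub> g \<in> carrier (mps n)"
  unfolding carrier_mps
proof (intro allI impI)
  fix a assume "(f \<otimes>\<^bsub>mps n\<^esub> g) a \<noteq> 0"
  then obtain b where b: "b \<subseteq># a" "f b \<noteq> 0" "g (a - b) \<noteq> 0"
    unfolding mult_mps by (metis (no_types, lifting) mem_Collect_eq mult_zero_left mult_zero_right sum.neutral)
  then have "set_mset b \<subseteq> {..<n}" "set_mset (a - b) \<subseteq> {..<n}" using f g unfolding carrier_mps by auto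
  moreover have "a = b + (a - b)" using b(1) by simp
  ultimately show "set_mset a \<subseteq> {..<n}" by (metis Un_least set_mset_union)
qed

lemma mult_mps_commute:
  "f \<otimes>\<^bsub>mps n\<^esub> g = g \<otimes>\<^bsub>mps n\<^esub> (f :: nat multiset \<Rightarrow> 'k::comm_ring_1)"
proof
  fix a
  show "(f \<otimes>\<^bsub>mps n\<^esub> g) a = (g \<otimes>\<^bsub>mps n\<^esub> f) a"
    unfolding mult_mps
    by (rule sum.reindex_bij_witness[of _ "\<lambda>b. a - b" "\<lambda>b. a - b"])
      (auto simp: subset_mset.le_iff_add mult.commute)
qed

lemma mult_mps_assoc:
  "(f \<otimes>\<^bsub>mps n\<^esub> g) \<otimes>\<^bsub>mps n\<^esub> h = f \<otimes>\<^bsub>mps n\<^esub> (g \<otimes>\<^bsub>mps n\<^esub> (h :: nat multiset \<Rightarrow> 'k::comm_ring_1))"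
proof
  fix a :: "nat multiset"
  have "((f \<otimes>\<^bsub>mps n\<^esub> g) \<otimes>\<^bsub>mps n\<^esub> h) a =
      (\<Sum>(b, c)\<in>(SIGMA b:{b. b \<subseteq># a}. {c. c \<subseteq># b}). f c * g (b - c) * h (a - b))"
    unfolding mult_mps by (simp add: sum.Sigma sum_distrib_right)
  also have "\<dots> = (\<Sum>(c, d)\<in>(SIGMA c:{c. c \<subseteq># a}. {d. d \<subseteq># a - c}). f c * g d * h (a - c - d))"
  proof (rule sum.reindex_bij_witness[of _ "\<lambda>(c, d). (c + d, c)" "\<lambda>(b, c). (c, b - c)"])
    fix p assume "p \<in> (SIGMA b:{b. b \<subseteq># a}. {c. c \<subseteq># b})"
    then obtain b c where p: "p = (b, c)" "b \<subseteq># a" "c \<subseteq># b" by auto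
    then obtain d e where "b = c + d" "a = b + e" by (metis subset_mset.le_iff_add)
    then show "(case case p of (b, c) \<Rightarrow> (c, b - c) of (c, d) \<Rightarrow> (c + d, c)) = p"
      "(case p of (b, c) \<Rightarrow> (c, b - c)) \<in> (SIGMA c:{c. c \<subseteq># a}. {d. d \<subseteq># a - c})"
      "(case case p of (b, c) \<Rightarrow> (c, b - c) of (c, d) \<Rightarrow> f c * g d * h (a - c - d)) =
        (case p of (b, c) \<Rightarrow> f c * g (b - c) * h (a - b))"
      using p by (auto simp: ac_simps)
  next
    fix p assume "p \<in> (SIGMA c:{c. c \<subseteq># a}. {d. d \<subseteq># a - c})"
    then obtain c d where p: "p = (c, d)" "c \<subseteq># a" "d \<subseteq># a - c" by auto
    then obtain e where e: "a = c + e" "d \<subseteq># e" by (metis add_diff_cancel_left' subset_mset.le_iff_add)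
    then show "(case case p of (c, d) \<Rightarrow> (c + d, c) of (b, c) \<Rightarrow> (c, b - c)) = p"
      "(case p of (c, d) \<Rightarrow> (c + d, c)) \<in> (SIGMA b:{b. b \<subseteq># a}. {c. c \<subseteq># b})"
      using p by auto
  qed
  also have "\<dots> = (f \<otimes>\<^bsub>mps n\<^esub> (g \<otimes>\<^bsub>mps n\<^esub> h)) a"
    unfolding mult_mps by (simp add: sum.Sigma sum_distrib_left mult.assoc)
  finally show "((f \<otimes>\<^bsub>mps n\<^esub> g) \<otimes>\<^bsub>mps n\<^esub> h) a = (f \<otimes>\<^bsub>mps n\<^esub> (g \<otimes>\<^bsub>mps n\<^esub> h)) a" .
qed

lemma mps_const_mult: "mps_const c \<otimes>\<^bsub>mps n\<^esub> f = (\<lambda>a. c * f a)"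
proof
  fix a
  have "(mps_const c \<otimes>\<^bsub>mps n\<^esub> f) a = (\<Sum>b\<in>{{#}}. mps_const c b * f (a - b))"
    unfolding mult_mps by (rule sum.mono_neutral_right) (auto simp: mps_const_def)
  then show "(mps_const c \<otimes>\<^bsub>mps n\<^esub> f) a = c * f a" by (simp add: mps_const_def)
qed

lemma mps_const_closed [simp]: "mps_const c \<in> carrier (mps n)"
  unfolding carrier_mps mps_const_def by auto

lemma mps_var_mult: "(mps_var i \<otimes>\<^bsub>mps n\<^esub> f) a = (if i \<in># a then f (a - {#i#}) else 0)"
proof -
  have "(mps_var i \<otimes>\<^bsub>mps n\<^esub> f) a = (\<Sum>b\<in>{b. b \<subseteq># a} \<inter> {{#i#}}. mps_var i b * f (a - b))"
    unfolding mult_mps by (rule sum.mono_neutral_right) (auto simp: mps_var_def)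
  also have "{b. b \<subseteq># a} \<inter> {{#i#}} = (if i \<in># a then {{#i#}} else {})" by auto
  finally show ?thesis by (simp add: mps_var_def)
qed

lemma mps_var_closed [simp]: "i < n \<Longrightarrow> mps_var i \<in> carrier (mps n)"
  unfolding carrier_mps mps_var_def by auto

lemma cring_mps: "cring (mps n :: (nat multiset \<Rightarrow> 'k::comm_ring_1) ring)"
proof (rule cringI)
  show "abelian_group (mps n :: (nat multiset \<Rightarrow> 'k) ring)"
  proof (rule abelian_groupI)
    fix f :: "nat multiset \<Rightarrow> 'k" assume "f \<in> carrier (mps n)"
    then show "\<exists>g\<in>carrier (mps n). g \<oplus>\<^bsub>mps n\<^esub> f = \<zero>\<^bsub>mps n\<^esub>"
      by (intro bexI[of _ "\<lambda>a. - f a"]) (auto simp: add_mps zero_mps carrier_mps)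
  next
    fix f g :: "nat multiset \<Rightarrow> 'k"
    assume fg: "f \<in> carrier (mps n)" "g \<in> carrier (mps n)"
    have "f a \<noteq> 0 \<or> g a \<noteq> 0" if "f a + g a \<noteq> 0" for a using that by auto
    then show "f \<oplus>\<^bsub>mps n\<^esub> g \<in> carrier (mps n)"
      using fg unfolding carrier_mps add_mps by blast
    show "f \<oplus>\<^bsub>mps n\<^esub> g = g \<oplus>\<^bsub>mps n\<^esub> f" unfolding add_mps by (simp only: add.commute)
    show "(f \<oplus>\<^bsub>mps n\<^esub> g) \<oplus>\<^bsub>mps n\<^esub> h = f \<oplus>\<^bsub>mps n\<^esub> (g \<oplus>\<^bsub>mps n\<^esub> h)" for h
      unfolding add_mps by (simp only: add.assoc)
  qed (simp_all add: add_mps zero_mps carrier_mps)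
  show "comm_monoid (mps n :: (nat multiset \<Rightarrow> 'k) ring)"
  proof (rule comm_monoidI)
    show "f \<otimes>\<^bsub>mps n\<^esub> g = g \<otimes>\<^bsub>mps n\<^esub> f" for f g :: "nat multiset \<Rightarrow> 'k"
      by (rule mult_mps_commute)
  qed (simp_all add: mult_mps_closed mult_mps_assoc one_mps mps_const_mult)
  show "(f \<oplus>\<^bsub>mps n\<^esub> g) \<otimes>\<^bsub>mps n\<^esub> h = f \<otimes>\<^bsub>mps n\<^esub> h \<oplus>\<^bsub>mps n\<^esub> g \<otimes>\<^bsub>mps n\<^esub> h"
    for f g h :: "nat multiset \<Rightarrow> 'k"
    by (rule ext) (simp add: mult_mps add_mps distrib_right sum.distrib)
qed

interpretation mps: cring "mps n :: (nat multiset \<Rightarrow> 'k::comm_ring_1) ring" for n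
  by (rule cring_mps)

lemma mps_mult_const_term: "(f \<otimes>\<^bsub>mps n\<^esub> g) {#} = f {#} * g {#}"
  by (simp add: mult_mps)

lemma a_minus_mps:
  assumes "f \<in> carrier (mps n)" "g \<in> carrier (mps n)"
  shows "f \<ominus>\<^bsub>mps n\<^esub> g = (\<lambda>a. f a - (g a :: 'k::comm_ring_1))"
proof -
  have "(f \<ominus>\<^bsub>mps n\<^esub> g) \<oplus>\<^bsub>mps n\<^esub> g = f"
    using assms mps.a_assoc[of f n "\<ominus>\<^bsub>mps n\<^esub> g" g] by (simp add: mps.minus_eq mps.l_neg)
  then have "(f \<ominus>\<^bsub>mps n\<^esub> g) a + g a = f a" for a unfolding add_mps by (rule fun_cong)
  then show ?thesis by (metis add_diff_cancel_right')
qed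

lemma mps_pow_eq_0:
  assumes F: "F {#} = 0" and "size a < l"
  shows "(F [^]\<^bsub>mps n\<^esub> l) a = (0 :: 'k::comm_ring_1)"
  using assms(2)
proof (induction l arbitrary: a)
  case (Suc l)
  have "(F [^]\<^bsub>mps n\<^esub> l) b * F (a - b) = 0" if "b \<subseteq># a" for b
  proof (cases "b = a")
    case False
    then have "size b < size a" using that by (meson mset_subset_size subset_mset.le_neq_trans)
    then show ?thesis using Suc by simp
  qed (simp add: F)
  then show ?case by (simp add: mult_mps)
qed simp

text \<open>The series \<open>\<Sum>\<^sub>l c\<^sub>l F\<^sup>l\<close>, for \<open>F\<close> without constant term: then \<open>F\<^sup>l\<close> starts in degree \<open>l\<close>,
  and the truncated sum is the full one.\<close>

definition mps_compose :: "nat \<Rightarrow> (nat multiset \<Rightarrow> 'k) \<Rightarrow> (nat \<Rightarrow> 'k) \<Rightarrow> nat multiset \<Rightarrow> 'k::comm_ring_1" where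
  "mps_compose n F c = (\<lambda>a. \<Sum>l\<le>size a. c l * (F [^]\<^bsub>mps n\<^esub> l) a)"

lemma mps_compose_eq:
  assumes "F {#} = 0" "size a \<le> N"
  shows "mps_compose n F c a = (\<Sum>l\<le>N. c l * (F [^]\<^bsub>mps n\<^esub> l) a)"
  unfolding mps_compose_def
  by (rule sum.mono_neutral_left) (use assms mps_pow_eq_0[of F] in auto)

lemma mps_compose_closed:
  assumes F: "F \<in> carrier (mps n)"
  shows "mps_compose n F c \<in> carrier (mps n)"
proof -
  have "set_mset a \<subseteq> {..<n}" if nz: "mps_compose n F c a \<noteq> 0" for a
  proof -
    have "\<exists>l::nat. (F [^]\<^bsub>mps n\<^esub> l) a \<noteq> 0"
    proof (rule ccontr)
      assume "\<not> ?thesis"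
      then show False using nz unfolding mps_compose_def by simp
    qed
    then show ?thesis using mps.nat_pow_closed[OF F] unfolding carrier_mps by blast
  qed
  then show ?thesis unfolding carrier_mps by blast
qed

text \<open>Splitting off the first term shows that every homomorphism respects these infinite sums up
  to multiples of arbitrarily high powers of the image of \<open>F\<close>.\<close>

lemma mps_compose_rec:
  assumes F: "F \<in> carrier (mps n)" "F {#} = 0"
  shows "mps_compose n F c =
    mps_const (c 0) \<oplus>\<^bsub>mps n\<^esub> F \<otimes>\<^bsub>mps n\<^esub> mps_compose n F (\<lambda>l. c (Suc l))"
proof
  fix a :: "nat multiset"
  have "(F \<otimes>\<^bsub>mps n\<^esub> mps_compose n F (\<lambda>l. c (Suc l))) a =
      (\<Sum>b | b \<subseteq># a. F b * (\<Sum>l\<le>size a. c (Suc l) * (F [^]\<^bsub>mps n\<^esub> l) (a - b)))"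
  proof -
    have "size (a - b) \<le> size a" for b by (rule size_mset_mono) (rule diff_subset_eq_self)
    then have "mps_compose n F d (a - b) = (\<Sum>l\<le>size a. d l * (F [^]\<^bsub>mps n\<^esub> l) (a - b))" for b d
      by (rule mps_compose_eq[where F = F, OF F(2)])
    then show ?thesis unfolding mult_mps by simp
  qed
  also have "\<dots> = (\<Sum>l\<le>size a. c (Suc l) * (F \<otimes>\<^bsub>mps n\<^esub> F [^]\<^bsub>mps n\<^esub> l) a)"
    unfolding mult_mps sum_distrib_left by (subst sum.swap) (simp add: algebra_simps)
  also have "\<dots> = (\<Sum>l\<le>size a. c (Suc l) * (F [^]\<^bsub>mps n\<^esub> Suc l) a)"
    using F by (simp add: mult_mps_commute)
  finally have 1: "(F \<otimes>\<^bsub>mps n\<^esub> mps_compose n F (\<lambda>l. c (Suc l))) a =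
    (\<Sum>l\<le>size a. c (Suc l) * (F [^]\<^bsub>mps n\<^esub> Suc l) a)" .
  have "mps_compose n F c a = (\<Sum>l\<le>Suc (size a). c l * (F [^]\<^bsub>mps n\<^esub> l) a)"
    using F by (intro mps_compose_eq) auto
  also have "\<dots> = c 0 * (F [^]\<^bsub>mps n\<^esub> (0::nat)) a + (\<Sum>l\<le>size a. c (Suc l) * (F [^]\<^bsub>mps n\<^esub> Suc l) a)"
    by (rule sum.atMost_Suc_shift)
  finally show "mps_compose n F c a =
      (mps_const (c 0) \<oplus>\<^bsub>mps n\<^esub> F \<otimes>\<^bsub>mps n\<^esub> mps_compose n F (\<lambda>l. c (Suc l))) a"
    unfolding 1[symmetric] add_mps by (simp add: one_mps mps_const_def)
qed

text \<open>A geometric series inverts a series with nonzero constant term.\<close>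

lemma mps_unit:
  fixes f :: "nat multiset \<Rightarrow> 'k::field"
  assumes f: "f \<in> carrier (mps n)" "f {#} \<noteq> 0"
  shows "\<exists>g\<in>carrier (mps n). f \<otimes>\<^bsub>mps n\<^esub> g = \<one>\<^bsub>mps n\<^esub>"
proof -
  define c where "c = f {#}"
  define F where "F = \<one>\<^bsub>mps n\<^esub> \<ominus>\<^bsub>mps n\<^esub> mps_const (1 / c) \<otimes>\<^bsub>mps n\<^esub> f"
  have F: "F \<in> carrier (mps n)" unfolding F_def using f by simp
  have "F = (\<lambda>a. \<one>\<^bsub>mps n\<^esub> a - (mps_const (1 / c) \<otimes>\<^bsub>mps n\<^esub> f) a)"
    unfolding F_def by (rule a_minus_mps) (use f in simp_all)
  then have "F = (\<lambda>a. mps_const 1 a - 1 / c * f a)" by (simp add: mps_const_mult one_mps)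
  then have F0: "F {#} = 0" and "f = (\<lambda>a. c * (mps_const 1 a - F a))"
    using f by (auto simp: c_def mps_const_def)
  then have Fa: "f = mps_const c \<otimes>\<^bsub>mps n\<^esub> (\<one>\<^bsub>mps n\<^esub> \<ominus>\<^bsub>mps n\<^esub> F)"
    unfolding mps_const_mult using a_minus_mps[OF mps.one_closed F] by (simp add: one_mps)
  define G where "G = mps_compose n F (\<lambda>_. 1)"
  have G: "G \<in> carrier (mps n)" unfolding G_def by (rule mps_compose_closed[OF F])
  have "G = \<one>\<^bsub>mps n\<^esub> \<oplus>\<^bsub>mps n\<^esub> F \<otimes>\<^bsub>mps n\<^esub> G"
    unfolding G_def one_mps by (rule mps_compose_rec[OF F F0])
  then have "(\<one>\<^bsub>mps n\<^esub> \<ominus>\<^bsub>mps n\<^esub> F) \<otimes>\<^bsub>mps n\<^esub> G = \<one>\<^bsub>mps n\<^esub>"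
    using F G
    by (simp add: mps.minus_eq mps.l_distr mps.l_minus)
      (metis F G mps.add.inv_closed mps.add.inv_solve_right' mps.m_closed mps.one_closed)
  moreover have "f \<otimes>\<^bsub>mps n\<^esub> (mps_const (1 / c) \<otimes>\<^bsub>mps n\<^esub> G) =
      (mps_const (1 / c) \<otimes>\<^bsub>mps n\<^esub> mps_const c) \<otimes>\<^bsub>mps n\<^esub> ((\<one>\<^bsub>mps n\<^esub> \<ominus>\<^bsub>mps n\<^esub> F) \<otimes>\<^bsub>mps n\<^esub> G)"
    using F G by (subst Fa) (simp add: mps.m_ac mps.minus_closed)
  moreover have "mps_const (1 / c) \<otimes>\<^bsub>mps n\<^esub> mps_const c = \<one>\<^bsub>mps n\<^esub>"
    unfolding mps_const_mult one_mps using f by (auto simp: mps_const_def c_def)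
  ultimately show ?thesis using G by (intro bexI[of _ "mps_const (1 / c) \<otimes>\<^bsub>mps n\<^esub> G"]) auto
qed

lemma ideal_mps_no_const: "ideal {f \<in> carrier (mps n). f {#} = 0} (mps n :: (nat multiset \<Rightarrow> 'k::comm_ring_1) ring)"
proof (rule idealI)
  show "subgroup {f \<in> carrier (mps n). f {#} = 0} (add_monoid (mps n :: (nat multiset \<Rightarrow> 'k) ring))"
  proof (rule mps.add.subgroupI)
    fix f :: "nat multiset \<Rightarrow> 'k" assume f: "f \<in> {f \<in> carrier (mps n). f {#} = 0}"
    then have "\<ominus>\<^bsub>mps n\<^esub> f = \<zero>\<^bsub>mps n\<^esub> \<ominus>\<^bsub>mps n\<^esub> f" by (simp add: mps.minus_eq)
    also have "\<dots> = (\<lambda>a. - f a)" using f by (subst a_minus_mps) (simp_all add: zero_mps carrier_mps)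
    finally have "\<ominus>\<^bsub>mps n\<^esub> f = (\<lambda>a. - f a)" .
    then show "\<ominus>\<^bsub>mps n\<^esub> f \<in> {f \<in> carrier (mps n). f {#} = 0}"
      using f by (auto simp: carrier_mps)
    fix g :: "nat multiset \<Rightarrow> 'k" assume "g \<in> {f \<in> carrier (mps n). f {#} = 0}"
    then show "f \<oplus>\<^bsub>mps n\<^esub> g \<in> {f \<in> carrier (mps n). f {#} = 0}"
      using f mps.a_closed[of f n g] by (simp add: add_mps)
  next
    show "{f :: nat multiset \<Rightarrow> 'k. f \<in> carrier (mps n) \<and> f {#} = 0} \<noteq> {}"
      using mps.zero_closed by (force simp: zero_mps)
  qed auto
qed (auto simp: mps_mult_const_term mps.ring_axioms)

lemma mps_maximal_ideals:
  fixes M :: "(nat multiset \<Rightarrow> 'k::field) set"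
  shows "maximalideal M (mps n) \<longleftrightarrow> M = {f \<in> carrier (mps n). f {#} = 0}"
proof -
  let ?M = "{f :: nat multiset \<Rightarrow> 'k. f \<in> carrier (mps n) \<and> f {#} = 0}"
  have one: "\<one>\<^bsub>mps n\<^esub> \<notin> ?M" by (simp add: one_mps mps_const_def)
  have proper_sub: "J \<subseteq> ?M" if J: "ideal J (mps n)" "J \<noteq> carrier (mps n)" for J
  proof
    interpret J: ideal J "mps n" by (rule J(1))
    fix f assume f: "f \<in> J"
    show "f \<in> ?M"
    proof (rule ccontr)
      assume "f \<notin> ?M"
      then obtain g where "g \<in> carrier (mps n)" "f \<otimes>\<^bsub>mps n\<^esub> g = \<one>\<^bsub>mps n\<^esub>"
        using mps_unit[of f n] J.Icarr[OF f] by auto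
      then have "\<one>\<^bsub>mps n\<^esub> \<in> J" using J.I_r_closed[OF f] by metis
      then show False using J.one_imp_carrier J(2) by blast
    qed
  qed
  have max: "maximalideal ?M (mps n)"
  proof (rule maximalidealI[OF ideal_mps_no_const])
    show "carrier (mps n) \<noteq> ?M" using one mps.one_closed by blast
    show "J = ?M \<or> J = carrier (mps n)" if "ideal J (mps n)" "?M \<subseteq> J" for J
      using proper_sub[OF that(1)] that(2) by blast
  qed
  moreover have "M = ?M" if M: "maximalideal M (mps n)"
  proof -
    interpret M: maximalideal M "mps n" by (rule M)
    have "M \<subseteq> ?M" using proper_sub[OF M.is_ideal] M.I_notcarr by blast
    then show ?thesis using M.I_maximal[OF ideal_mps_no_const] one mps.one_closed by blast
  qed
  ultimately show ?thesis by blast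
qed

lemma max_ideal_mps:
  "max_ideal (mps n :: (nat multiset \<Rightarrow> 'k::field) ring) = {f \<in> carrier (mps n). f {#} = 0}"
  unfolding max_ideal_def mps_maximal_ideals by simp

text \<open>Splitting off the multiples of the last variable reduces the number of variables that occur.\<close>

lemma genideal_mps_vars:
  fixes f :: "nat multiset \<Rightarrow> 'k::comm_ring_1"
  assumes f: "f \<in> carrier (mps n)" "f {#} = 0"
  shows "f \<in> genideal (mps n) (mps_var ` {..<n})"
proof -
  let ?I = "genideal (mps n) (mps_var ` {..<n} :: (nat multiset \<Rightarrow> 'k) set)"
  have sub: "mps_var ` {..<n} \<subseteq> carrier (mps n)" by auto
  interpret I: ideal ?I "mps n" by (rule mps.genideal_ideal[OF sub])
  have "f \<in> ?I" if "f \<in> carrier (mps n)" "\<And>a. f a \<noteq> 0 \<Longrightarrow> \<exists>i<k. i \<in># a" "k \<le> n"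
    for k and f :: "nat multiset \<Rightarrow> 'k"
    using that
  proof (induction k arbitrary: f)
    case 0
    then have "f = \<zero>\<^bsub>mps n\<^esub>" by (auto simp: zero_mps)
    then show ?case by simp
  next
    case (Suc k)
    define h where "h = (\<lambda>a. f (add_mset k a))"
    define g where "g = (\<lambda>a. if k \<in># a then 0 else f a)"
    have h: "h \<in> carrier (mps n)" and g: "g \<in> carrier (mps n)"
      using Suc.prems(1) unfolding h_def g_def carrier_mps by (auto, fastforce)
    have "g \<in> ?I"
    proof (rule Suc.IH[OF g])
      fix a assume "g a \<noteq> 0"
      then have "k \<notin># a" "f a \<noteq> 0" by (auto simp: g_def split: if_splits)
      then show "\<exists>i<k. i \<in># a" using Suc.prems(2)[of a] less_Suc_eq by metis
    qed (use Suc.prems in simp)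
    moreover have "mps_var k \<in> ?I"
      using mps.genideal_self[OF sub] Suc.prems(3) by auto
    then have "mps_var k \<otimes>\<^bsub>mps n\<^esub> h \<in> ?I" using h by (rule I.I_r_closed)
    moreover have "f = g \<oplus>\<^bsub>mps n\<^esub> mps_var k \<otimes>\<^bsub>mps n\<^esub> h"
      by (rule ext) (simp add: add_mps mps_var_mult g_def h_def)
    ultimately show ?case using I.a_closed by metis
  qed
  moreover have "\<exists>i<n. i \<in># a" if "f a \<noteq> 0" for a
    using that f unfolding carrier_mps by (metis lessThan_iff multiset_nonemptyE subsetD)
  ultimately show ?thesis using f(1) by blast
qed

text \<open>A monomial of degree one, and hence nothing but \<open>y i\<close>, survives when a variable is
  substituted.\<close>

lemma mps_subst_var:
  fixes y :: "nat \<Rightarrow> nat multiset \<Rightarrow> 'k::comm_ring_1"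
  assumes y: "\<And>i. i < m \<Longrightarrow> y i \<in> carrier (mps n)" and i: "i < m" and "y i {#} = 0"
  shows "mps_subst m n y (mps_var i) = y i"
proof
  fix a :: "nat multiset"
  let ?B = "{b :: nat multiset. set_mset b \<subseteq> {..<m} \<and> size b \<le> size a}"
  let ?p = "\<lambda>b. finprod (mps n) (\<lambda>i. y i [^]\<^bsub>mps n\<^esub> count b i) {..<m}"
  have "finite ?B"
  proof -
    have "?B \<subseteq> mset ` {xs. set xs \<subseteq> {..<m} \<and> length xs \<le> size a}"
    proof
      fix b assume "b \<in> ?B"
      then show "b \<in> mset ` {xs. set xs \<subseteq> {..<m} \<and> length xs \<le> size a}"
        by (intro image_eqI[of _ _ "sorted_list_of_multiset b"]) (auto simp flip: size_mset)
    qed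
    then show ?thesis using finite_lists_length_le[of "{..<m}" "size a"] by (auto dest: finite_subset)
  qed
  then have sum: "mps_subst m n y (mps_var i) a = (\<Sum>b\<in>?B \<inter> {{#i#}}. mps_var i b * ?p b a)"
    unfolding mps_subst_def by (intro sum.mono_neutral_right) (auto simp: mps_var_def)
  show "mps_subst m n y (mps_var i) a = y i a"
  proof (cases "a = {#}")
    case True
    then have "?B \<inter> {{#i#}} = {}" by auto
    then show ?thesis using sum True assms(3) by simp
  next
    case False
    then have "1 \<le> size a" by (simp add: Suc_leI nonempty_has_size)
    then have "?B \<inter> {{#i#}} = {{#i#}}" using i by auto
    then have "mps_subst m n y (mps_var i) a = ?p {#i#} a" using sum by (simp add: mps_var_def)
    also have "?p {#i#} = finprod (mps n) (\<lambda>j. if j = i then y j else \<one>\<^bsub>mps n\<^esub>) {..<m}"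
      using y by (intro mps.finprod_cong) (auto simp: simp_implies_def)
    also have "\<dots> = y i" using y i by (intro mps.finprod_singleton_swap) auto
    finally show ?thesis .
  qed
qed

section \<open>Homomorphisms to power series in one variable\<close>

text \<open>Division with remainder by \<open>s\<close>, where the remainder is the constant term, is repeated \<open>e\<close>
  times.\<close>

lemma fps_expand_uniformizer:
  fixes s :: "'k::field fps"
  assumes s: "subdegree s = 1"
  shows "\<exists>c q. g = (\<Sum>i<e. fps_const (c i) * s ^ i) + s ^ e * q"
proof (induction e)
  case 0
  show ?case by auto
next
  case (Suc e)
  then obtain c q where g: "g = (\<Sum>i<e. fps_const (c i) * s ^ i) + s ^ e * q" by blast
  have "s \<noteq> 0" using s by auto
  have "s dvd q - fps_const (fps_nth q 0)"
  proof (cases "q - fps_const (fps_nth q 0) = 0")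
    case False
    then have "subdegree (q - fps_const (fps_nth q 0)) \<noteq> 0"
      using nth_subdegree_nonzero[OF False] by (intro notI) simp
    then show ?thesis using False \<open>s \<noteq> 0\<close> s by (simp add: fps_dvd_iff)
  qed (simp only: dvd_0_right)
  then obtain q' where "q - fps_const (fps_nth q 0) = s * q'" by (rule dvdE)
  then have q: "q = fps_const (fps_nth q 0) + s * q'" by (simp add: algebra_simps)
  have "g = (\<Sum>i<Suc e. fps_const ((c(e := fps_nth q 0)) i) * s ^ i) + s ^ Suc e * q'"
    by (subst g, subst q) (simp add: algebra_simps)
  then show ?case by blast
qed

context
  fixes n :: nat and \<eta> :: "(nat multiset \<Rightarrow> 'k::field) \<Rightarrow> 'k fps"
  assumes \<eta>: "\<eta> \<in> kalg_hom (mps n) mps_const ring_of_type_algebra fps_const"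
begin

lemma kalg_hom_simps:
  "\<lbrakk>f \<in> carrier (mps n); g \<in> carrier (mps n)\<rbrakk> \<Longrightarrow> \<eta> (f \<otimes>\<^bsub>mps n\<^esub> g) = \<eta> f * \<eta> g"
  "\<lbrakk>f \<in> carrier (mps n); g \<in> carrier (mps n)\<rbrakk> \<Longrightarrow> \<eta> (f \<oplus>\<^bsub>mps n\<^esub> g) = \<eta> f + \<eta> g"
  "\<eta> (mps_const c) = fps_const c" "\<eta> \<one>\<^bsub>mps n\<^esub> = 1" "\<eta> \<zero>\<^bsub>mps n\<^esub> = 0"
proof -
  have h: "\<eta> \<in> ring_hom (mps n) ring_of_type_algebra" and c: "\<eta> (mps_const c) = fps_const c" for c
    using \<eta> by (auto simp: kalg_hom_def)
  show "\<lbrakk>f \<in> carrier (mps n); g \<in> carrier (mps n)\<rbrakk> \<Longrightarrow> \<eta> (f \<otimes>\<^bsub>mps n\<^esub> g) = \<eta> f * \<eta> g"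
    "\<lbrakk>f \<in> carrier (mps n); g \<in> carrier (mps n)\<rbrakk> \<Longrightarrow> \<eta> (f \<oplus>\<^bsub>mps n\<^esub> g) = \<eta> f + \<eta> g"
    using ring_hom_mult[OF h] ring_hom_add[OF h] by auto
  show "\<eta> (mps_const c) = fps_const c" "\<eta> \<one>\<^bsub>mps n\<^esub> = 1" using c ring_hom_one[OF h] by auto
  have "\<zero>\<^bsub>mps n\<^esub> = mps_const (0::'k)" by (simp add: zero_mps mps_const_def)
  then show "\<eta> \<zero>\<^bsub>mps n\<^esub> = 0" using c[of 0] by simp
qed

lemma kalg_hom_pow: "f \<in> carrier (mps n) \<Longrightarrow> \<eta> (f [^]\<^bsub>mps n\<^esub> (l::nat)) = \<eta> f ^ l"
  by (induction l) (simp_all add: kalg_hom_simps mult.commute)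

lemma kalg_hom_unit:
  assumes "f \<in> carrier (mps n)" "f {#} \<noteq> 0"
  shows "fps_nth (\<eta> f) 0 \<noteq> 0"
proof -
  obtain g where "g \<in> carrier (mps n)" "f \<otimes>\<^bsub>mps n\<^esub> g = \<one>\<^bsub>mps n\<^esub>"
    using mps_unit assms by blast
  then have "\<eta> f * \<eta> g = 1" using kalg_hom_simps(1)[of f g] kalg_hom_simps(4) assms by simp
  then have "fps_nth (\<eta> f) 0 * fps_nth (\<eta> g) 0 = 1" by (metis fps_mult_nth_0 fps_one_nth)
  then show ?thesis by auto
qed

text \<open>If the constant term of the image were a constant \<open>c \<noteq> 0\<close>, then \<open>f\<close> minus \<open>c\<close> would be a unit whose
  image is not a unit.\<close>

lemma kalg_hom_local:
  assumes f: "f \<in> carrier (mps n)" "f {#} = 0"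
  shows "fps_nth (\<eta> f) 0 = 0"
proof (rule ccontr)
  define c where "c = fps_nth (\<eta> f) 0"
  define g where "g = f \<oplus>\<^bsub>mps n\<^esub> mps_const (- c)"
  assume "fps_nth (\<eta> f) 0 \<noteq> 0"
  then have "g {#} \<noteq> 0" using f by (simp add: g_def c_def add_mps mps_const_def)
  moreover have "g \<in> carrier (mps n)" using f by (simp add: g_def)
  ultimately have "fps_nth (\<eta> g) 0 \<noteq> 0" by (rule kalg_hom_unit[rotated])
  moreover have "\<eta> g = \<eta> f + fps_const (- c)" using f by (simp add: g_def kalg_hom_simps)
  ultimately show False by (simp add: c_def)
qed

text \<open>As a module over the image of \<open>\<eta>\<close>, the ring \<open>k[[t]]\<close> is generated by the first \<open>e\<close> powers of a
  uniformizer, where \<open>e\<close> is the order of an element \<open>F\<close> of the image: dividing repeatedly by \<open>F\<close>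
  one obtains coefficients that are power series in \<open>F\<close>.\<close>

lemma powers_of_uniformizer_generate:
  assumes F: "F \<in> carrier (mps n)" "F {#} = 0" "\<eta> F \<noteq> 0" and s: "subdegree s = 1"
  shows "\<exists>C. (\<forall>i. C i \<in> carrier (mps n)) \<and> g = (\<Sum>i<subdegree (\<eta> F). \<eta> (C i) * s ^ i)"
proof -
  define e where "e = subdegree (\<eta> F)"
  have s0: "s \<noteq> 0" using s by auto
  have e: "0 < e"
    using kalg_hom_local[OF F(1,2)] F(3) unfolding e_def by (metis gr0I nth_subdegree_nonzero)
  have "\<eta> F dvd s ^ e"
    using F(3) s0 s by (simp add: fps_dvd_iff e_def)
  then obtain w where w: "s ^ e = \<eta> F * w" by (rule dvdE)
  have "\<exists>c q. g = (\<Sum>i<e. fps_const (c i) * s ^ i) + \<eta> F * q" for g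
    using fps_expand_uniformizer[OF s, of g e] unfolding w by (metis mult.assoc)
  then obtain c q where cq: "\<And>g. g = (\<Sum>i<e. fps_const (c g i) * s ^ i) + \<eta> F * q g"
    by metis
  define G where "G l = (q ^^ l) g" for l
  have G_Suc: "G (Suc l) = q (G l)" for l by (simp add: G_def)
  define C where "C l i = mps_compose n F (\<lambda>j. c (G (l + j)) i)" for l i
  have C_closed: "C l i \<in> carrier (mps n)" for l i
    unfolding C_def by (rule mps_compose_closed[OF F(1)])
  have "C l i = mps_const (c (G l) i) \<oplus>\<^bsub>mps n\<^esub> F \<otimes>\<^bsub>mps n\<^esub> C (Suc l) i" for l i
    unfolding C_def by (subst mps_compose_rec[OF F(1,2)]) simp
  then have C_rec: "\<eta> (C l i) = fps_const (c (G l) i) + \<eta> F * \<eta> (C (Suc l) i)" for l i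
    using C_closed F(1) kalg_hom_simps mps.m_closed mps_const_closed by metis
  define D where "D l = G l - (\<Sum>i<e. \<eta> (C l i) * s ^ i)" for l
  have D_rec: "D l = \<eta> F * D (Suc l)" for l
  proof -
    have "(\<Sum>i<e. \<eta> (C l i) * s ^ i) =
        (\<Sum>i<e. fps_const (c (G l) i) * s ^ i) + \<eta> F * (\<Sum>i<e. \<eta> (C (Suc l) i) * s ^ i)"
      by (subst C_rec) (simp add: sum.distrib sum_distrib_left algebra_simps)
    then show ?thesis unfolding D_def using cq[of "G l"] G_Suc[of l] by (simp add: algebra_simps)
  qed
  have D: "D 0 = \<eta> F ^ l * D l" for l
    by (induction l) (simp, metis D_rec mult.assoc power_Suc2)
  have "D 0 = 0"
  proof (rule ccontr)
    assume nz: "D 0 \<noteq> 0"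
    define l where "l = Suc (subdegree (D 0))"
    have "D l \<noteq> 0" using nz D[of l] by auto
    then have "subdegree (D 0) = l * e + subdegree (D l)"
      using F(3) by (subst D[of l]) (simp add: e_def)
    moreover have "l \<le> l * e" using e by simp
    ultimately show False unfolding l_def by linarith
  qed
  then have "g = (\<Sum>i<e. \<eta> (C 0 i) * s ^ i)" unfolding D_def G_def by simp
  then show ?thesis unfolding e_def using C_closed by blast
qed

end

section \<open>Regular cones\<close>

definition int_pairing :: "nat \<Rightarrow> (nat \<Rightarrow> int) \<Rightarrow> (nat \<Rightarrow> int) \<Rightarrow> int" where
  "int_pairing m u v = (\<Sum>i<m. u i * v i)"

lemma int_pairing_linear:
  "int_pairing m (u + u') v = int_pairing m u v + int_pairing m u' v" "int_pairing m (\<lambda>i. a * u i) v = a * int_pairing m u v"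
  "int_pairing m (u - u') v = int_pairing m u v - int_pairing m u' v" "int_pairing m 0 v = 0" "int_pairing m (- u) v = - int_pairing m u v"
  "int_pairing m u (\<lambda>i. \<Sum>b\<in>B. c b * b i) = (\<Sum>b\<in>B. c b * int_pairing m u b)"
proof -
  show "int_pairing m u (\<lambda>i. \<Sum>b\<in>B. c b * b i) = (\<Sum>b\<in>B. c b * int_pairing m u b)"
    unfolding int_pairing_def sum_distrib_left by (subst sum.swap) (simp add: algebra_simps)
qed (auto simp: int_pairing_def algebra_simps sum.distrib sum_distrib_left sum_subtractf sum_negf)

lemma pairing_real_vec: "pairing m (real_vec u) (real_vec v) = real_of_int (int_pairing m u v)"
  by (simp add: pairing_def real_vec_def int_pairing_def)

lemma pairing_cone:
  "pairing m u (\<lambda>i. \<Sum>g\<in>G. c g * real_of_int (g i)) = (\<Sum>g\<in>G. c g * pairing m u (real_vec g))"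
  unfolding pairing_def real_vec_def sum_distrib_left
  by (subst sum.swap) (simp add: algebra_simps)

lemma lattice_vectors_closed:
  "0 \<in> lattice_vectors m"
  "u \<in> lattice_vectors m \<Longrightarrow> v \<in> lattice_vectors m \<Longrightarrow> u + v \<in> lattice_vectors m"
  "u \<in> lattice_vectors m \<Longrightarrow> v \<in> lattice_vectors m \<Longrightarrow> u - v \<in> lattice_vectors m"
  "u \<in> lattice_vectors m \<Longrightarrow> - u \<in> lattice_vectors m"
  "u \<in> lattice_vectors m \<Longrightarrow> (\<lambda>i. a * u i) \<in> lattice_vectors m"
  by (auto simp: lattice_vectors_def)

lemma int_pairing_unit_vec: "i < m \<Longrightarrow> int_pairing m (unit_vec i) v = v i"
  by (simp add: int_pairing_def unit_vec_def if_distrib[of "\<lambda>x. x * _"] cong: if_cong)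

lemma unit_vec_lattice: "i < m \<Longrightarrow> unit_vec i \<in> lattice_vectors m"
  by (auto simp: lattice_vectors_def unit_vec_def)

lemma lattice_vector_unit_sum:
  "w \<in> lattice_vectors m \<Longrightarrow> w = (\<lambda>j. \<Sum>i<m. w i * unit_vec i j)"
  by (rule ext) (auto simp: lattice_vectors_def unit_vec_def if_distrib cong: if_cong)

text \<open>The dual basis: \<open>D b\<close> reads off the coefficient at \<open>b\<close>, by uniqueness of coefficients.\<close>

lemma lattice_basis_dual:
  assumes "lattice_basis m B"
  obtains D where "\<And>b. D b \<in> lattice_vectors m"
    and "\<And>b b'. b \<in> B \<Longrightarrow> b' \<in> B \<Longrightarrow> int_pairing m (D b) b' = (if b' = b then 1 else 0)"
    and "\<And>w. w \<in> lattice_vectors m \<Longrightarrow> w = (\<lambda>i. \<Sum>b\<in>B. int_pairing m (D b) w * b i)"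
proof -
  have fin: "finite B" and B: "B \<subseteq> lattice_vectors m" and
    ex1: "\<And>w. w \<in> lattice_vectors m \<Longrightarrow> \<exists>!c::(nat \<Rightarrow> int) \<Rightarrow> int.
        (\<forall>v. v \<notin> B \<longrightarrow> c v = 0) \<and> w = (\<lambda>i. \<Sum>v\<in>B. c v * v i)"
    using assms unfolding lattice_basis_def by auto
  have "\<forall>i. \<exists>c::(nat \<Rightarrow> int) \<Rightarrow> int. i < m \<longrightarrow>
      (\<forall>v. v \<notin> B \<longrightarrow> c v = 0) \<and> unit_vec i = (\<lambda>j. \<Sum>v\<in>B. c v * v j)"
    using ex1[OF unit_vec_lattice] by blast
  from choice[OF this] obtain co where co': "\<And>i. i < m \<Longrightarrow>
      (\<forall>v. v \<notin> B \<longrightarrow> co i v = (0::int)) \<and> unit_vec i = (\<lambda>j. \<Sum>v\<in>B. co i v * v j)"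
    by blast
  then have co0: "\<And>i v. i < m \<Longrightarrow> v \<notin> B \<Longrightarrow> co i v = 0"
    and co: "\<And>i. i < m \<Longrightarrow> unit_vec i = (\<lambda>j. \<Sum>v\<in>B. co i v * v j)"
    by auto
  define D where "D b = (\<lambda>i. if i < m then co i b else 0)" for b
  have int_pairing: "int_pairing m (D b) w = (\<Sum>i<m. w i * co i b)" for b w
    by (simp add: int_pairing_def D_def mult.commute)
  have D_sum: "w = (\<lambda>i. \<Sum>b\<in>B. int_pairing m (D b) w * b i)" if w: "w \<in> lattice_vectors m" for w
  proof -
    have "w = (\<lambda>j. \<Sum>i<m. w i * (\<Sum>b\<in>B. co i b * b j))"
    proof
      fix j
      have "w j = (\<Sum>i<m. w i * unit_vec i j)"
        by (rule fun_cong[OF lattice_vector_unit_sum[OF w]])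
      also have "\<dots> = (\<Sum>i<m. w i * (\<Sum>b\<in>B. co i b * b j))"
        by (intro sum.cong refl) (simp add: co)
      finally show "w j = (\<Sum>i<m. w i * (\<Sum>b\<in>B. co i b * b j))" .
    qed
    also have "\<dots> = (\<lambda>i. \<Sum>b\<in>B. int_pairing m (D b) w * b i)"
      unfolding int_pairing sum_distrib_left sum_distrib_right
      by (subst sum.swap) (simp add: algebra_simps)
    finally show ?thesis .
  qed
  have uniq: "\<exists>!x. Q x \<Longrightarrow> Q x \<Longrightarrow> Q y \<Longrightarrow> x = y" for Q and x y :: "(nat \<Rightarrow> int) \<Rightarrow> int"
    by blast
  have D_out: "int_pairing m (D b) w = 0" if "b \<notin> B" for b w
    unfolding int_pairing using co0 that by simp
  show ?thesis
  proof (rule that[of D])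
    show "D b \<in> lattice_vectors m" for b by (simp add: D_def lattice_vectors_def)
    show "w = (\<lambda>i. \<Sum>b\<in>B. int_pairing m (D b) w * b i)" if "w \<in> lattice_vectors m" for w by (rule D_sum[OF that])
    fix b b' assume b: "b \<in> B" "b' \<in> B"
    let ?\<delta> = "\<lambda>b. if b = b' then 1 else (0::int)"
    have "(\<lambda>b. int_pairing m (D b) b') = ?\<delta>"
    proof (rule uniq[OF ex1])
      show "b' \<in> lattice_vectors m" using b B by auto
      then show "(\<forall>v. v \<notin> B \<longrightarrow> int_pairing m (D v) b' = 0) \<and> b' = (\<lambda>i. \<Sum>v\<in>B. int_pairing m (D v) b' * v i)"
        using D_out D_sum by simp
      show "(\<forall>v. v \<notin> B \<longrightarrow> ?\<delta> v = 0) \<and> b' = (\<lambda>i. \<Sum>v\<in>B. ?\<delta> v * v i)"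
        using b fin by (auto simp: if_distrib[of "\<lambda>x. x * _"] cong: if_cong)
    qed
    then show "int_pairing m (D b) b' = (if b' = b then 1 else 0)" by (metis (mono_tags))
  qed
qed

text \<open>The dual basis \<open>D\<close> of a lattice basis containing the generators \<open>G\<close> of \<open>\<sigma>\<close> supplies the elements of
  the dual monoid that are needed. As \<open>\<sigma>\<close> lies in the orthant, that monoid contains the exponents of
  all monomials.\<close>

locale orthant_regular_cone =
  fixes m :: nat and \<sigma> :: "(nat \<Rightarrow> real) set" and B G :: "(nat \<Rightarrow> int) set"
    and D :: "(nat \<Rightarrow> int) \<Rightarrow> nat \<Rightarrow> int"
  assumes basis: "lattice_basis m B" and GB: "G \<subseteq> B" and \<sigma>: "\<sigma> = cone_spanned G"
    and orth: "\<sigma> \<subseteq> orthant m"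
    and D_lattice: "\<And>b. D b \<in> lattice_vectors m"
    and D_dual: "\<And>b b'. b \<in> B \<Longrightarrow> b' \<in> B \<Longrightarrow> int_pairing m (D b) b' = (if b' = b then 1 else 0)"
    and D_sum: "\<And>w. w \<in> lattice_vectors m \<Longrightarrow> w = (\<lambda>i. \<Sum>b\<in>B. int_pairing m (D b) w * b i)"
begin

lemma finite_B: "finite B" and finite_G: "finite G" and B_lattice: "b \<in> B \<Longrightarrow> b \<in> lattice_vectors m"
  using basis GB finite_subset unfolding lattice_basis_def by auto

lemma in_\<sigma>: "(\<forall>g\<in>G. 0 \<le> c g) \<Longrightarrow> (\<lambda>i. \<Sum>g\<in>G. c g * real_of_int (g i)) \<in> \<sigma>"
  unfolding \<sigma> cone_spanned_def by blast

lemma \<sigma>_cases: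
  assumes "x \<in> \<sigma>"
  obtains c where "\<And>g. g \<in> G \<Longrightarrow> 0 \<le> c g" "x = (\<lambda>i. \<Sum>g\<in>G. c g * real_of_int (g i))"
  using assms unfolding \<sigma> cone_spanned_def by blast

lemma generator_in_\<sigma>: "g \<in> G \<Longrightarrow> real_vec g \<in> \<sigma>"
proof -
  assume g: "g \<in> G"
  have "real_vec g = (\<lambda>i. \<Sum>h\<in>G. (if h = g then 1 else 0) * real_of_int (h i))"
    using g finite_G by (auto simp: real_vec_def if_distrib[of "\<lambda>x. x * _"] cong: if_cong)
  then show ?thesis using in_\<sigma>[of "\<lambda>h. if h = g then 1 else 0"] by simp
qed

lemma generator_nonneg: "g \<in> G \<Longrightarrow> 0 \<le> g i"
  using generator_in_\<sigma>[of g] orth unfolding orthant_def real_vec_def by auto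

lemma dual_monoid_iff:
  "u \<in> dual_monoid m \<sigma> \<longleftrightarrow> u \<in> lattice_vectors m \<and> (\<forall>g\<in>G. 0 \<le> int_pairing m u g)"
proof -
  have "(\<forall>v\<in>\<sigma>. 0 \<le> pairing m (real_vec u) v) \<longleftrightarrow> (\<forall>g\<in>G. 0 \<le> int_pairing m u g)"
  proof
    assume "\<forall>v\<in>\<sigma>. 0 \<le> pairing m (real_vec u) v"
    then have "0 \<le> pairing m (real_vec u) (real_vec g)" if "g \<in> G" for g
      using generator_in_\<sigma> that by blast
    then show "\<forall>g\<in>G. 0 \<le> int_pairing m u g" by (simp add: pairing_real_vec)
  next
    assume *: "\<forall>g\<in>G. 0 \<le> int_pairing m u g"
    show "\<forall>v\<in>\<sigma>. 0 \<le> pairing m (real_vec u) v"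
    proof
      fix v assume "v \<in> \<sigma>"
      then obtain c where "\<And>g. g \<in> G \<Longrightarrow> 0 \<le> c g" "v = (\<lambda>i. \<Sum>g\<in>G. c g * real_of_int (g i))"
        by (rule \<sigma>_cases) blast
      then show "0 \<le> pairing m (real_vec u) v"
        using * by (simp add: pairing_cone pairing_real_vec sum_nonneg)
    qed
  qed
  then show ?thesis unfolding dual_monoid_def by blast
qed

lemma dual_monoid_closed:
  "0 \<in> dual_monoid m \<sigma>"
  "u \<in> dual_monoid m \<sigma> \<Longrightarrow> v \<in> dual_monoid m \<sigma> \<Longrightarrow> u + v \<in> dual_monoid m \<sigma>"
  "u \<in> dual_monoid m \<sigma> \<Longrightarrow> 0 \<le> a \<Longrightarrow> (\<lambda>i. a * u i) \<in> dual_monoid m \<sigma>"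
  by (auto simp: dual_monoid_iff int_pairing_linear lattice_vectors_closed)

lemma dual_monoid_nonneg:
  assumes "u \<in> lattice_vectors m" "\<And>i. 0 \<le> u i"
  shows "u \<in> dual_monoid m \<sigma>"
  unfolding dual_monoid_iff int_pairing_def using assms generator_nonneg by (auto intro!: sum_nonneg)

lemma unit_vec_dual_monoid: "i < m \<Longrightarrow> unit_vec i \<in> dual_monoid m \<sigma>"
  using unit_vec_lattice by (rule dual_monoid_nonneg) (auto simp: unit_vec_def)

definition ones :: "nat \<Rightarrow> int" where "ones = (\<lambda>i. if i < m then 1 else 0)"

lemma ones_lattice: "ones \<in> lattice_vectors m"
  by (auto simp: ones_def lattice_vectors_def)

lemma ones_dual_monoid: "ones \<in> dual_monoid m \<sigma>"
  using ones_lattice by (rule dual_monoid_nonneg) (auto simp: ones_def)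

lemma int_pairing_ones: "g \<in> G \<Longrightarrow> 1 \<le> int_pairing m ones g"
proof -
  assume g: "g \<in> G"
  have "g \<noteq> 0"
  proof
    assume "g = 0"
    then have "int_pairing m (D g) g = 0" by (simp add: int_pairing_def)
    then show False using D_dual[of g g] GB g by auto
  qed
  then have "\<exists>i. g i \<noteq> 0" by (simp add: fun_eq_iff)
  then obtain i where "g i \<noteq> 0" by blast
  have "g \<in> lattice_vectors m" using B_lattice[of g] GB g by blast
  then have "i < m" using \<open>g i \<noteq> 0\<close> unfolding lattice_vectors_def using not_le by blast
  have "0 < g i" using \<open>g i \<noteq> 0\<close> generator_nonneg[OF g, of i] by simp
  have "g i \<le> (\<Sum>i<m. g i)" using generator_nonneg[OF g] \<open>i < m\<close> by (intro member_le_sum) auto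
  also have "\<dots> = int_pairing m ones g" unfolding int_pairing_def ones_def by simp
  finally show ?thesis using \<open>0 < g i\<close> by simp
qed

text \<open>A large multiple of \<open>w\<close> outweighs \<open>u\<close> on every generator on which \<open>w\<close> is positive.\<close>

lemma absorbing:
  assumes w: "w \<in> dual_monoid m \<sigma>" and u: "u \<in> lattice_vectors m"
    and pos: "\<And>g. g \<in> G \<Longrightarrow> int_pairing m w g = 0 \<Longrightarrow> 0 \<le> int_pairing m u g"
  shows "\<exists>N\<ge>0. \<forall>M\<ge>N. u + (\<lambda>i. M * w i) \<in> dual_monoid m \<sigma>"
proof -
  define N where "N = (\<Sum>g\<in>G. \<bar>int_pairing m u g\<bar>)"
  have "0 \<le> N" unfolding N_def by (simp add: sum_nonneg)
  moreover have "u + (\<lambda>i. M * w i) \<in> dual_monoid m \<sigma>" if M: "N \<le> M" for M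
    unfolding dual_monoid_iff
  proof (intro conjI ballI)
    show "u + (\<lambda>i. M * w i) \<in> lattice_vectors m"
      using u w lattice_vectors_closed(2,5) unfolding dual_monoid_iff by blast
    fix g assume g: "g \<in> G"
    have nn: "0 \<le> int_pairing m w g" using w g unfolding dual_monoid_iff by blast
    show "0 \<le> int_pairing m (u + (\<lambda>i. M * w i)) g"
    proof (cases "int_pairing m w g = 0")
      case True
      then show ?thesis using pos[OF g] by (simp add: int_pairing_linear)
    next
      case False
      have "\<bar>int_pairing m u g\<bar> \<le> N" unfolding N_def using g finite_G by (intro member_le_sum) auto
      then have "- int_pairing m u g \<le> M * 1" using M by simp
      also have "M * 1 \<le> M * int_pairing m w g"
        using False nn M \<open>0 \<le> N\<close> by (intro mult_left_mono) auto
      finally show ?thesis by (simp add: int_pairing_linear)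
    qed
  qed
  ultimately show ?thesis by blast
qed

lemma ones_absorbing:
  assumes "u \<in> lattice_vectors m"
  shows "\<exists>N\<ge>0. \<forall>M\<ge>N. u + (\<lambda>i. M * ones i) \<in> dual_monoid m \<sigma>"
  using absorbing[OF ones_dual_monoid assms] int_pairing_ones by force

text \<open>A sum of members of \<open>T\<close>, one for each generator on which \<open>T\<close> does not vanish identically, cuts out
  the face of the cone that belongs to \<open>T\<close>.\<close>

lemma monoid_face_orbit:
  assumes T0: "0 \<in> T" and T: "T \<subseteq> dual_monoid m \<sigma>"
    and face: "\<And>u v. u \<in> dual_monoid m \<sigma> \<Longrightarrow> v \<in> dual_monoid m \<sigma> \<Longrightarrow> u + v \<in> T \<longleftrightarrow> u \<in> T \<and> v \<in> T"
  shows "\<exists>\<tau>. is_face m \<tau> \<sigma> \<and> (\<forall>u\<in>dual_monoid m \<sigma>. u \<in> T \<longleftrightarrow> u \<in> perp m \<tau>)"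
proof -
  have ex: "\<exists>w\<in>T. \<forall>g\<in>H. \<forall>u\<in>T. int_pairing m w g = 0 \<longrightarrow> int_pairing m u g = 0" if "H \<subseteq> G" for H
    using finite_subset[OF that finite_G] that
  proof (induction H rule: finite_induct)
    case (insert g H)
    then obtain w where w: "w \<in> T" "\<forall>g\<in>H. \<forall>u\<in>T. int_pairing m w g = 0 \<longrightarrow> int_pairing m u g = 0" by auto
    show ?case
    proof (cases "\<exists>u\<in>T. int_pairing m u g \<noteq> 0")
      case True
      then obtain u where u: "u \<in> T" "int_pairing m u g \<noteq> 0" by blast
      have nn: "0 \<le> int_pairing m x h" if "x \<in> T" "h \<in> insert g H" for x h
        using that T insert.prems dual_monoid_iff by blast
      have "int_pairing m (w + u) h = 0 \<longrightarrow> int_pairing m x h = 0" if "x \<in> T" "h \<in> insert g H" for x h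
      proof
        assume "int_pairing m (w + u) h = 0"
        then have "int_pairing m w h = 0" "int_pairing m u h = 0"
          using nn[OF w(1) that(2)] nn[OF u(1) that(2)] unfolding int_pairing_linear by linarith+
        then show "int_pairing m x h = 0" using w(2) u(2) that by auto
      qed
      moreover have "w + u \<in> T" using face w(1) u(1) T by blast
      ultimately show ?thesis by blast
    next
      case False
      then show ?thesis using w by blast
    qed
  qed (use T0 in auto)
  obtain w where w: "w \<in> T" "\<And>g u. g \<in> G \<Longrightarrow> u \<in> T \<Longrightarrow> int_pairing m w g = 0 \<Longrightarrow> int_pairing m u g = 0"
    using ex[OF subset_refl] by blast
  define \<tau> where "\<tau> = {v\<in>\<sigma>. pairing m (real_vec w) v = 0}"
  have wS: "w \<in> dual_monoid m \<sigma>" using w(1) T by blast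
  then have "is_face m \<tau> \<sigma>" unfolding is_face_def \<tau>_def dual_monoid_def by blast
  moreover have "u \<in> T \<longleftrightarrow> u \<in> perp m \<tau>" if u: "u \<in> dual_monoid m \<sigma>" for u
  proof
    assume uT: "u \<in> T"
    have "pairing m (real_vec u) v = 0" if v: "v \<in> \<tau>" for v
    proof -
      have "v \<in> \<sigma>" using v by (simp add: \<tau>_def)
      then obtain c where c: "\<And>g. g \<in> G \<Longrightarrow> 0 \<le> c g" "v = (\<lambda>i. \<Sum>g\<in>G. c g * real_of_int (g i))"
        by (rule \<sigma>_cases) blast
      have "(\<Sum>g\<in>G. c g * real_of_int (int_pairing m w g)) = 0"
        using v unfolding \<tau>_def c(2) by (simp add: pairing_cone pairing_real_vec)
      then have "\<forall>g\<in>G. c g * real_of_int (int_pairing m w g) = 0"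
        using c(1) wS unfolding dual_monoid_iff
        by (subst (asm) sum_nonneg_eq_0_iff[OF finite_G]) auto
      then have "\<forall>g\<in>G. c g * real_of_int (int_pairing m u g) = 0" using w(2)[OF _ uT] by auto
      then show ?thesis unfolding c(2) pairing_cone pairing_real_vec by (rule sum.neutral)
    qed
    then show "u \<in> perp m \<tau>" using u unfolding perp_def dual_monoid_def by blast
  next
    assume p: "u \<in> perp m \<tau>"
    have "int_pairing m u g = 0" if g: "g \<in> G" "int_pairing m w g = 0" for g
    proof -
      have "real_vec g \<in> \<tau>" unfolding \<tau>_def using generator_in_\<sigma> g by (simp add: pairing_real_vec)
      then show ?thesis using p unfolding perp_def by (auto simp: pairing_real_vec)
    qed
    then obtain N where N: "0 \<le> N" "- u + (\<lambda>i. N * w i) \<in> dual_monoid m \<sigma>"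
      using absorbing[OF wS, of "- u"] u lattice_vectors_closed(4)
      unfolding dual_monoid_iff by (auto simp: int_pairing_linear)
    have pow: "(\<lambda>i. int l * w i) \<in> T" for l
    proof (induction l)
      case (Suc l)
      have "(\<lambda>i. int (Suc l) * w i) = (\<lambda>i. int l * w i) + w" by (auto simp: algebra_simps)
      then show ?case using Suc face w(1) T by (metis subsetD)
    qed (use T0 in \<open>simp add: zero_fun_def\<close>)
    have "u + (- u + (\<lambda>i. N * w i)) \<in> T" using pow[of "nat N"] N(1) by (simp add: add.assoc[symmetric])
    then show "u \<in> T" using face[OF u N(2)] by blast
  qed
  ultimately show ?thesis by blast
qed

text \<open>If the dual monoid were nonnegative on \<open>v\<close>, the dual basis would give nonnegative coefficients
  of \<open>v\<close> on the generators and zero coefficients elsewhere, which places \<open>v\<close> in \<open>\<sigma>\<close>. Given an element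
  of negative pairing, multiples of it and of \<open>ones\<close> move a vector of pairing one into the dual
  monoid.\<close>

lemma pairing_one_outside:
  assumes v: "v \<in> lattice_vectors m" and pos: "\<And>i. 0 \<le> v i" and v1: "u \<in> lattice_vectors m" "int_pairing m u v = 1"
    and out: "real_vec v \<notin> \<sigma>"
  shows "(\<exists>u\<in>dual_monoid m \<sigma>. int_pairing m u v = 1) \<and> (\<exists>u\<in>dual_monoid m \<sigma>. int_pairing m u v < 0)"
proof -
  have "\<exists>w\<in>dual_monoid m \<sigma>. int_pairing m w v < 0"
  proof (rule ccontr)
    assume "\<not> ?thesis"
    then have nn: "0 \<le> int_pairing m w v" if "w \<in> dual_monoid m \<sigma>" for w using that not_less by blast
    have G: "0 \<le> int_pairing m (D g) v" if "g \<in> G" for g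
      using nn[of "D g"] that GB D_lattice D_dual by (auto simp: dual_monoid_iff subset_iff)
    have notG: "int_pairing m (D b) v = 0" if "b \<in> B - G" for b
    proof -
      have "\<forall>g\<in>G. int_pairing m (D b) g = 0" using that GB D_dual by auto
      then have "D b \<in> dual_monoid m \<sigma>" "- D b \<in> dual_monoid m \<sigma>"
        using D_lattice lattice_vectors_closed(4) by (auto simp: dual_monoid_iff int_pairing_linear)
      then show ?thesis using nn[of "D b"] nn[of "- D b"] by (simp add: int_pairing_linear)
    qed
    have "v = (\<lambda>i. \<Sum>b\<in>B. int_pairing m (D b) v * b i)" by (rule D_sum[OF v])
    also have "\<dots> = (\<lambda>i. \<Sum>g\<in>G. int_pairing m (D g) v * g i)"
      using notG by (intro ext sum.mono_neutral_right[OF finite_B GB]) auto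
    finally have "v = (\<lambda>i. \<Sum>g\<in>G. int_pairing m (D g) v * g i)" .
    then have "v i = (\<Sum>g\<in>G. int_pairing m (D g) v * g i)" for i by (rule fun_cong)
    then have "real_vec v = (\<lambda>i. \<Sum>g\<in>G. real_of_int (int_pairing m (D g) v) * real_of_int (g i))"
      unfolding real_vec_def by (simp add: fun_eq_iff)
    then show False using out in_\<sigma>[of "\<lambda>g. real_of_int (int_pairing m (D g) v)"] G by simp
  qed
  then obtain w where w: "w \<in> dual_monoid m \<sigma>" "int_pairing m w v < 0" by blast
  define a where "a = - int_pairing m w v"
  define b where "b = int_pairing m ones v"
  have ab: "0 < a" "0 \<le> b" using w pos by (auto simp: a_def b_def int_pairing_def ones_def intro!: sum_nonneg)
  obtain N where N: "0 \<le> N" "\<forall>M\<ge>N. u + (\<lambda>i. M * ones i) \<in> dual_monoid m \<sigma>"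
    using ones_absorbing[OF v1(1)] by blast
  \<comment> \<open>The multiples of \<open>ones\<close> and of \<open>w\<close> are chosen so that their pairings with \<open>v\<close> cancel.\<close>
  let ?u = "u + (\<lambda>i. a * N * ones i) + (\<lambda>i. b * N * w i)"
  have "N \<le> a * N" using ab N(1) by (simp add: mult_le_cancel_right1)
  then have "u + (\<lambda>i. a * N * ones i) \<in> dual_monoid m \<sigma>" using N(2) by blast
  then have "?u \<in> dual_monoid m \<sigma>" 
    using w(1) ab N(1) dual_monoid_closed(3)[OF w(1), of "b * N"] dual_monoid_closed(2) by simp
  moreover have "int_pairing m ?u v = 1"
    unfolding int_pairing_linear v1 b_def[symmetric] using a_def by (simp add: algebra_simps)
  ultimately show ?thesis using w by blast
qed

text \<open>A generator with nonzero coefficient in \<open>v\<close> lies on the face spanned by \<open>v\<close>, hence is a multiple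
  of \<open>v\<close>. Both vectors being primitive, they agree.\<close>

lemma primitive_face_is_generator:
  assumes v: "v \<in> lattice_vectors m" and v1: "u \<in> lattice_vectors m" "int_pairing m u v = 1"
    and inside: "real_vec v \<in> \<sigma>" and face: "is_face m (cone_spanned {v}) \<sigma>"
  shows "v \<in> G"
proof -
  obtain c where c: "\<And>g. g \<in> G \<Longrightarrow> 0 \<le> c g"
    "real_vec v = (\<lambda>i. \<Sum>g\<in>G. c g * real_of_int (g i))"
    using inside by (rule \<sigma>_cases) blast
  have v_pair: "real_of_int (int_pairing m x v) = (\<Sum>g\<in>G. c g * real_of_int (int_pairing m x g))" for x
    unfolding pairing_real_vec[symmetric] c(2) by (rule pairing_cone)
  obtain w where w: "\<forall>x\<in>\<sigma>. 0 \<le> pairing m w x" "cone_spanned {v} = {x\<in>\<sigma>. pairing m w x = 0}"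
    using face unfolding is_face_def by blast
  have "real_vec v \<in> cone_spanned {v}"
    unfolding cone_spanned_def real_vec_def by (intro CollectI exI[of _ "\<lambda>_. 1"]) simp
  then have "pairing m w (real_vec v) = 0" using w(2) by blast
  then have "(\<Sum>g\<in>G. c g * pairing m w (real_vec g)) = 0" unfolding c(2) pairing_cone .
  then have z: "\<forall>g\<in>G. c g * pairing m w (real_vec g) = 0"
    using c(1) w(1) generator_in_\<sigma> by (subst (asm) sum_nonneg_eq_0_iff[OF finite_G]) auto
  have "\<exists>g\<in>G. c g \<noteq> 0"
  proof (rule ccontr)
    assume "\<not> ?thesis"
    then have "real_of_int (int_pairing m u v) = 0" unfolding v_pair by simp
    then show False using v1 by simp
  qed
  then obtain g where g: "g \<in> G" "c g \<noteq> 0" by blast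
  then have "real_vec g \<in> cone_spanned {v}" using z w(2) generator_in_\<sigma> by auto
  then obtain l where "real_vec g = (\<lambda>i. l * real_of_int (v i))"
    unfolding cone_spanned_def by auto
  then have gl: "real_of_int (g i) = l * real_of_int (v i)" for i unfolding real_vec_def by (rule fun_cong)
  have g_pair: "real_of_int (int_pairing m x g) = l * real_of_int (int_pairing m x v)" for x
    unfolding int_pairing_def by (simp add: gl sum_distrib_left algebra_simps)
  have "int_pairing m (D g) g = 1" using D_dual[of g g] g GB by auto
  then have l1: "l * real_of_int (int_pairing m (D g) v) = 1" using g_pair[of "D g"] by simp
  have "real_of_int (int_pairing m u g) = l" using g_pair[of u] v1 by simp
  then have "int_pairing m u g * int_pairing m (D g) v = 1" using l1 by (metis of_int_1 of_int_eq_iff of_int_mult)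
  moreover have "0 \<le> int_pairing m (D g) v"
  proof -
    have "real_of_int (int_pairing m (D g) v) = c g"
      unfolding v_pair using g(1) GB finite_G D_dual
      by (subst sum.remove[OF finite_G g(1)]) (auto simp: subset_iff intro!: sum.neutral)
    then show ?thesis using c(1)[OF g(1)] by linarith
  qed
  ultimately have "int_pairing m u g = 1" by (metis dual_order.refl mult_cancel_right1 mult_zero_right pos_zmult_eq_1_iff_lemma zmult_eq_1_iff zero_neq_one not_one_le_zero neg_0_le_iff_le zero_le_one order_antisym)
  then have "l = 1" using \<open>real_of_int (int_pairing m u g) = l\<close> by simp
  then have "g = v" using gl by auto
  then show ?thesis using g by simp
qed

end

lemma regular_cone_dual_basis:
  assumes "regular_cone m \<sigma>" "\<sigma> \<subseteq> orthant m"
  shows "\<exists>B G D. orthant_regular_cone m \<sigma> B G D"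
proof -
  obtain B G where BG: "lattice_basis m B" "G \<subseteq> B" "\<sigma> = cone_spanned G"
    using assms(1) unfolding regular_cone_def by blast
  obtain D where "\<And>b. D b \<in> lattice_vectors m"
    "\<And>b b'. b \<in> B \<Longrightarrow> b' \<in> B \<Longrightarrow> int_pairing m (D b) b' = (if b' = b then 1 else 0)"
    "\<And>w. w \<in> lattice_vectors m \<Longrightarrow> w = (\<lambda>i. \<Sum>b\<in>B. int_pairing m (D b) w * b i)"
    using lattice_basis_dual[OF BG(1)] by blast
  then have "orthant_regular_cone m \<sigma> B G D"
    using BG assms(2) by unfold_locales auto
  then show ?thesis by blast
qed

section \<open>Charts of the toric modification\<close>

text \<open>The curve as the charts see it: \<open>h j\<close> is the map from its ring to the normalization \<open>k[[t]]\<close> of the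
  branch with prime ideal \<open>P j\<close>, and \<open>v j\<close> is the order vector of the coordinates \<open>z\<close>. The condition
  \<open>primes\<close> says that a prime ideal contains that of a branch, and that it equals the latter or is a point
  where all coordinates vanish. The condition \<open>generated\<close> holds because \<open>k[[t]]\<close> is a finite module over the ring of the
  branch.\<close>

locale parametrized_curve = cring R for R :: "'b ring" (structure) +
  fixes \<iota> :: "'k::alg_closed_field \<Rightarrow> 'b" and r m :: nat and P :: "nat \<Rightarrow> 'b set"
    and h :: "nat \<Rightarrow> 'b \<Rightarrow> 'k fps" and z :: "nat \<Rightarrow> 'b" and v :: "nat \<Rightarrow> nat \<Rightarrow> int"
  assumes \<iota>: "\<iota> \<in> ring_hom base_field R" and r: "1 \<le> r"
    and h: "\<And>j. j < r \<Longrightarrow> h j \<in> ring_hom R ring_of_type_algebra"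
    and h_const: "\<And>j c. j < r \<Longrightarrow> h j (\<iota> c) = fps_const c"
    and h_kernel: "\<And>j. j < r \<Longrightarrow> P j = {a \<in> carrier R. h j a = 0}"
    and prime: "\<And>j. j < r \<Longrightarrow> primeideal (P j) R"
    and incomparable: "\<And>i j. i < r \<Longrightarrow> j < r \<Longrightarrow> P i \<subseteq> P j \<Longrightarrow> i = j"
    and primes: "\<And>q. primeideal q R \<Longrightarrow> \<exists>j<r. P j \<subseteq> q \<and> (q = P j \<or> (\<forall>i<m. z i \<in> q))"
    and z: "\<And>i. i < m \<Longrightarrow> z i \<in> carrier R"
    and order_pos: "\<And>i j. j < r \<Longrightarrow> i < m \<Longrightarrow> 0 < subdegree (h j (z i))"
    and v: "\<And>j. j < r \<Longrightarrow> v j = (\<lambda>i. if i < m then int (subdegree (h j (z i))) else 0)"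
    and primitive: "\<And>j. j < r \<Longrightarrow> \<exists>u\<in>lattice_vectors m. int_pairing m u (v j) = 1"
    and distinct: "\<And>i j. i < r \<Longrightarrow> j < r \<Longrightarrow> v i = v j \<Longrightarrow> i = j"
    and generated: "\<And>j s g. j < r \<Longrightarrow> subdegree s = 1 \<Longrightarrow>
      \<exists>(e::nat) c. (\<forall>i. c i \<in> carrier R) \<and> g = (\<Sum>i<e. h j (c i) * s ^ i)"

locale subdivided_curve = parametrized_curve R \<iota> r m P h z v
  for R :: "'b ring" (structure) and \<iota> :: "'k::alg_closed_field \<Rightarrow> 'b" and r m P h z v +
  fixes \<Sigma> :: "(nat \<Rightarrow> real) set set"
  assumes subdivision: "regular_subdivision m \<Sigma>"
    and rays: "\<And>j. j < r \<Longrightarrow> cone_spanned {v j} \<in> \<Sigma>"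

locale curve_chart = subdivided_curve R \<iota> r m P h z v \<Sigma> + orthant_regular_cone m \<sigma> B G D
  for R :: "'b ring" (structure) and \<iota> :: "'k::alg_closed_field \<Rightarrow> 'b" and r m P h z v \<Sigma> \<sigma> B G D +
  assumes \<sigma>_in: "\<sigma> \<in> \<Sigma>"
begin

sublocale submonoid_algebra R "dual_monoid m \<sigma>"
  by unfold_locales (auto intro: dual_monoid_closed)

lemma h_nz: "j < r \<Longrightarrow> i < m \<Longrightarrow> h j (z i) \<noteq> 0"
  using order_pos by fastforce

lemma h_simps:
  "j < r \<Longrightarrow> a \<in> carrier R \<Longrightarrow> b \<in> carrier R \<Longrightarrow> h j (a \<otimes> b) = h j a * h j b"
  "j < r \<Longrightarrow> a \<in> carrier R \<Longrightarrow> b \<in> carrier R \<Longrightarrow> h j (a \<oplus> b) = h j a + h j b"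
  "j < r \<Longrightarrow> h j \<one> = 1"
  using ring_hom_mult[OF h] ring_hom_add[OF h] ring_hom_one[OF h] by auto

lemma h_zero: "j < r \<Longrightarrow> h j \<zero> = 0"
proof -
  assume j: "j < r"
  have "h j (\<zero> \<oplus> \<zero>) = h j \<zero> + h j \<zero>" by (rule h_simps(2)[OF j zero_closed zero_closed])
  then show ?thesis by (simp only: l_zero zero_closed add_cancel_right_right)
qed

text \<open>The restriction of the character with exponent \<open>u\<close> to the branch \<open>j\<close>. Its order is the pairing of
  \<open>u\<close> with the order vector of the branch.\<close>

definition Z :: "nat \<Rightarrow> (nat \<Rightarrow> int) \<Rightarrow> 'k fls" where
  "Z j u = (\<Prod>i<m. fps_to_fls (h j (z i)) powi u i)"

lemma Z_0: "Z j 0 = 1"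
  by (simp add: Z_def)

lemma Z_add: "j < r \<Longrightarrow> Z j (u + u') = Z j u * Z j u'"
  unfolding Z_def prod.distrib[symmetric]
  by (intro prod.cong refl) (simp add: power_int_add h_nz)

lemma Z_nz: "j < r \<Longrightarrow> Z j u \<noteq> 0"
  unfolding Z_def by (simp add: h_nz)

lemma subdegree_Z: "j < r \<Longrightarrow> fls_subdegree (Z j u) = int_pairing m u (v j)"
proof -
  assume j: "j < r"
  have "fls_subdegree (\<Prod>i\<in>I. fps_to_fls (h j (z i)) powi u i) = (\<Sum>i\<in>I. u i * v j i)"
    if "finite I" "I \<subseteq> {..<m}" for I
    using that
  proof (induction I rule: finite_induct)
    case (insert l I)
    have "(\<Prod>i\<in>I. fps_to_fls (h j (z i)) powi u i) \<noteq> 0"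
      using insert.prems insert.hyps j h_nz by (auto simp: subset_iff)
    then show ?case
      using insert j h_nz[of j l] by (simp add: v[OF j] fls_subdegree_fls_to_fps)
  qed simp
  then show ?thesis unfolding Z_def int_pairing_def by blast
qed

lemma Z_unit_vec: "i < m \<Longrightarrow> Z j (unit_vec i) = fps_to_fls (h j (z i))"
proof -
  assume i: "i < m"
  have "Z j (unit_vec i) = (\<Prod>l<m. if l = i then fps_to_fls (h j (z l)) else 1)"
    unfolding Z_def unit_vec_def by (intro prod.cong) auto
  then show ?thesis using i by simp
qed

text \<open>The map of rings that belongs to the lift of the parametrized branch \<open>j\<close>, with its closed point
  removed, to this chart.\<close>

definition H :: "nat \<Rightarrow> ((nat \<Rightarrow> int) \<Rightarrow> 'b) \<Rightarrow> 'k fls" where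
  "H j = evaluation (\<lambda>a. fps_to_fls (h j a)) (Z j)"

lemma coefficients_hom: "j < r \<Longrightarrow> (\<lambda>a. fps_to_fls (h j a)) \<in> ring_hom R ring_of_type_algebra"
  by (rule ring_hom_memI) (auto simp: h_simps fls_times_fps_to_fls)

lemma H_hom: "j < r \<Longrightarrow> H j \<in> ring_hom A ring_of_type_algebra"
  unfolding H_def by (rule evaluation_hom[OF coefficients_hom]) (auto simp: Z_0 Z_add)

lemma H_character: "j < r \<Longrightarrow> H j (character R c u) = fps_to_fls (h j c) * Z j u"
  unfolding H_def by (rule evaluation_character[OF coefficients_hom]) (auto simp: Z_0 Z_add)

lemma H_const: "j < r \<Longrightarrow> H j (alg_const R c) = fps_to_fls (h j c)"
  by (simp add: alg_const_character H_character Z_0)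

lemma H_char: "j < r \<Longrightarrow> H j (character R \<one> u) = Z j u"
  by (simp add: H_character h_simps)

lemma H_simps:
  "j < r \<Longrightarrow> f \<in> carrier A \<Longrightarrow> g \<in> carrier A \<Longrightarrow> H j (f \<otimes>\<^bsub>A\<^esub> g) = H j f * H j g"
  "j < r \<Longrightarrow> f \<in> carrier A \<Longrightarrow> g \<in> carrier A \<Longrightarrow> H j (f \<oplus>\<^bsub>A\<^esub> g) = H j f + H j g"
  "j < r \<Longrightarrow> H j \<one>\<^bsub>A\<^esub> = 1" "j < r \<Longrightarrow> H j \<zero>\<^bsub>A\<^esub> = 0"
proof -
  show "j < r \<Longrightarrow> f \<in> carrier A \<Longrightarrow> g \<in> carrier A \<Longrightarrow> H j (f \<otimes>\<^bsub>A\<^esub> g) = H j f * H j g"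
    "j < r \<Longrightarrow> f \<in> carrier A \<Longrightarrow> g \<in> carrier A \<Longrightarrow> H j (f \<oplus>\<^bsub>A\<^esub> g) = H j f + H j g"
    "j < r \<Longrightarrow> H j \<one>\<^bsub>A\<^esub> = 1"
    using ring_hom_mult[OF H_hom] ring_hom_add[OF H_hom] ring_hom_one[OF H_hom] by auto
  show "H j \<zero>\<^bsub>A\<^esub> = 0" if "j < r"
  proof -
    have "H j (\<zero>\<^bsub>A\<^esub> \<oplus>\<^bsub>A\<^esub> \<zero>\<^bsub>A\<^esub>) = H j \<zero>\<^bsub>A\<^esub> + H j \<zero>\<^bsub>A\<^esub>"
      using ring_hom_add[OF H_hom[OF that] A.zero_closed A.zero_closed]
      by (simp only: ring_of_type_algebra_simps)
    then show ?thesis by (simp only: A.l_zero A.zero_closed add_cancel_right_right)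
  qed
qed

lemma H_minus:
  assumes "j < r" "f \<in> carrier A" "g \<in> carrier A"
  shows "H j (f \<ominus>\<^bsub>A\<^esub> g) = H j f - H j g"
proof -
  have "H j (f \<ominus>\<^bsub>A\<^esub> g) + H j g = H j (f \<ominus>\<^bsub>A\<^esub> g \<oplus>\<^bsub>A\<^esub> g)" using assms by (simp add: H_simps)
  also have "f \<ominus>\<^bsub>A\<^esub> g \<oplus>\<^bsub>A\<^esub> g = f" using assms(2,3) by algebra
  finally show ?thesis by (simp add: algebra_simps)
qed

lemma H_pow: "j < r \<Longrightarrow> f \<in> carrier A \<Longrightarrow> H j (f [^]\<^bsub>A\<^esub> (n::nat)) = H j f ^ n"
  by (induction n) (simp_all add: H_simps mult.commute)

text \<open>The ideal of the closure of the lifted branch \<open>j\<close>.\<close>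

definition K :: "nat \<Rightarrow> ((nat \<Rightarrow> int) \<Rightarrow> 'b) set" where
  "K j = {f \<in> carrier A. H j f = 0}"

lemma prime_K: "j < r \<Longrightarrow> primeideal (K j) A"
proof -
  assume j: "j < r"
  show ?thesis
  proof (rule primeidealI[OF idealI])
    show "ring A" "cring A" by unfold_locales
    show "subgroup (K j) (add_monoid A)"
    proof (rule A.add.subgroupI)
      have "\<zero>\<^bsub>A\<^esub> \<in> K j" using H_simps(4)[OF j] by (simp add: K_def)
      then show "K j \<subseteq> carrier A" "K j \<noteq> {}" by (auto simp: K_def)
      show "\<ominus>\<^bsub>A\<^esub> f \<in> K j" if "f \<in> K j" for f
        using that H_minus[OF j A.zero_closed, of f] H_simps(4)[OF j] by (simp add: K_def A.minus_eq)
      show "f \<oplus>\<^bsub>A\<^esub> g \<in> K j" if "f \<in> K j" "g \<in> K j" for f g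
        using that j by (auto simp: K_def H_simps)
    qed
    have "\<one>\<^bsub>A\<^esub> \<notin> K j" using H_simps(3)[OF j] by (simp add: K_def)
    then show "carrier A \<noteq> K j" using A.one_closed by blast
    show "f \<in> K j \<or> g \<in> K j" if "f \<in> carrier A" "g \<in> carrier A" "f \<otimes>\<^bsub>A\<^esub> g \<in> K j" for f g
      using that H_simps(1)[OF j that(1,2)] by (simp add: K_def)
  next
    fix f g assume "f \<in> K j" "g \<in> carrier A"
    then show "g \<otimes>\<^bsub>A\<^esub> f \<in> K j" "f \<otimes>\<^bsub>A\<^esub> g \<in> K j"
      using j by (simp_all add: K_def H_simps)
  qed
qed

abbreviation I0 where "I0 \<equiv> preimage_ideal m R z \<sigma>"

lemma unit_char_closed: "i < m \<Longrightarrow> character R \<one> (unit_vec i) \<in> carrier A"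
  by (simp add: unit_vec_dual_monoid)

lemma I0_generators:
  "{character R \<one> (unit_vec i) \<ominus>\<^bsub>A\<^esub> alg_const R (z i) | i. i < m} \<subseteq> carrier A"
  using unit_char_closed z by auto

lemma ideal_I0: "ideal I0 A"
  unfolding preimage_ideal_def by (rule A.genideal_ideal[OF I0_generators])

lemma I0_in_K: "j < r \<Longrightarrow> I0 \<subseteq> K j"
proof -
  assume j: "j < r"
  have "ideal (K j) A" using prime_K[OF j] by (simp add: primeideal_def)
  moreover have "{character R \<one> (unit_vec i) \<ominus>\<^bsub>A\<^esub> alg_const R (z i) | i. i < m} \<subseteq> K j"
    using I0_generators j unit_char_closed z
    by (auto simp: K_def H_minus H_char H_const Z_unit_vec)
  ultimately show ?thesis unfolding preimage_ideal_def by (rule A.genideal_minimal)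
qed

text \<open>The elements of the chart ring that agree on the preimage of the curve with a function on the
  curve.\<close>

definition W :: "((nat \<Rightarrow> int) \<Rightarrow> 'b) set" where
  "W = {f \<in> carrier A. \<exists>a\<in>carrier R. f \<ominus>\<^bsub>A\<^esub> alg_const R a \<in> I0}"

lemma W_add: "f \<in> W \<Longrightarrow> g \<in> W \<Longrightarrow> f \<oplus>\<^bsub>A\<^esub> g \<in> W"
  and W_mult: "f \<in> W \<Longrightarrow> g \<in> W \<Longrightarrow> f \<otimes>\<^bsub>A\<^esub> g \<in> W"
proof -
  interpret I0: ideal I0 A by (rule ideal_I0)
  assume "f \<in> W" "g \<in> W"
  then obtain a b where f: "f \<in> carrier A" "a \<in> carrier R" "f \<ominus>\<^bsub>A\<^esub> alg_const R a \<in> I0"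
    and g: "g \<in> carrier A" "b \<in> carrier R" "g \<ominus>\<^bsub>A\<^esub> alg_const R b \<in> I0"
    unfolding W_def by auto
  let ?a = "alg_const R a" and ?b = "alg_const R b"
  have ab: "?a \<in> carrier A" "?b \<in> carrier A" using f g by auto
  have "alg_const R (a \<oplus> b) = ?a \<oplus>\<^bsub>A\<^esub> ?b" using ring_hom_add[OF alg_const_hom] f g by simp
  moreover have "(f \<oplus>\<^bsub>A\<^esub> g) \<ominus>\<^bsub>A\<^esub> (?a \<oplus>\<^bsub>A\<^esub> ?b) = (f \<ominus>\<^bsub>A\<^esub> ?a) \<oplus>\<^bsub>A\<^esub> (g \<ominus>\<^bsub>A\<^esub> ?b)"
    using f(1) g(1) ab by algebra
  ultimately show "f \<oplus>\<^bsub>A\<^esub> g \<in> W" unfolding W_def using f g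
    by (auto intro!: bexI[of _ "a \<oplus> b"] I0.a_closed)
  have "alg_const R (a \<otimes> b) = ?a \<otimes>\<^bsub>A\<^esub> ?b" using ring_hom_mult[OF alg_const_hom] f g by simp
  moreover have "(f \<otimes>\<^bsub>A\<^esub> g) \<ominus>\<^bsub>A\<^esub> (?a \<otimes>\<^bsub>A\<^esub> ?b) = (f \<ominus>\<^bsub>A\<^esub> ?a) \<otimes>\<^bsub>A\<^esub> g \<oplus>\<^bsub>A\<^esub> ?a \<otimes>\<^bsub>A\<^esub> (g \<ominus>\<^bsub>A\<^esub> ?b)"
    using f(1) g(1) ab by algebra
  ultimately show "f \<otimes>\<^bsub>A\<^esub> g \<in> W" unfolding W_def using f g ab
      I0.a_closed[OF I0.I_r_closed[OF f(3) g(1)] I0.I_l_closed[OF g(3) ab(1)]]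
    by (auto intro!: bexI[of _ "a \<otimes> b"])
qed

lemma W_const: "a \<in> carrier R \<Longrightarrow> alg_const R a \<in> W"
proof -
  interpret I0: ideal I0 A by (rule ideal_I0)
  assume a: "a \<in> carrier R"
  then have "alg_const R a \<ominus>\<^bsub>A\<^esub> alg_const R a = \<zero>\<^bsub>A\<^esub>" by (simp add: A.minus_eq A.r_neg)
  then have "alg_const R a \<ominus>\<^bsub>A\<^esub> alg_const R a \<in> I0" by simp
  then show ?thesis using a alg_const_closed[OF a] unfolding W_def by blast
qed

lemma W_unit_vec: "i < m \<Longrightarrow> character R \<one> (unit_vec i) \<in> W"
proof -
  assume i: "i < m"
  have "character R \<one> (unit_vec i) \<ominus>\<^bsub>A\<^esub> alg_const R (z i) \<in> I0"
    unfolding preimage_ideal_def using A.genideal_self[OF I0_generators] i by blast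
  then show ?thesis unfolding W_def using i z unit_char_closed by auto
qed

lemma nonneg_vector_induct:
  assumes u: "u \<in> lattice_vectors m" "\<And>i. 0 \<le> u i" and zero: "Q 0"
    and step: "\<And>u i. u \<in> lattice_vectors m \<Longrightarrow> (\<And>i. 0 \<le> u i) \<Longrightarrow> i < m \<Longrightarrow> Q u \<Longrightarrow> Q (u + unit_vec i)"
  shows "Q u"
  using u
proof (induction "nat (\<Sum>i<m. u i)" arbitrary: u)
  case 0
  then have "(\<Sum>i<m. u i) = 0" by (simp add: sum_nonneg order_antisym)
  then have "\<forall>i<m. u i = 0" using 0 by (simp add: sum_nonneg_eq_0_iff)
  then have "u = 0" using 0(2) unfolding lattice_vectors_def by (auto simp: fun_eq_iff not_less[symmetric])
  then have "Q u" using zero by simp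
  then show ?case .
next
  case (Suc n)
  have "\<exists>i<m. u i \<noteq> 0"
  proof (rule ccontr)
    assume "\<not> ?thesis"
    then have "(\<Sum>i<m. u i) = 0" by (intro sum.neutral) auto
    then show False using Suc(2) by simp
  qed
  then obtain i where i: "i < m" "0 < u i" using Suc.prems(2) by (metis order_le_less)
  define w where "w = u - unit_vec i"
  have w: "w \<in> lattice_vectors m" unfolding w_def
    using Suc.prems(1) unit_vec_lattice[OF i(1)] by (rule lattice_vectors_closed)
  have w0: "0 \<le> w l" for l using Suc.prems(2)[of l] i by (auto simp: w_def unit_vec_def)
  have "(\<Sum>l<m. w l) = (\<Sum>l<m. u l) - 1"
    using i(1) by (simp add: w_def sum_subtractf unit_vec_def)
  then have "n = nat (\<Sum>l<m. w l)" using Suc(2) by simp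
  then have "Q w" using Suc.hyps(1) w w0 by blast
  then have "Q (w + unit_vec i)" using step w w0 i(1) by blast
  moreover have "w + unit_vec i = u" by (simp add: w_def)
  ultimately have "Q u" by simp
  then show ?case .
qed

lemma W_character:
  assumes u: "u \<in> lattice_vectors m" "\<And>i. 0 \<le> u i" and c: "c \<in> carrier R"
  shows "character R c u \<in> W"
proof (induction u rule: nonneg_vector_induct)
  case 3
  have "character R c 0 \<in> W" using W_const[OF c] by (simp only: alg_const_character)
  then show ?case .
next
  case (4 u i)
  have "character R c (u + unit_vec i) = character R c u \<otimes>\<^bsub>A\<^esub> character R \<one> (unit_vec i)"
    using 4(1-3) c dual_monoid_nonneg unit_vec_dual_monoid by (subst character_mult) auto
  then have "character R c (u + unit_vec i) \<in> W" using 4(3,4) W_mult W_unit_vec by simp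
  then show ?case .
qed (use u in auto)

lemma W_all:
  assumes f: "f \<in> carrier A" and nonneg: "\<And>u i. u \<in> dual_monoid m \<sigma> \<Longrightarrow> 0 \<le> u i"
  shows "f \<in> W"
  using f
proof (induction f rule: character_induct)
  case zero
  then show ?case using W_const[of \<zero>] by (simp add: zero_A alg_const_def character_def)
next
  case (character c u)
  then show ?case using W_character nonneg dual_monoid_iff by blast
qed (rule W_add)

text \<open>Multiplication by a high power of the product of the coordinates makes all exponents of a function
  on the chart nonnegative.\<close>

lemma W_multiple:
  assumes f: "f \<in> carrier A"
  shows "\<exists>N. \<forall>M\<ge>N. character R \<one> (\<lambda>i. int M * ones i) \<otimes>\<^bsub>A\<^esub> f \<in> W"
  using f
proof (induction f rule: character_induct)
  case zero
  have "\<zero>\<^bsub>A\<^esub> \<in> W" using W_const[of \<zero>] by (simp add: zero_A alg_const_def character_def)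
  then show ?case using dual_monoid_closed(3)[OF ones_dual_monoid] by (simp add: A.r_null)
next
  case (character c u)
  define N where "N = nat (\<Sum>i<m. \<bar>u i\<bar>)"
  have u: "u \<in> lattice_vectors m" using character dual_monoid_iff by blast
  have "character R \<one> (\<lambda>i. int M * ones i) \<otimes>\<^bsub>A\<^esub> character R c u \<in> W" if "N \<le> M" for M
  proof -
    have "0 \<le> ((\<lambda>i. int M * ones i) + u) i" for i
    proof (cases "i < m")
      case True
      have "\<bar>u i\<bar> \<le> (\<Sum>i<m. \<bar>u i\<bar>)" using True by (intro member_le_sum) auto
      also have "\<dots> \<le> int M" using that by (simp add: N_def)
      finally show ?thesis using True by (simp add: ones_def)
    next
      case False
      then show ?thesis using u by (simp add: ones_def lattice_vectors_def)
    qed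
    moreover have "(\<lambda>i. int M * ones i) + u \<in> lattice_vectors m"
      by (intro lattice_vectors_closed ones_lattice u)
    ultimately have "character R c ((\<lambda>i. int M * ones i) + u) \<in> W"
      using W_character character by blast
    then show ?thesis
      using character dual_monoid_closed(3)[OF ones_dual_monoid] by (simp add: character_mult)
  qed
  then show ?case by blast
next
  case (add f g)
  then obtain N N' where N: "\<forall>M\<ge>N. character R \<one> (\<lambda>i. int M * ones i) \<otimes>\<^bsub>A\<^esub> f \<in> W"
    "\<forall>M\<ge>N'. character R \<one> (\<lambda>i. int M * ones i) \<otimes>\<^bsub>A\<^esub> g \<in> W" by blast
  have "character R \<one> (\<lambda>i. int M * ones i) \<otimes>\<^bsub>A\<^esub> (f \<oplus>\<^bsub>A\<^esub> g) \<in> W" if "max N N' \<le> M" for M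
    using add N that W_add dual_monoid_closed(3)[OF ones_dual_monoid, of "int M"]
    by (simp add: A.r_distr)
  then show ?case by blast
qed

lemma K_via_W:
  assumes j: "j < r" and f: "f \<in> K j" "f \<in> W" and Q: "ideal Q A" "I0 \<subseteq> Q" "alg_const R ` P j \<subseteq> Q"
  shows "f \<in> Q"
proof -
  interpret Q: ideal Q A by (rule Q)
  obtain a where a: "a \<in> carrier R" "f \<ominus>\<^bsub>A\<^esub> alg_const R a \<in> I0" and fA: "f \<in> carrier A"
    using f unfolding W_def by auto
  have "H j (f \<ominus>\<^bsub>A\<^esub> alg_const R a) = 0" using a(2) I0_in_K[OF j] by (auto simp: K_def)
  then have "h j a = 0" using f(1) j a fA by (simp add: H_minus H_const K_def)
  then have "alg_const R a \<in> Q" using a h_kernel[OF j] Q(3) by auto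
  moreover have "f \<ominus>\<^bsub>A\<^esub> alg_const R a \<in> Q" using a Q(2) by auto
  moreover have "(f \<ominus>\<^bsub>A\<^esub> x) \<oplus>\<^bsub>A\<^esub> x = f" if "x \<in> carrier A" for x
    using fA that by algebra
  then have "(f \<ominus>\<^bsub>A\<^esub> alg_const R a) \<oplus>\<^bsub>A\<^esub> alg_const R a = f"
    using alg_const_closed[OF a(1)] by blast
  ultimately show ?thesis using Q.a_closed by metis
qed

text \<open>The exponents of the characters that do not vanish at the point \<open>Q\<close>.\<close>

definition T :: "((nat \<Rightarrow> int) \<Rightarrow> 'b) set \<Rightarrow> (nat \<Rightarrow> int) set" where
  "T Q = {u \<in> dual_monoid m \<sigma>. character R \<one> u \<notin> Q}"

lemma T_face:
  assumes "primeideal Q A"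
  shows "0 \<in> T Q" "T Q \<subseteq> dual_monoid m \<sigma>"
    "u \<in> dual_monoid m \<sigma> \<Longrightarrow> u' \<in> dual_monoid m \<sigma> \<Longrightarrow> u + u' \<in> T Q \<longleftrightarrow> u \<in> T Q \<and> u' \<in> T Q"
proof -
  interpret Q: primeideal Q A by fact
  have "\<one>\<^bsub>A\<^esub> \<notin> Q" using Q.one_imp_carrier Q.I_notcarr by blast
  then show "0 \<in> T Q" unfolding T_def by (simp add: one_A alg_const_character)
  show "T Q \<subseteq> dual_monoid m \<sigma>" unfolding T_def by auto
  assume u: "u \<in> dual_monoid m \<sigma>" "u' \<in> dual_monoid m \<sigma>"
  have "character R \<one> (u + u') = character R \<one> u \<otimes>\<^bsub>A\<^esub> character R \<one> u'"
    using u by (simp add: character_mult)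
  then have "character R \<one> (u + u') \<in> Q \<longleftrightarrow> character R \<one> u \<in> Q \<or> character R \<one> u' \<in> Q"
    using u Q.I_prime Q.I_l_closed Q.I_r_closed character_closed by (metis one_closed)
  then show "u + u' \<in> T Q \<longleftrightarrow> u \<in> T Q \<and> u' \<in> T Q" unfolding T_def using u by auto
qed

text \<open>If no coordinate vanishes at \<open>Q\<close>, no monomial does. Every character divides a monomial, because \<open>ones\<close> is
  positive on all generators.\<close>

lemma T_unit_vecs:
  assumes Q: "primeideal Q A" and e: "\<And>i. i < m \<Longrightarrow> unit_vec i \<in> T Q"
  shows "dual_monoid m \<sigma> \<subseteq> T Q"
proof
  fix u assume u: "u \<in> dual_monoid m \<sigma>"
  have nonneg: "w \<in> T Q" if "w \<in> lattice_vectors m" "\<And>i. 0 \<le> w i" for w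
  proof (induction w rule: nonneg_vector_induct)
    case (4 w i)
    then have "w + unit_vec i \<in> T Q"
      using T_face(3)[OF Q, of w "unit_vec i"] e dual_monoid_nonneg unit_vec_dual_monoid by blast
    then show ?case .
  next
    case 3
    show ?case by (rule T_face(1)[OF Q])
  qed (use that in auto)
  have "- u \<in> lattice_vectors m" using u lattice_vectors_closed(4) unfolding dual_monoid_iff by blast
  then obtain N where N: "0 \<le> N" "- u + (\<lambda>i. N * ones i) \<in> dual_monoid m \<sigma>"
    using ones_absorbing[of "- u"] by blast
  have "(\<lambda>i. N * ones i) \<in> T Q"
    using N(1) lattice_vectors_closed(5)[OF ones_lattice] by (intro nonneg) (auto simp: ones_def)
  then have "u + (- u + (\<lambda>i. N * ones i)) \<in> T Q" by (simp add: add.assoc[symmetric])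
  then show "u \<in> T Q" using T_face(3)[OF Q u N(2)] by blast
qed

lemma zero_cone_in_orthant_fan: "{0} \<in> orthant_fan m"
proof -
  have "{0} = {x \<in> orthant m. pairing m (\<lambda>_. 1) x = 0}"
  proof (intro equalityI subsetI)
    fix x assume "x \<in> {x \<in> orthant m. pairing m (\<lambda>_. 1) x = 0}"
    then have x: "x \<in> orthant m" "(\<Sum>i<m. x i) = 0" by (auto simp: pairing_def)
    then have "\<forall>i<m. x i = 0" unfolding orthant_def by (subst (asm) sum_nonneg_eq_0_iff) auto
    then have "x i = 0" for i using x(1) unfolding orthant_def by (cases "i < m") auto
    then show "x \<in> {0}" by (auto simp: fun_eq_iff)
  qed (auto simp: orthant_def pairing_def)
  then show ?thesis unfolding orthant_fan_def is_face_def
    by (intro CollectI exI[of _ "\<lambda>_. 1"]) (auto simp: pairing_def orthant_def intro!: sum_nonneg)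
qed

lemma zero_in_\<sigma>: "0 \<in> \<sigma>"
  using in_\<sigma>[of "\<lambda>_. 0"] by (simp add: zero_fun_def)

lemma pairing_unit_vec: "i < m \<Longrightarrow> pairing m (real_vec (unit_vec i)) x = x i"
  by (simp add: pairing_def real_vec_def unit_vec_def if_distrib[of "\<lambda>x. x * _"] if_distrib[of real_of_int] cong: if_cong)

lemma face_without_unit_vecs:
  assumes \<tau>: "is_face m \<tau> \<sigma>" and e: "\<And>i. i < m \<Longrightarrow> unit_vec i \<in> perp m \<tau>"
  shows "\<tau> = {0}"
proof -
  have sub: "\<tau> \<subseteq> \<sigma>" using \<tau> unfolding is_face_def by blast
  have "x = 0" if x: "x \<in> \<tau>" for x
  proof
    fix i show "x i = 0 i"
    proof (cases "i < m")
      case True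
      then show ?thesis using e[OF True] x by (auto simp: perp_def pairing_unit_vec)
    next
      case False
      then show ?thesis using x sub orth unfolding orthant_def by auto
    qed
  qed
  moreover have "0 \<in> \<tau>" using \<tau> zero_in_\<sigma> unfolding is_face_def by (auto simp: pairing_def)
  ultimately show ?thesis by blast
qed

text \<open>The generic point of a branch lies in the torus.\<close>

lemma K_not_exceptional: "j < r \<Longrightarrow> \<not> in_exceptional m R \<Sigma> \<sigma> (K j)"
proof
  assume j: "j < r" and "in_exceptional m R \<Sigma> \<sigma> (K j)"
  then obtain \<tau> where \<tau>: "\<tau> \<notin> orthant_fan m" "is_face m \<tau> \<sigma>"
    "\<forall>u\<in>dual_monoid m \<sigma>. character R \<one> u \<notin> K j \<longleftrightarrow> u \<in> perp m \<tau>"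
    unfolding in_exceptional_def in_orbit_def by blast
  have "character R \<one> u \<notin> K j" for u using j by (simp add: K_def H_char Z_nz)
  then have "\<tau> = {0}" using \<tau>(2,3) unit_vec_dual_monoid by (intro face_without_unit_vecs) auto
  then show False using \<tau>(1) zero_cone_in_orthant_fan by simp
qed

text \<open>All coordinates vanish at \<open>Q\<close>, so the cone of its orbit lies in no coordinate hyperplane. Among the
  faces of the orthant, only the orthant itself has this property; it is a cone of the chart only if
  the chart is the affine space.\<close>

lemma nonexceptional_closed_point:
  assumes Q: "primeideal Q A" "\<not> in_exceptional m R \<Sigma> \<sigma> Q"
    and e: "\<And>i. i < m \<Longrightarrow> character R \<one> (unit_vec i) \<in> Q"
    and u: "u \<in> dual_monoid m \<sigma>"
  shows "0 \<le> u i"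
proof -
  obtain \<tau> where \<tau>: "is_face m \<tau> \<sigma>" "\<And>u. u \<in> dual_monoid m \<sigma> \<Longrightarrow> u \<in> T Q \<longleftrightarrow> u \<in> perp m \<tau>"
    using monoid_face_orbit[OF T_face[OF Q(1)]] by blast
  then have "in_orbit m R \<sigma> \<tau> Q" unfolding in_orbit_def T_def by auto
  moreover have "\<tau> \<in> \<Sigma>" using subdivision \<sigma>_in \<tau>(1) unfolding regular_subdivision_def by blast
  ultimately have "is_face m \<tau> (orthant m)"
    using Q(2) unfolding in_exceptional_def orthant_fan_def by blast
  then obtain w where w: "\<And>x. x \<in> orthant m \<Longrightarrow> 0 \<le> pairing m w x"
    "\<tau> = {x \<in> orthant m. pairing m w x = 0}" unfolding is_face_def by blast
  have "w i = 0" if i: "i < m" for i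
  proof (rule ccontr)
    assume "w i \<noteq> 0"
    have w_nonneg: "0 \<le> w l" if "l < m" for l
    proof -
      have "real_vec (unit_vec l) \<in> orthant m" using that by (auto simp: orthant_def real_vec_def unit_vec_def)
      then have "0 \<le> pairing m w (real_vec (unit_vec l))" by (rule w(1))
      also have "pairing m w (real_vec (unit_vec l)) = pairing m (real_vec (unit_vec l)) w"
        by (simp add: pairing_def mult.commute)
      finally show ?thesis using that by (simp add: pairing_unit_vec)
    qed
    have "x i = 0" if x: "x \<in> \<tau>" for x
    proof -
      have "(\<Sum>l<m. w l * x l) = 0" "\<And>l. 0 \<le> x l" using x w(2) by (auto simp: pairing_def orthant_def)
      then have "\<forall>l<m. w l * x l = 0" using w_nonneg by (subst (asm) sum_nonneg_eq_0_iff) auto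
      then show ?thesis using i \<open>w i \<noteq> 0\<close> by auto
    qed
    then have "unit_vec i \<in> perp m \<tau>" using unit_vec_lattice[OF i] by (simp add: perp_def pairing_unit_vec i)
    then have "unit_vec i \<in> T Q" using \<tau>(2) unit_vec_dual_monoid[OF i] by blast
    then show False using e[OF i] unfolding T_def by blast
  qed
  then have "\<tau> = orthant m" unfolding w(2) by (auto simp: pairing_def)
  then have \<sigma>_eq: "orthant m \<subseteq> \<sigma>" using \<tau>(1) unfolding is_face_def by blast
  show ?thesis
  proof (cases "i < m")
    case True
    then have "real_vec (unit_vec i) \<in> \<sigma>"
      using \<sigma>_eq by (auto simp: orthant_def real_vec_def unit_vec_def)
    then have "0 \<le> pairing m (real_vec u) (real_vec (unit_vec i))" using u unfolding dual_monoid_def by blast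
    also have "\<dots> = pairing m (real_vec (unit_vec i)) (real_vec u)"
      by (simp add: pairing_def mult.commute)
    finally show ?thesis using True by (simp add: pairing_unit_vec) (simp add: real_vec_def)
  next
    case False
    then show ?thesis using u unfolding dual_monoid_iff lattice_vectors_def by auto
  qed
qed

lemma coefficient_prime:
  assumes "primeideal Q A"
  shows "primeideal {a \<in> carrier R. alg_const R a \<in> Q} R"
proof -
  interpret ring_hom_ring R A "alg_const R"
    by unfold_locales (rule alg_const_hom)
  show ?thesis by (rule primeideal_vimage[OF cring_axioms assms])
qed

text \<open>Modulo the equations of the preimage, and up to a power of the product of the coordinates, an element
  of \<open>K j\<close> is a function on the curve that vanishes on the branch \<open>j\<close>. The product of the coordinates
  is invertible at the generic point of a branch; at the closed point the chart is affine space and the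
  exponents are nonnegative from the outset.\<close>

lemma K_below:
  assumes Q: "primeideal Q A" "I0 \<subseteq> Q" "\<not> in_exceptional m R \<Sigma> \<sigma> Q"
    and j: "j < r" "alg_const R ` P j \<subseteq> Q"
  shows "K j \<subseteq> Q"
proof
  interpret Q: primeideal Q A by (rule Q)
  fix f assume f: "f \<in> K j"
  then have fA: "f \<in> carrier A" by (simp add: K_def)
  define q where "q = {a \<in> carrier R. alg_const R a \<in> Q}"
  have q: "primeideal q R" unfolding q_def by (rule coefficient_prime[OF Q(1)])
  have Pq: "P j \<subseteq> q" unfolding q_def using j h_kernel[OF j(1)] by auto
  have z_iff: "character R \<one> (unit_vec i) \<in> Q \<longleftrightarrow> z i \<in> q" if i: "i < m" for i
  proof -
    let ?c = "character R \<one> (unit_vec i)" and ?z = "alg_const R (z i)"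
    have c: "?c \<in> carrier A" "?z \<in> carrier A" using unit_char_closed z i by auto
    have d: "?c \<ominus>\<^bsub>A\<^esub> ?z \<in> Q"
      using A.genideal_self[OF I0_generators] i Q(2) unfolding preimage_ideal_def by blast
    have "(?c \<ominus>\<^bsub>A\<^esub> ?z) \<oplus>\<^bsub>A\<^esub> ?z = ?c" "?c \<ominus>\<^bsub>A\<^esub> (?c \<ominus>\<^bsub>A\<^esub> ?z) = ?z" using c by algebra+
    then have "?c \<in> Q \<longleftrightarrow> ?z \<in> Q" using d Q.a_closed Q.a_inv_closed unfolding A.minus_eq by metis
    then show ?thesis using i z by (simp add: q_def)
  qed
  show "f \<in> Q"
  proof (cases "\<forall>i<m. z i \<in> q")
    case True
    then have "f \<in> W"
      using nonexceptional_closed_point[OF Q(1,3)] z_iff by (intro W_all[OF fA]) auto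
    then show ?thesis by (rule K_via_W[OF j(1) f _ Q.is_ideal Q(2) j(2)])
  next
    case False
    then obtain i where i: "i < r" "q = P i" using primes[OF q] by blast
    then have "i = j" using incomparable[OF j(1) i(1)] Pq by simp
    have "z l \<notin> q" if "l < m" for l
      using i \<open>i = j\<close> h_kernel[OF j(1)] h_nz[OF j(1) that] by auto
    then have "unit_vec l \<in> T Q" if "l < m" for l
      using z_iff[OF that] that unit_vec_dual_monoid unfolding T_def by simp
    then have TQ: "dual_monoid m \<sigma> \<subseteq> T Q" by (rule T_unit_vecs[OF Q(1)])
    obtain N where N: "character R \<one> (\<lambda>i. int N * ones i) \<otimes>\<^bsub>A\<^esub> f \<in> W" using W_multiple[OF fA] by blast
    have o: "(\<lambda>i. int N * ones i) \<in> dual_monoid m \<sigma>" using dual_monoid_closed(3)[OF ones_dual_monoid] by simp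
    then have oc: "character R \<one> (\<lambda>i. int N * ones i) \<in> carrier A" by simp
    have "character R \<one> (\<lambda>i. int N * ones i) \<otimes>\<^bsub>A\<^esub> f \<in> K j"
      using prime_K[OF j(1)] f oc by (meson ideal.I_l_closed primeideal_def)
    then have "character R \<one> (\<lambda>i. int N * ones i) \<otimes>\<^bsub>A\<^esub> f \<in> Q"
      using N by (rule K_via_W[OF j(1) _ _ Q.is_ideal Q(2) j(2)])
    moreover have "character R \<one> (\<lambda>i. int N * ones i) \<notin> Q" using TQ o unfolding T_def by blast
    ultimately show ?thesis using Q.I_prime[OF oc fA] by blast
  qed
qed

lemma strict_transform_curve:
  "strict_transform_ideal m R z \<Sigma> \<sigma> {\<zero>} = {f \<in> carrier A. \<forall>j<r. f \<in> K j}"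
proof (intro equalityI subsetI)
  fix f assume f: "f \<in> strict_transform_ideal m R z \<Sigma> \<sigma> {\<zero>}"
  have "alg_const R \<zero> \<in> K j" if "j < r" for j
    using that by (simp add: K_def H_const h_zero)
  then have "f \<in> K j" if "j < r" for j
    using f that prime_K I0_in_K K_not_exceptional unfolding strict_transform_ideal_def by blast
  then show "f \<in> {f \<in> carrier A. \<forall>j<r. f \<in> K j}"
    using f unfolding strict_transform_ideal_def by blast
next
  fix f assume f: "f \<in> {f \<in> carrier A. \<forall>j<r. f \<in> K j}"
  have "f \<in> Q" if Q: "primeideal Q A" "I0 \<subseteq> Q" "\<not> in_exceptional m R \<Sigma> \<sigma> Q" for Q
  proof -
    obtain j where j: "j < r" "P j \<subseteq> {a \<in> carrier R. alg_const R a \<in> Q}"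
      using primes[OF coefficient_prime[OF Q(1)]] by blast
    then have "K j \<subseteq> Q" by (intro K_below[OF Q]) auto
    then show ?thesis using f j by blast
  qed
  then show "f \<in> strict_transform_ideal m R z \<Sigma> \<sigma> {\<zero>}"
    using f unfolding strict_transform_ideal_def by blast
qed

lemma strict_transform_branch:
  assumes j: "j < r"
  shows "strict_transform_ideal m R z \<Sigma> \<sigma> (P j) = K j"
proof (intro equalityI subsetI)
  fix f assume f: "f \<in> strict_transform_ideal m R z \<Sigma> \<sigma> (P j)"
  have "alg_const R ` P j \<subseteq> K j" using j h_kernel by (auto simp: K_def H_const)
  then show "f \<in> K j"
    using f j prime_K I0_in_K K_not_exceptional unfolding strict_transform_ideal_def by blast
next
  fix f assume f: "f \<in> K j"
  then have "f \<in> Q" if "primeideal Q A" "I0 \<subseteq> Q" "\<not> in_exceptional m R \<Sigma> \<sigma> Q" "alg_const R ` P j \<subseteq> Q" for Q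
    using K_below that j by blast
  then show "f \<in> strict_transform_ideal m R z \<Sigma> \<sigma> (P j)"
    using f unfolding strict_transform_ideal_def K_def by blast
qed

end

context curve_chart
begin

section \<open>The strict transform is smooth\<close>

lemma v_lattice: "j < r \<Longrightarrow> v j \<in> lattice_vectors m" and v_nonneg: "j < r \<Longrightarrow> 0 \<le> v j i"
  by (auto simp: v lattice_vectors_def)

text \<open>The ray through \<open>v j\<close> is a cone of the fan, so its intersection with \<open>\<sigma>\<close> is a face.\<close>

lemma v_generator:
  assumes j: "j < r" and inside: "real_vec (v j) \<in> \<sigma>"
  shows "v j \<in> G"
proof -
  obtain u where u: "u \<in> lattice_vectors m" "int_pairing m u (v j) = 1" using primitive[OF j] by blast
  obtain c where c: "\<And>g. g \<in> G \<Longrightarrow> 0 \<le> c g" "real_vec (v j) = (\<lambda>i. \<Sum>g\<in>G. c g * real_of_int (g i))"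
    using inside by (rule \<sigma>_cases) blast
  have "x \<in> \<sigma>" if x: "x \<in> cone_spanned {v j}" for x
  proof -
    obtain a where a: "0 \<le> a" "x = (\<lambda>i. a * real_vec (v j) i)"
      using x unfolding cone_spanned_def real_vec_def by auto
    have "x = (\<lambda>i. \<Sum>g\<in>G. (a * c g) * real_of_int (g i))"
      unfolding a(2) c(2) by (simp add: sum_distrib_left mult.assoc)
    then show ?thesis using in_\<sigma>[of "\<lambda>g. a * c g"] a(1) c(1) by simp
  qed
  then have "cone_spanned {v j} \<inter> \<sigma> = cone_spanned {v j}" by blast
  moreover have "is_face m (cone_spanned {v j} \<inter> \<sigma>) \<sigma>"
    using subdivision rays[OF j] \<sigma>_in unfolding regular_subdivision_def by blast
  ultimately show ?thesis
    using primitive_face_is_generator[OF v_lattice[OF j] u inside] by simp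
qed

lemma D_generator: "g \<in> G \<Longrightarrow> D g \<in> dual_monoid m \<sigma>"
  using D_lattice D_dual GB by (auto simp: dual_monoid_iff subset_iff)

lemma uniformizing_exponent:
  assumes j: "j < r"
  shows "\<exists>u\<in>dual_monoid m \<sigma>. int_pairing m u (v j) = 1"
proof (cases "real_vec (v j) \<in> \<sigma>")
  case True
  then have "v j \<in> G" by (rule v_generator[OF j])
  then show ?thesis using D_generator D_dual[of "v j" "v j"] GB by auto
next
  case False
  obtain u where u: "u \<in> lattice_vectors m" "int_pairing m u (v j) = 1" using primitive[OF j] by blast
  then show ?thesis using pairing_one_outside[OF v_lattice[OF j] v_nonneg[OF j] u False] by blast
qed

lemma fls_nonneg_fps: "0 \<le> fls_subdegree (x :: 'k fls) \<Longrightarrow> \<exists>g. x = fps_to_fls g"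
  by (metis fls_regpart_to_fls_trivial)

text \<open>A character of order one along the branch serves as the uniformizer whose powers generate
  \<open>k[[t]]\<close> over the functions on the curve.\<close>

lemma H_onto_fps:
  assumes j: "j < r"
  shows "\<exists>f\<in>carrier A. H j f = fps_to_fls g"
proof -
  obtain u where u: "u \<in> dual_monoid m \<sigma>" "int_pairing m u (v j) = 1" using uniformizing_exponent[OF j] by blast
  have d: "fls_subdegree (Z j u) = 1" using subdegree_Z[OF j] u by simp
  then obtain s where s: "Z j u = fps_to_fls s" using fls_nonneg_fps[of "Z j u"] by auto
  then have "subdegree s = 1" using d by (simp add: fls_subdegree_fls_to_fps)
  then obtain e :: nat and c where c: "\<And>i. c i \<in> carrier R" "g = (\<Sum>i<e. h j (c i) * s ^ i)"
    using generated[OF j, of s g] by blast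
  have "\<exists>f\<in>carrier A. H j f = fps_to_fls (\<Sum>i<e. h j (c i) * s ^ i)" for e
  proof (induction e)
    case 0
    then show ?case using H_simps(4)[OF j] by (intro bexI[of _ "\<zero>\<^bsub>A\<^esub>"]) auto
  next
    case (Suc e)
    then obtain f where f: "f \<in> carrier A" "H j f = fps_to_fls (\<Sum>i<e. h j (c i) * s ^ i)" by blast
    have "character R \<one> u \<in> carrier A" using u by simp
    then have "H j (f \<oplus>\<^bsub>A\<^esub> alg_const R (c e) \<otimes>\<^bsub>A\<^esub> character R \<one> u [^]\<^bsub>A\<^esub> e) =
        H j f + fps_to_fls (h j (c e)) * fps_to_fls s ^ e"
      using j f(1) c(1) s by (simp add: H_simps H_const H_pow H_char)
    also have "\<dots> = fps_to_fls (\<Sum>i<Suc e. h j (c i) * s ^ i)"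
      by (simp add: f(2) fls_times_fps_to_fls fps_to_fls_power)
    finally have "H j (f \<oplus>\<^bsub>A\<^esub> alg_const R (c e) \<otimes>\<^bsub>A\<^esub> character R \<one> u [^]\<^bsub>A\<^esub> e) =
        fps_to_fls (\<Sum>i<Suc e. h j (c i) * s ^ i)" .
    moreover have "f \<oplus>\<^bsub>A\<^esub> alg_const R (c e) \<otimes>\<^bsub>A\<^esub> character R \<one> u [^]\<^bsub>A\<^esub> e \<in> carrier A"
      using f(1) c(1) u by simp
    ultimately show ?case by blast
  qed
  then show ?thesis unfolding c(2) .
qed

lemma H_fps_inside:
  assumes j: "j < r" and inside: "real_vec (v j) \<in> \<sigma>" and f: "f \<in> carrier A"
  shows "\<exists>g. H j f = fps_to_fls g"
  using f
proof (induction f rule: character_induct)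
  case zero
  then show ?case using H_simps(4)[OF j] fps_zero_to_fls by metis
next
  case (character c u)
  have "0 \<le> int_pairing m u (v j)" using character v_generator[OF j inside] dual_monoid_iff by blast
  then obtain s where "Z j u = fps_to_fls s" using fls_nonneg_fps[of "Z j u"] subdegree_Z[OF j] by auto
  then have "H j (character R c u) = fps_to_fls (h j c * s)"
    by (simp add: H_character[OF j] fls_times_fps_to_fls)
  then show ?case by blast
next
  case (add f g)
  then show ?case using H_simps(2)[OF j] by (metis fps_to_fls_plus)
qed

text \<open>Multiplying \<open>k[[t]]\<close> by the powers of a character with a pole along the branch yields \<open>k((t))\<close>.\<close>

lemma H_onto_outside:
  assumes j: "j < r" and outside: "real_vec (v j) \<notin> \<sigma>"
  shows "\<exists>f\<in>carrier A. H j f = x"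
proof (cases "x = 0")
  case True
  then show ?thesis using H_simps(4)[OF j] by (intro bexI[of _ "\<zero>\<^bsub>A\<^esub>"]) auto
next
  case False
  obtain u where u: "u \<in> lattice_vectors m" "int_pairing m u (v j) = 1" using primitive[OF j] by blast
  obtain w where w: "w \<in> dual_monoid m \<sigma>" "int_pairing m w (v j) < 0"
    using pairing_one_outside[OF v_lattice[OF j] v_nonneg[OF j] u outside] by blast
  define N where "N = nat (- fls_subdegree x)"
  define y where "y = x / Z j w ^ N"
  have "fls_subdegree y = fls_subdegree x - int N * int_pairing m w (v j)"
    unfolding y_def using False Z_nz[OF j] subdegree_Z[OF j]
    by (simp add: fls_divide_subdegree fls_subdegree_pow)
  moreover have "int N * 1 \<le> int N * (- int_pairing m w (v j))" using w(2) by (intro mult_left_mono) auto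
  moreover have "- fls_subdegree x \<le> int N" unfolding N_def by simp
  ultimately have "0 \<le> fls_subdegree y" by simp
  then obtain g where "y = fps_to_fls g" using fls_nonneg_fps by blast
  then obtain f where f: "f \<in> carrier A" "H j f = y" using H_onto_fps[OF j, of g] by auto
  have "H j (character R \<one> w [^]\<^bsub>A\<^esub> N \<otimes>\<^bsub>A\<^esub> f) = Z j w ^ N * y"
    using f w(1) j by (simp add: H_simps H_pow H_char)
  also have "\<dots> = x" unfolding y_def using Z_nz[OF j] by simp
  finally have "H j (character R \<one> w [^]\<^bsub>A\<^esub> N \<otimes>\<^bsub>A\<^esub> f) = x" .
  moreover have "character R \<one> w [^]\<^bsub>A\<^esub> N \<otimes>\<^bsub>A\<^esub> f \<in> carrier A" using f(1) w(1) by simp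
  ultimately show ?thesis by blast
qed

lemma modulo_K:
  assumes j: "j < r" and Q: "ideal Q A" "K j \<subseteq> Q" and f: "f \<in> carrier A" and g: "g \<in> Q"
    and eq: "H j f = H j g"
  shows "f \<in> Q"
proof -
  interpret Q: ideal Q A by (rule Q)
  have gA: "g \<in> carrier A" using g by (rule Q.Icarr)
  have "f \<ominus>\<^bsub>A\<^esub> g \<in> K j" using H_minus[OF j f gA] eq f gA by (simp add: K_def)
  then have "(f \<ominus>\<^bsub>A\<^esub> g) \<oplus>\<^bsub>A\<^esub> g \<in> Q" using Q(2) g by auto
  moreover have "(f \<ominus>\<^bsub>A\<^esub> g) \<oplus>\<^bsub>A\<^esub> g = f" using f gA by algebra
  ultimately show ?thesis by simp
qed

lemma no_unit_modulo_K:
  assumes j: "j < r" and Q: "ideal Q A" "K j \<subseteq> Q" "Q \<noteq> carrier A"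
    and f: "f \<in> Q" and g: "g \<in> carrier A" and inv: "H j g * H j f = 1"
  shows False
proof -
  interpret Q: ideal Q A by (rule Q)
  have 1: "g \<otimes>\<^bsub>A\<^esub> f \<in> Q" using f g by (rule Q.I_l_closed)
  have 2: "H j \<one>\<^bsub>A\<^esub> = H j (g \<otimes>\<^bsub>A\<^esub> f)" using inv j g Q.Icarr[OF f] by (simp add: H_simps)
  have "\<one>\<^bsub>A\<^esub> \<in> Q" by (rule modulo_K[OF j Q(1,2) A.one_closed 1 2])
  then show False using Q.one_imp_carrier Q(3) by blast
qed

text \<open>The closed point of the branch \<open>j\<close> in this chart, if there is one.\<close>

definition M :: "nat \<Rightarrow> ((nat \<Rightarrow> int) \<Rightarrow> 'b) set" where
  "M j = {f \<in> carrier A. H j f = 0 \<or> 0 < fls_subdegree (H j f)}"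

text \<open>The quotient by \<open>K j\<close> is the field \<open>k((t))\<close> or the discrete valuation ring \<open>k[[t]]\<close>, according to
  whether \<open>v j\<close> lies outside or inside the cone.\<close>

lemma prime_over_K:
  assumes j: "j < r" and Q: "primeideal Q A" "K j \<subseteq> Q" "Q \<noteq> K j"
  shows "real_vec (v j) \<in> \<sigma> \<and> Q = M j"
proof -
  interpret Q: primeideal Q A by (rule Q)
  note no_unit = no_unit_modulo_K[OF j Q.is_ideal Q(2) Q.I_notcarr[symmetric]]
  obtain f where f: "f \<in> Q" "H j f \<noteq> 0" using Q(2,3) Q.Icarr unfolding K_def by blast
  have inside: "real_vec (v j) \<in> \<sigma>"
  proof (rule ccontr)
    assume "\<not> ?thesis"
    then obtain g where "g \<in> carrier A" "H j g = 1 / H j f" using H_onto_outside[OF j] by blast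
    then show False using no_unit[OF f(1), of g] f(2) by simp
  qed
  obtain s where s: "s \<in> carrier A" "H j s = fps_to_fls fps_X" using H_onto_fps[OF j] by blast
  define X' where "X' = (fps_to_fls fps_X :: 'k fls)"
  have sX: "H j s = X'" using s(2) by (simp only: X'_def)
  have X': "X' \<noteq> 0" "fls_subdegree X' = 1" unfolding X'_def by (simp_all add: fls_subdegree_fls_to_fps)
  have "s \<in> Q"
  proof -
    obtain g where g: "H j f = fps_to_fls g" using H_fps_inside[OF j inside Q.Icarr[OF f(1)]] by blast
    define a where "a = subdegree g"
    have sub: "fls_subdegree (X' ^ a / H j f) = 0"
      using X' f(2) g by (simp add: fls_divide_subdegree fls_subdegree_pow fls_subdegree_fls_to_fps a_def)
    then obtain w where "X' ^ a / H j f = fps_to_fls w" using fls_nonneg_fps by fastforce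
    then obtain f' where f': "f' \<in> carrier A" "H j f' = X' ^ a / H j f" using H_onto_fps[OF j, of w] by auto
    have 1: "f' \<otimes>\<^bsub>A\<^esub> f \<in> Q" using f(1) f'(1) by (rule Q.I_l_closed)
    have 2: "H j (s [^]\<^bsub>A\<^esub> a) = H j (f' \<otimes>\<^bsub>A\<^esub> f)"
      using f' s(1) sX f Q.Icarr[OF f(1)] j by (simp add: H_pow H_simps)
    have "s [^]\<^bsub>A\<^esub> a \<in> Q" by (rule modulo_K[OF j Q.is_ideal Q(2) A.nat_pow_closed[OF s(1)] 1 2])
    then show ?thesis
    proof (induction a)
      case 0
      then show ?case using Q.one_imp_carrier Q.I_notcarr by simp
    next
      case (Suc a)
      then show ?case using Q.I_prime[of "s [^]\<^bsub>A\<^esub> a" s] s(1) by auto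
    qed
  qed
  have "M j \<subseteq> Q"
  proof
    fix f assume f: "f \<in> M j"
    show "f \<in> Q"
    proof (cases "H j f = 0")
      case True
      then show ?thesis using f Q(2) unfolding M_def K_def by auto
    next
      case False
      then have "0 \<le> fls_subdegree (H j f / X')"
        using f X' by (simp add: fls_divide_subdegree M_def)
      then obtain w where "H j f / X' = fps_to_fls w" using fls_nonneg_fps by blast
      then obtain g where g: "g \<in> carrier A" "H j g = H j f / X'" using H_onto_fps[OF j, of w] by auto
      have 1: "s \<otimes>\<^bsub>A\<^esub> g \<in> Q" using \<open>s \<in> Q\<close> g(1) by (rule Q.I_r_closed)
      have 2: "H j f = H j (s \<otimes>\<^bsub>A\<^esub> g)" using g s(1) sX X'(1) j by (simp add: H_simps)
      show ?thesis using f by (intro modulo_K[OF j Q.is_ideal Q(2) _ 1 2]) (simp add: M_def)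
    qed
  qed
  moreover have "Q \<subseteq> M j"
  proof
    fix f assume f: "f \<in> Q"
    have fA: "f \<in> carrier A" using f by (rule Q.Icarr)
    show "f \<in> M j"
    proof (rule ccontr)
      assume "f \<notin> M j"
      then have nz: "H j f \<noteq> 0" "\<not> 0 < fls_subdegree (H j f)" using fA by (auto simp: M_def)
      obtain g where "H j f = fps_to_fls g" using H_fps_inside[OF j inside fA] by blast
      then have "fls_subdegree (H j f) = 0" using nz(2) by (simp add: fls_subdegree_fls_to_fps)
      then have "0 \<le> fls_subdegree (1 / H j f)" using nz(1) by (simp add: fls_divide_subdegree)
      then obtain w where "1 / H j f = fps_to_fls w" using fls_nonneg_fps by blast
      then obtain g where "g \<in> carrier A" "H j g = 1 / H j f" using H_onto_fps[OF j, of w] by auto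
      then show False using no_unit[OF f, of g] nz(1) by simp
    qed
  qed
  ultimately show ?thesis using inside by blast
qed

text \<open>Two branches with closed points in the chart pass through different boundary divisors: the character
  dual to one of the two rays vanishes at the closed point of one branch only. The generic points differ
  because the prime ideals of the branches are incomparable.\<close>

lemma disjoint_branches:
  assumes ij: "i < r" "j < r" and Q: "primeideal Q A" "K i \<subseteq> Q" "K j \<subseteq> Q"
  shows "i = j"
proof (rule ccontr)
  assume ne: "i \<noteq> j"
  have not_sub: "\<not> K i \<subseteq> K j" if "i < r" "j < r" "i \<noteq> j" for i j
  proof
    assume sub: "K i \<subseteq> K j"
    have "P i \<subseteq> P j"
    proof
      fix a assume "a \<in> P i"
      then have a: "a \<in> carrier R" "h i a = 0" using h_kernel[OF that(1)] by auto
      then have "alg_const R a \<in> K i" using H_const[OF that(1)] by (simp add: K_def)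
      then have "H j (alg_const R a) = 0" using sub by (auto simp: K_def)
      then show "a \<in> P j" using a H_const[OF that(2)] h_kernel[OF that(2)] by simp
    qed
    then show False using incomparable that by blast
  qed
  have "Q \<noteq> K i" "Q \<noteq> K j" using not_sub ij ne Q by metis+
  then have *: "real_vec (v i) \<in> \<sigma>" "Q = M i" "real_vec (v j) \<in> \<sigma>" "Q = M j"
    using prime_over_K ij Q by blast+
  have g: "v i \<in> G" "v j \<in> G" using v_generator ij * by blast+
  have "v j \<noteq> v i" using distinct ij ne by metis
  then have d: "int_pairing m (D (v i)) (v i) = 1" "int_pairing m (D (v i)) (v j) = 0"
    using D_dual[OF subsetD[OF GB g(1)] subsetD[OF GB g(1)]]
      D_dual[OF subsetD[OF GB g(1)] subsetD[OF GB g(2)]] by simp_all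
  let ?c = "character R \<one> (D (v i))"
  have c: "?c \<in> carrier A" using D_generator[OF g(1)] by simp
  have "?c \<in> M i" using c d ij by (simp add: M_def H_char subdegree_Z)
  moreover have "?c \<notin> M j" using d ij Z_nz by (simp add: M_def H_char subdegree_Z)
  ultimately show False using * by blast
qed

text \<open>A point of the strict transform lies on exactly one branch \<open>j\<close>. An element that vanishes on the other
  branches but not at this point shows that the local ring is that of the branch \<open>j\<close> alone, which is
  \<open>k[[t]]\<close> or \<open>k((t))\<close>.\<close>

theorem regular_strict_transform:
  assumes Q': "primeideal Q' (A Quot strict_transform_ideal m R z \<Sigma> \<sigma> {\<zero>})"
  shows "regular_local_ring (localization (A Quot strict_transform_ideal m R z \<Sigma> \<sigma> {\<zero>}) Q')"
proof -
  define J where "J = strict_transform_ideal m R z \<Sigma> \<sigma> {\<zero>}"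
  have J: "f \<in> J \<longleftrightarrow> f \<in> carrier A \<and> (\<forall>j<r. f \<in> K j)" for f
    unfolding J_def strict_transform_curve by simp
  have "ideal (\<Inter>(K ` {..<r})) A"
  proof (rule A.i_Intersect)
    show "K ` {..<r} \<noteq> {}" using r by (auto simp: lessThan_empty_iff)
    show "ideal I A" if "I \<in> K ` {..<r}" for I
      using that prime_K by (auto simp: primeideal_def)
  qed
  moreover have "f \<in> carrier A" if "\<forall>j<r. f \<in> K j" for f
    using that[rule_format, of 0] r by (simp add: K_def)
  then have "\<Inter>(K ` {..<r}) = J" unfolding set_eq_iff J by auto
  ultimately have J_ideal: "ideal J A" by simp
  interpret J: ideal J A by (rule J_ideal)
  have Q': "primeideal Q' (A Quot J)" using Q' unfolding J_def .
  define Q where "Q = {f \<in> carrier A. J +>\<^bsub>A\<^esub> f \<in> Q'}"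
  have "primeideal Q A" unfolding Q_def
    by (rule ring_hom_ring.primeideal_vimage[OF J.rcos_ring_hom_ring cring_A Q'])
  then interpret Q: primeideal Q A .
  have "J \<subseteq> Q"
  proof
    fix f assume f: "f \<in> J"
    have "J +>\<^bsub>A\<^esub> f = J" using f by (rule J.a_rcos_const)
    moreover have "\<zero>\<^bsub>A Quot J\<^esub> \<in> Q'"
      using Q' by (meson additive_subgroup.zero_closed ideal_def primeideal_def)
    moreover have "\<zero>\<^bsub>A Quot J\<^esub> = J" unfolding FactRing_def by (simp only: ring.simps)
    ultimately have "J +>\<^bsub>A\<^esub> f \<in> Q'" by (simp only:)
    then show "f \<in> Q" using J.Icarr[OF f] unfolding Q_def by blast
  qed
  have K_ideal: "ideal (K j) A" if "j < r" for j using prime_K[OF that] by (simp add: primeideal_def)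
  have "\<exists>j<r. K j \<subseteq> Q"
  proof (rule ccontr)
    assume "\<not> ?thesis"
    then have "\<not> K j \<subseteq> Q" if "j \<in> {..<r}" for j using that by blast
    then have "\<exists>f\<in>carrier A. f \<notin> Q \<and> (\<forall>j\<in>{..<r}. f \<in> K j)"
      using K_ideal by (intro A.exists_in_ideals_avoiding_prime[OF Q.primeideal]) blast+
    then show False using J \<open>J \<subseteq> Q\<close> by blast
  qed
  then obtain j where j: "j < r" "K j \<subseteq> Q" by blast
  have others: "\<not> K i \<subseteq> Q" if "i < r" "i \<noteq> j" for i
    using disjoint_branches[OF that(1) j(1) Q.primeideal _ j(2)] that(2) by blast
  have "\<exists>u\<in>carrier A. u \<notin> Q \<and> (\<forall>i\<in>{..<r} - {j}. u \<in> K i)"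
    using K_ideal others by (intro A.exists_in_ideals_avoiding_prime[OF Q.primeideal]) blast+
  then obtain u where u: "u \<in> carrier A" "u \<notin> Q" "\<forall>i\<in>{..<r} - {j}. u \<in> K i" by blast
  have killed: "\<exists>u\<in>carrier A - Q. u \<otimes>\<^bsub>A\<^esub> f \<in> J" if f: "f \<in> carrier A" "H j f = 0" for f
  proof -
    have "u \<otimes>\<^bsub>A\<^esub> f \<in> K i" if "i < r" for i
    proof (cases "i = j")
      case True
      then show ?thesis using f u j by (simp add: K_def H_simps)
    next
      case False
      then show ?thesis using ideal.I_r_closed[OF K_ideal[OF that] _ f(1)] u that by blast
    qed
    then show ?thesis using u f by (auto simp: J)
  qed
  have J_H: "H j f = 0" if "f \<in> J" for f
  proof -
    have "f \<in> K j" using that J j(1) by blast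
    then show ?thesis by (simp add: K_def)
  qed
  have one: "\<one>\<^bsub>A\<^esub> \<in> carrier A - Q" using Q.one_imp_carrier Q.I_notcarr by blast
  have "regular_local_ring (localization (A Quot J) Q')"
  proof (cases "Q = K j")
    case True
    note QK = True
    have "\<exists>h. h \<in> ring_iso (ring_of_type_algebra :: 'k fls ring) (localization (A Quot J) Q') \<and>
        h 0 = \<zero>\<^bsub>localization (A Quot J) Q'\<^esub>"
    proof (rule localization_quotient_iso[OF cring_A J_ideal Q' Q_def H_hom[OF j(1)] _ _ _ killed])
      show "H j f = 0" if "f \<in> J" for f by (rule J_H[OF that])
      show "H j s dvd 1" if s: "s \<in> carrier A - Q" for s
      proof -
        have "H j s \<noteq> 0" using s unfolding True K_def by blast
        then show ?thesis by (simp add: dvd_field_iff)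
      qed
      show "\<exists>a\<in>carrier A. \<exists>s\<in>carrier A - Q. e * H j s = H j a" for e
      proof (cases "e = 0")
        case True
        then show ?thesis using one H_simps(4)[OF j(1)] A.zero_closed by (metis mult_zero_left)
      next
        case False
        define N where "N = nat (- fls_subdegree e)"
        define y where "y = fps_to_fls (fps_X ^ N :: 'k fps)"
        have y: "y \<noteq> 0" "fls_subdegree y = int N"
          unfolding y_def by (simp_all add: fls_subdegree_fls_to_fps)
        obtain s where s: "s \<in> carrier A" "H j s = y" unfolding y_def using H_onto_fps[OF j(1)] by blast
        have "0 \<le> fls_subdegree (e * y)" using False y by (simp add: N_def)
        then obtain g where "e * y = fps_to_fls g" using fls_nonneg_fps by blast
        then obtain a where "a \<in> carrier A" "H j a = e * y" using H_onto_fps[OF j(1), of g] by auto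
        moreover have "s \<notin> Q" using s(2) y(1) unfolding QK K_def by simp
        ultimately show ?thesis using s by (metis DiffI)
      qed
    qed
    then show ?thesis using regular_local_ring_iso_field by blast
  next
    case False
    then have inside: "real_vec (v j) \<in> \<sigma>" and QM: "Q = M j"
      using prime_over_K[OF j(1) Q.primeideal j(2)] by blast+
    define \<theta> where "\<theta> f = fls_regpart (H j f)" for f
    have \<theta>: "fps_to_fls (\<theta> f) = H j f" if "f \<in> carrier A" for f
      using H_fps_inside[OF j(1) inside that] unfolding \<theta>_def by auto
    have \<theta>_inj: "\<theta> f = g" if "f \<in> carrier A" "H j f = fps_to_fls g" for f g
      using \<theta>[OF that(1)] that(2) by simp
    have "\<exists>h. h \<in> ring_iso (ring_of_type_algebra :: 'k fps ring) (localization (A Quot J) Q') \<and>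
        h 0 = \<zero>\<^bsub>localization (A Quot J) Q'\<^esub>"
    proof (rule localization_quotient_iso[OF cring_A J_ideal Q' Q_def, of \<theta>])
      show "\<theta> \<in> ring_hom A ring_of_type_algebra"
        using j(1) \<theta> by (intro ring_hom_memI)
          (auto intro!: \<theta>_inj simp: H_simps fls_times_fps_to_fls)
      show "\<theta> f = 0" if "f \<in> J" for f using J_H[OF that] by (simp add: \<theta>_def)
      show "\<theta> s dvd 1" if s: "s \<in> carrier A - Q" for s
      proof -
        have nz: "H j s \<noteq> 0" "\<not> 0 < fls_subdegree (H j s)" using s unfolding QM M_def by blast+
        have e: "fps_to_fls (\<theta> s) = H j s" using \<theta> s by blast
        then have "\<theta> s \<noteq> 0" using nz(1) by (metis fps_zero_to_fls)
        moreover have "subdegree (\<theta> s) = 0"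
          using nz(2) fls_subdegree_fls_to_fps[of "\<theta> s"] unfolding e by simp
        ultimately have "fps_nth (\<theta> s) 0 \<noteq> 0" by (metis nth_subdegree_nonzero)
        then show ?thesis by simp
      qed
      show "\<exists>a\<in>carrier A. \<exists>s\<in>carrier A - Q. e * \<theta> s = \<theta> a" for e
      proof -
        obtain a where a: "a \<in> carrier A" "H j a = fps_to_fls e" using H_onto_fps[OF j(1)] by blast
        have "\<theta> \<one>\<^bsub>A\<^esub> = 1" using H_simps(3)[OF j(1)] by (simp add: \<theta>_def)
        moreover have "\<theta> a = e" using a by (rule \<theta>_inj)
        ultimately show ?thesis using a one by (intro bexI[of _ a] bexI[of _ "\<one>\<^bsub>A\<^esub>"]) auto
      qed
      show "\<exists>u\<in>carrier A - Q. u \<otimes>\<^bsub>A\<^esub> a \<in> J" if "a \<in> carrier A" "\<theta> a = 0" for a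
        using killed[OF that(1)] \<theta>[OF that(1)] that(2) by simp
    qed
    then show ?thesis using regular_local_ring_iso_fps by blast
  qed
  then show ?thesis unfolding J_def .
qed

end

context curve_chart
begin

section \<open>The strict transform is transversal to the orbits\<close>

lemma base_field_algebra: "submonoid_algebra (base_field :: 'k ring) (dual_monoid m \<sigma>)"
proof -
  interpret k: cring "base_field :: 'k ring" by (rule cring_from_type_algebra)
  show ?thesis by unfold_locales (auto intro: dual_monoid_closed)
qed

text \<open>The point \<open>p\<close> is the value at \<open>t = 0\<close> of functions on the branch \<open>j\<close>, and the linear coefficient in \<open>t\<close> is
  a tangent vector of the strict transform. The character \<open>u0\<close> dual to \<open>v j\<close> has order one along the branch,
  so a multiple of this tangent vector can be subtracted from any derivation \<open>\<delta>\<close> to make it vanish on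
  \<open>u0\<close>. As \<open>u0\<close> divides every character that vanishes at \<open>p\<close>, the difference is tangent to the orbit.\<close>

theorem transversal_strict_transform:
  assumes j: "j < r" and p: "p \<in> kalg_hom A (\<lambda>c. alg_const R (\<iota> c)) base_field id"
    and Kp: "K j \<subseteq> a_kernel A base_field p"
    and orbit: "in_orbit m R \<sigma> \<tau> (a_kernel A base_field p)"
  shows "transversal_at m R \<iota> \<sigma> (coordinate_cone m {}) \<tau> (K j) p"
proof -
  have p_hom: "p \<in> ring_hom A base_field" and p_const: "\<And>c. p (alg_const R (\<iota> c)) = c"
    using p by (auto simp: kalg_hom_def)
  have p_simps: "\<And>f g. f \<in> carrier A \<Longrightarrow> g \<in> carrier A \<Longrightarrow> p (f \<otimes>\<^bsub>A\<^esub> g) = p f * p g"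
    "\<And>f g. f \<in> carrier A \<Longrightarrow> g \<in> carrier A \<Longrightarrow> p (f \<oplus>\<^bsub>A\<^esub> g) = p f + p g" "p \<one>\<^bsub>A\<^esub> = 1"
    using ring_hom_mult[OF p_hom] ring_hom_add[OF p_hom] ring_hom_one[OF p_hom] by auto
  have ker: "f \<in> a_kernel A base_field p \<longleftrightarrow> f \<in> carrier A \<and> p f = 0" for f
    by (simp add: a_kernel_def')
  have \<iota>c: "\<iota> c \<in> carrier R" for c using ring_hom_closed[OF \<iota>, of c] by simp
  have \<iota>_simps: "\<iota> 1 = \<one>" using ring_hom_one[OF \<iota>] by simp
  have \<iota>_add: "\<iota> (a + b) = \<iota> a \<oplus> \<iota> b" for a b using ring_hom_add[OF \<iota>, of a b] by simp
  have \<iota>_0: "\<iota> 0 = \<zero>"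
    using \<iota>_add[of 0 0] \<iota>c[of 0] by (metis add.r_cancel_one' add_0)
  \<comment> \<open>The point factors through the parametrization of the branch.\<close>
  have factor: "p f = p g" if "f \<in> carrier A" "g \<in> carrier A" "H j f = H j g" for f g
  proof -
    have "f \<ominus>\<^bsub>A\<^esub> g \<in> K j" using H_minus[OF j that(1,2)] that by (simp add: K_def)
    then have "p (f \<ominus>\<^bsub>A\<^esub> g) = 0" using Kp ker by blast
    moreover have "(f \<ominus>\<^bsub>A\<^esub> g) \<oplus>\<^bsub>A\<^esub> g = f" using that(1,2) by algebra
    then have "p f = p (f \<ominus>\<^bsub>A\<^esub> g) + p g" using p_simps(2)[of "f \<ominus>\<^bsub>A\<^esub> g" g] that by simp
    ultimately show ?thesis by simp
  qed
  obtain s where s: "s \<in> carrier A" "H j s = fps_to_fls fps_X" using H_onto_fps[OF j] by blast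
  have not_inv: False if c: "p s = c" and g: "g \<in> carrier A" "H j g * fps_to_fls (fps_X + fps_const (- c)) = 1" for g c
  proof -
    let ?s = "s \<oplus>\<^bsub>A\<^esub> alg_const R (\<iota> (- c))"
    have sc: "?s \<in> carrier A" using s \<iota>c by simp
    have "H j ?s = fps_to_fls (fps_X + fps_const (- c))"
      using s \<iota>c j h_const[OF j] by (simp add: H_simps H_const fps_to_fls_plus del: fps_const_neg)
    then have "H j (g \<otimes>\<^bsub>A\<^esub> ?s) = H j \<one>\<^bsub>A\<^esub>" using g sc j by (simp add: H_simps)
    then have "p (g \<otimes>\<^bsub>A\<^esub> ?s) = p \<one>\<^bsub>A\<^esub>" using g sc by (intro factor) auto
    then have "p g * p ?s = 1" using p_simps g sc by simp
    moreover have "p ?s = 0" using p_simps(2) s \<iota>c p_const c by simp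
    ultimately show False by simp
  qed
  have inside: "real_vec (v j) \<in> \<sigma>"
  proof (rule ccontr)
    assume out: "real_vec (v j) \<notin> \<sigma>"
    define y where "y = fps_to_fls (fps_X + fps_const (- p s))"
    have "fps_nth (fps_X + fps_const (- p s)) 1 = 1" by simp
    then have "fps_X + fps_const (- p s) \<noteq> 0" by (metis fps_zero_nth zero_neq_one)
    then have "y \<noteq> 0" unfolding y_def by (simp only: fps_to_fls_eq_0_iff not_False_eq_True)
    moreover obtain g where "g \<in> carrier A" "H j g = 1 / y" using H_onto_outside[OF j out] by blast
    ultimately show False using not_inv[OF refl, of g] by (simp add: y_def)
  qed
  have ps: "p s = 0"
  proof (rule ccontr)
    assume nz: "p s \<noteq> 0"
    let ?y = "fps_X + fps_const (- p s)"
    have "inverse ?y * ?y = 1" by (rule inverse_mult_eq_1) (use nz in simp)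
    moreover obtain g where g: "g \<in> carrier A" "H j g = fps_to_fls (inverse ?y)" using H_onto_fps[OF j] by blast
    ultimately have "H j g * fps_to_fls ?y = 1"
      by (metis fls_times_fps_to_fls fps_to_fls_eq_1_iff)
    then show False using not_inv[OF refl g(1)] by blast
  qed
  define \<theta> where "\<theta> f = fls_regpart (H j f)" for f
  have \<theta>: "fps_to_fls (\<theta> f) = H j f" if "f \<in> carrier A" for f
    using H_fps_inside[OF j inside that] unfolding \<theta>_def by auto
  have \<theta>_inj: "\<theta> f = g" if "H j f = fps_to_fls g" for f g
    using that by (simp add: \<theta>_def)
  have \<theta>_mult: "\<theta> (f \<otimes>\<^bsub>A\<^esub> g) = \<theta> f * \<theta> g" if "f \<in> carrier A" "g \<in> carrier A" for f g
    using that j by (intro \<theta>_inj) (simp add: H_simps fls_times_fps_to_fls \<theta>)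
  have \<theta>_add: "\<theta> (f \<oplus>\<^bsub>A\<^esub> g) = \<theta> f + \<theta> g" if "f \<in> carrier A" "g \<in> carrier A" for f g
    using that j by (intro \<theta>_inj) (simp add: H_simps fps_to_fls_plus \<theta>)
  have \<theta>_const: "\<theta> (alg_const R (\<iota> c)) = fps_const c" for c
    by (intro \<theta>_inj) (simp add: H_const[OF j] h_const[OF j])
  have p_eval: "p f = fps_nth (\<theta> f) 0" if f: "f \<in> carrier A" for f
  proof -
    let ?c = "fps_nth (\<theta> f) 0"
    have "\<theta> f = fps_const ?c + fps_X * fps_shift 1 (\<theta> f)"
      by (rule fps_ext) (auto simp: fps_X_mult_nth)
    moreover obtain g where g: "g \<in> carrier A" "H j g = fps_to_fls (fps_shift 1 (\<theta> f))"
      using H_onto_fps[OF j] by blast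
    have "H j (alg_const R (\<iota> ?c) \<oplus>\<^bsub>A\<^esub> s \<otimes>\<^bsub>A\<^esub> g) =
        fps_to_fls (fps_const ?c + fps_X * fps_shift 1 (\<theta> f))"
      using j s g \<iota>c h_const[OF j]
      by (simp add: H_simps H_const fls_times_fps_to_fls fps_to_fls_plus)
    ultimately have "H j f = H j (alg_const R (\<iota> ?c) \<oplus>\<^bsub>A\<^esub> s \<otimes>\<^bsub>A\<^esub> g)"
      using \<theta>[OF f] by metis
    then have "p f = p (alg_const R (\<iota> ?c) \<oplus>\<^bsub>A\<^esub> s \<otimes>\<^bsub>A\<^esub> g)"
      using f s g \<iota>c by (intro factor) auto
    also have "\<dots> = ?c" using s g \<iota>c p_const ps by (simp add: p_simps)
    finally show ?thesis .
  qed
  define u0 where "u0 = D (v j)"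
  have vG: "v j \<in> G" by (rule v_generator[OF j inside])
  have u0: "u0 \<in> dual_monoid m \<sigma>" unfolding u0_def by (rule D_generator[OF vG])
  have u0_dual: "int_pairing m u0 g = (if g = v j then 1 else 0)" if "g \<in> G" for g
    unfolding u0_def using D_dual[OF subsetD[OF GB vG] subsetD[OF GB that]] .
  have order: "int (subdegree (\<theta> (character R \<one> u))) = int_pairing m u (v j)" "\<theta> (character R \<one> u) \<noteq> 0"
    if "u \<in> dual_monoid m \<sigma>" for u
  proof -
    have e: "fps_to_fls (\<theta> (character R \<one> u)) = Z j u" using \<theta> that by (simp add: H_char[OF j])
    then show "int (subdegree (\<theta> (character R \<one> u))) = int_pairing m u (v j)"
      using subdegree_Z[OF j] by (metis fls_subdegree_fls_to_fps)
    show "\<theta> (character R \<one> u) \<noteq> 0" using e Z_nz[OF j] by (metis fps_zero_to_fls)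
  qed
  have p_char: "p (character R \<one> u) = 0 \<longleftrightarrow> 0 < int_pairing m u (v j)" if u: "u \<in> dual_monoid m \<sigma>" for u
  proof -
    have "fps_nth (\<theta> (character R \<one> u)) 0 = 0 \<longleftrightarrow> 0 < subdegree (\<theta> (character R \<one> u))"
      using order(2)[OF u] by (metis gr0I nth_less_subdegree_zero nth_subdegree_nonzero)
    moreover have "0 < subdegree (\<theta> (character R \<one> u)) \<longleftrightarrow> 0 < int_pairing m u (v j)"
      using order(1)[OF u] by linarith
    moreover have "p (character R \<one> u) = fps_nth (\<theta> (character R \<one> u)) 0"
      by (rule p_eval) (use u in simp)
    ultimately show ?thesis by (simp only:)
  qed
  have off_orbit: "p (character R \<one> u) = 0" if "u \<in> dual_monoid m \<sigma>" "u \<notin> perp m \<tau>" for u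
  proof -
    have "character R \<one> u \<in> a_kernel A base_field p" using orbit that unfolding in_orbit_def by blast
    then show ?thesis using ker by blast
  qed
  \<comment> \<open>\<open>A0\<close> is the coordinate ring of the toric chart, included by \<open>e\<close> in its extension to the curve.\<close>
  define A0 where "A0 = chart_ring m (base_field :: 'k ring) \<sigma>"
  interpret k: submonoid_algebra "base_field :: 'k ring" "dual_monoid m \<sigma>" by (rule base_field_algebra)
  interpret A0: cring A0 unfolding A0_def by (rule k.cring_A)
  define e where "e = (\<lambda>(f :: (nat \<Rightarrow> int) \<Rightarrow> 'k) u. \<iota> (f u))"
  have e_hom: "e \<in> ring_hom A0 A" unfolding e_def A0_def
    by (rule coefficient_extension_hom[OF base_field_algebra _ \<iota>]) unfold_locales
  have e_closed: "e f \<in> carrier A" if "f \<in> carrier A0" for f using ring_hom_closed[OF e_hom that] .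
  have e_simps: "\<And>f g. f \<in> carrier A0 \<Longrightarrow> g \<in> carrier A0 \<Longrightarrow> e (f \<otimes>\<^bsub>A0\<^esub> g) = e f \<otimes>\<^bsub>A\<^esub> e g"
    "\<And>f g. f \<in> carrier A0 \<Longrightarrow> g \<in> carrier A0 \<Longrightarrow> e (f \<oplus>\<^bsub>A0\<^esub> g) = e f \<oplus>\<^bsub>A\<^esub> e g"
    using ring_hom_mult[OF e_hom] ring_hom_add[OF e_hom] by auto
  have e_char: "e (character base_field c u) = character R (\<iota> c) u" for c u
    unfolding e_def character_def using \<iota>_0 by auto
  have e_const: "e (alg_const base_field c) = alg_const R (\<iota> c)" for c
    unfolding alg_const_def by (rule e_char)
  define q where "q = (\<lambda>f. p (e f))"
  define Der where "Der \<delta> \<longleftrightarrow> \<delta> \<in> extensional (carrier A0) \<and>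
     (\<forall>f\<in>carrier A0. \<forall>g\<in>carrier A0. \<delta> (f \<oplus>\<^bsub>A0\<^esub> g) = \<delta> f + \<delta> g) \<and>
     (\<forall>f\<in>carrier A0. \<forall>g\<in>carrier A0. \<delta> (f \<otimes>\<^bsub>A0\<^esub> g) = q f * \<delta> g + q g * \<delta> f) \<and>
     (\<forall>c. \<delta> (alg_const base_field c) = 0)" for \<delta> :: "((nat \<Rightarrow> int) \<Rightarrow> 'k) \<Rightarrow> 'k"
  define TS where "TS I = tangent_space A0 (alg_const base_field) I q" for I
  have TS: "\<delta> \<in> TS I \<longleftrightarrow> Der \<delta> \<and> (\<forall>f\<in>I. \<delta> f = 0)" for \<delta> I
    unfolding TS_def tangent_space_def Der_def by auto
  define O\<tau> where "O\<tau> = (orbit_closure_ideal m \<sigma> \<tau> :: ((nat \<Rightarrow> int) \<Rightarrow> 'k) set)"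
  define O0 where "O0 = (orbit_closure_ideal m \<sigma> (coordinate_cone m {}) :: ((nat \<Rightarrow> int) \<Rightarrow> 'k) set)"
  have Der_0: "\<delta> \<zero>\<^bsub>A0\<^esub> = 0" if "Der \<delta>" for \<delta>
  proof -
    have "\<delta> (\<zero>\<^bsub>A0\<^esub> \<oplus>\<^bsub>A0\<^esub> \<zero>\<^bsub>A0\<^esub>) = \<delta> \<zero>\<^bsub>A0\<^esub> + \<delta> \<zero>\<^bsub>A0\<^esub>"
      using that A0.zero_closed unfolding Der_def by blast
    then show ?thesis by (simp only: A0.l_zero A0.zero_closed add_cancel_right_right)
  qed
  have O0: "O0 \<subseteq> {\<zero>\<^bsub>A0\<^esub>}"
  proof -
    have "x = 0" if "x \<in> coordinate_cone m {}" for x using that unfolding coordinate_cone_def by auto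
    then have "coordinate_cone m {} \<subseteq> {0}" by blast
    moreover have "pairing m u 0 = 0" for u by (simp add: pairing_def)
    ultimately have "pairing m u x = 0" if "x \<in> coordinate_cone m {}" for u x
      using that by blast
    then have "u \<in> perp m (coordinate_cone m {})" if "u \<in> dual_monoid m \<sigma>" for u
      using that unfolding perp_def dual_monoid_def by blast
    then have "{character base_field 1 u | u. u \<in> dual_monoid m \<sigma> \<and> u \<notin> perp m (coordinate_cone m {})} = ({} :: ((nat \<Rightarrow> int) \<Rightarrow> 'k) set)"
      by blast
    then show ?thesis unfolding O0_def orbit_closure_ideal_def A0_def[symmetric]
      by (simp only: A0.genideal_minimal[OF A0.zeroideal empty_subsetI])
  qed
  have TS_O0: "\<delta> \<in> TS O0 \<longleftrightarrow> Der \<delta>" for \<delta>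
    unfolding TS using O0 Der_0 by blast
  define TC where "TC = (\<lambda>\<delta>. \<lambda>f\<in>carrier A0. \<delta> (e f)) ` tangent_space A (\<lambda>c. alg_const R (\<iota> c)) (K j) p"
  have Der_TC: "Der \<delta>" if "\<delta> \<in> TC" for \<delta>
  proof -
    obtain \<epsilon> where \<epsilon>: "\<epsilon> \<in> tangent_space A (\<lambda>c. alg_const R (\<iota> c)) (K j) p"
      "\<delta> = (\<lambda>f\<in>carrier A0. \<epsilon> (e f))" using \<open>\<delta> \<in> TC\<close> unfolding TC_def by blast
    have kc: "alg_const base_field c \<in> carrier A0" for c :: 'k unfolding A0_def by simp
    show ?thesis using \<epsilon>(1) kc unfolding Der_def \<epsilon>(2) tangent_space_def q_def
      by (simp add: e_closed e_simps e_const)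
  qed
  have Der_add: "Der (\<lambda>f\<in>carrier A0. \<delta> f + a * \<epsilon> f)" if "Der \<delta>" "Der \<epsilon>" for \<delta> \<epsilon> and a :: 'k
    using that k.alg_const_closed unfolding Der_def A0_def[symmetric] by (simp add: algebra_simps)
  have "{\<lambda>f\<in>carrier A0. \<delta> f + \<epsilon> f | \<delta> \<epsilon>. \<delta> \<in> TC \<and> \<epsilon> \<in> TS O\<tau>} = TS O0"
  proof (intro equalityI subsetI)
    fix \<delta> assume "\<delta> \<in> {\<lambda>f\<in>carrier A0. \<delta> f + \<epsilon> f | \<delta> \<epsilon>. \<delta> \<in> TC \<and> \<epsilon> \<in> TS O\<tau>}"
    then obtain \<delta>' \<epsilon> where "\<delta> = (\<lambda>f\<in>carrier A0. \<delta>' f + 1 * \<epsilon> f)" "\<delta>' \<in> TC" "\<epsilon> \<in> TS O\<tau>" by auto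
    moreover from this have "Der \<delta>'" "Der \<epsilon>" using Der_TC TS by blast+
    ultimately have "Der \<delta>" using Der_add[of \<delta>' \<epsilon> 1] by simp
    then show "\<delta> \<in> TS O0" using TS_O0 by blast
  next
    fix \<delta> assume "\<delta> \<in> TS O0"
    then have \<delta>: "Der \<delta>" by (simp add: TS_O0)
    define \<chi> where "\<chi> u = (character base_field 1 u :: (nat \<Rightarrow> int) \<Rightarrow> 'k)" for u
    have \<chi>: "\<chi> u \<in> carrier A0" if "u \<in> dual_monoid m \<sigma>" for u using that unfolding \<chi>_def A0_def by simp
    have e\<chi>: "e (\<chi> u) = character R \<one> u" for u unfolding \<chi>_def e_char \<iota>_simps ..
    define a where "a = fps_nth (\<theta> (character R \<one> u0)) 1"
    have a: "a \<noteq> 0"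
    proof -
      have "subdegree (\<theta> (character R \<one> u0)) = 1" using order(1)[OF u0] u0_dual[OF vG] by simp
      then show ?thesis unfolding a_def using nth_subdegree_nonzero[OF order(2)[OF u0]] by simp
    qed
    define b where "b = \<delta> (\<chi> u0) / a"
    \<comment> \<open>The tangent vector of the branch at its closed point, scaled to agree with \<open>\<delta>\<close> on the
      uniformizing character.\<close>
    define \<epsilon>0 where "\<epsilon>0 = (\<lambda>f\<in>carrier A. b * fps_nth (\<theta> f) 1)"
    have "\<epsilon>0 \<in> tangent_space A (\<lambda>c. alg_const R (\<iota> c)) (K j) p"
      unfolding tangent_space_def
    proof (intro CollectI conjI ballI allI)
      show "\<epsilon>0 \<in> extensional (carrier A)" unfolding \<epsilon>0_def by simp
      show "\<epsilon>0 (f \<oplus>\<^bsub>A\<^esub> g) = \<epsilon>0 f + \<epsilon>0 g" if "f \<in> carrier A" "g \<in> carrier A" for f g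
        using that by (simp add: \<epsilon>0_def \<theta>_add algebra_simps)
      show "\<epsilon>0 (f \<otimes>\<^bsub>A\<^esub> g) = p f * \<epsilon>0 g + p g * \<epsilon>0 f" if "f \<in> carrier A" "g \<in> carrier A" for f g
        using that by (simp add: \<epsilon>0_def \<theta>_mult p_eval fps_mult_nth_1 algebra_simps)
      show "\<epsilon>0 (alg_const R (\<iota> c)) = 0" for c using \<iota>c by (simp add: \<epsilon>0_def \<theta>_const)
      show "\<epsilon>0 f = 0" if "f \<in> K j" for f using that by (simp add: \<epsilon>0_def \<theta>_def K_def)
    qed
    then have \<epsilon>0_TC: "(\<lambda>f\<in>carrier A0. \<epsilon>0 (e f)) \<in> TC" unfolding TC_def by blast
    define \<epsilon> where "\<epsilon> = (\<lambda>f\<in>carrier A0. \<delta> f + (- 1) * (\<lambda>f\<in>carrier A0. \<epsilon>0 (e f)) f)"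
    have \<epsilon>: "Der \<epsilon>" unfolding \<epsilon>_def by (rule Der_add[OF \<delta> Der_TC[OF \<epsilon>0_TC]])
    have "\<epsilon>0 (e (\<chi> u0)) = b * a" using u0 by (simp add: \<epsilon>0_def e\<chi> a_def)
    then have \<epsilon>_u0: "\<epsilon> (\<chi> u0) = 0"
      using \<chi>[OF u0] a by (simp add: \<epsilon>_def b_def)
    have q_u0: "q (\<chi> u0) = 0"
      unfolding q_def e\<chi> using p_char[OF u0] u0_dual[OF vG] by simp
    define N where "N = {f \<in> carrier A0. q f = 0 \<and> \<epsilon> f = 0}"
    have q_simps: "q (f \<oplus>\<^bsub>A0\<^esub> g) = q f + q g" "q (f \<otimes>\<^bsub>A0\<^esub> g) = q f * q g"
      if "f \<in> carrier A0" "g \<in> carrier A0" for f g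
      using that by (simp_all add: q_def e_simps e_closed p_simps)
    have \<epsilon>_simps: "\<epsilon> (f \<oplus>\<^bsub>A0\<^esub> g) = \<epsilon> f + \<epsilon> g" "\<epsilon> (f \<otimes>\<^bsub>A0\<^esub> g) = q f * \<epsilon> g + q g * \<epsilon> f"
      if "f \<in> carrier A0" "g \<in> carrier A0" for f g
      using \<epsilon> that unfolding Der_def by blast+
    have q0: "q \<zero>\<^bsub>A0\<^esub> = 0"
    proof -
      have "q (\<zero>\<^bsub>A0\<^esub> \<oplus>\<^bsub>A0\<^esub> \<zero>\<^bsub>A0\<^esub>) = q \<zero>\<^bsub>A0\<^esub> + q \<zero>\<^bsub>A0\<^esub>" by (rule q_simps(1)) auto
      then show ?thesis by (simp only: A0.l_zero A0.zero_closed add_cancel_right_right)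
    qed
    have N_ideal: "ideal N A0"
    proof (rule idealI)
      show "ring A0" by unfold_locales
      show "subgroup N (add_monoid A0)"
      proof (rule A0.add.subgroupI)
        show "N \<subseteq> carrier A0" unfolding N_def by blast
        have "\<zero>\<^bsub>A0\<^esub> \<in> N" using q0 Der_0[OF \<epsilon>] by (simp add: N_def)
        then show "N \<noteq> {}" by blast
        fix f assume f: "f \<in> N"
        then have fc: "f \<in> carrier A0" "\<ominus>\<^bsub>A0\<^esub> f \<in> carrier A0" by (auto simp: N_def)
        have "f \<oplus>\<^bsub>A0\<^esub> \<ominus>\<^bsub>A0\<^esub> f = \<zero>\<^bsub>A0\<^esub>" using fc by (simp add: A0.r_neg)
        then have "q f + q (\<ominus>\<^bsub>A0\<^esub> f) = 0" "\<epsilon> f + \<epsilon> (\<ominus>\<^bsub>A0\<^esub> f) = 0"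
          using q_simps(1)[OF fc] \<epsilon>_simps(1)[OF fc] q0 Der_0[OF \<epsilon>] by simp_all
        then show "\<ominus>\<^bsub>A0\<^esub> f \<in> N" using f fc by (simp add: N_def)
        fix g assume "g \<in> N"
        then show "f \<oplus>\<^bsub>A0\<^esub> g \<in> N" using f by (simp add: N_def q_simps \<epsilon>_simps)
      qed
      fix f g assume "f \<in> N" "g \<in> carrier A0"
      then show "g \<otimes>\<^bsub>A0\<^esub> f \<in> N" "f \<otimes>\<^bsub>A0\<^esub> g \<in> N" by (simp_all add: N_def q_simps \<epsilon>_simps)
    qed
    have "\<chi> u \<in> N" if u: "u \<in> dual_monoid m \<sigma>" "u \<notin> perp m \<tau>" for u
    proof -
      have "0 < int_pairing m u (v j)" using off_orbit[OF u] p_char[OF u(1)] by blast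
      then have "u - u0 \<in> dual_monoid m \<sigma>"
        using u(1) u0 lattice_vectors_closed(3) u0_dual
        by (auto simp: dual_monoid_iff int_pairing_linear)
      then have w: "\<chi> (u - u0) \<in> carrier A0" by (rule \<chi>)
      have "\<chi> u0 \<otimes>\<^bsub>A0\<^esub> \<chi> (u - u0) = \<chi> (u0 + (u - u0))"
        unfolding \<chi>_def A0_def using u0 \<open>u - u0 \<in> dual_monoid m \<sigma>\<close> by (subst k.character_mult) auto
      moreover have "u0 + (u - u0) = u" by simp
      ultimately have "\<chi> u = \<chi> u0 \<otimes>\<^bsub>A0\<^esub> \<chi> (u - u0)" by simp
      moreover have "\<chi> u0 \<in> N" using \<chi>[OF u0] q_u0 \<epsilon>_u0 by (simp add: N_def)
      ultimately show ?thesis using ideal.I_r_closed[OF N_ideal _ w] by simp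
    qed
    then have "O\<tau> \<subseteq> N"
      unfolding O\<tau>_def orbit_closure_ideal_def A0_def[symmetric] \<chi>_def
      by (intro A0.genideal_minimal[OF N_ideal]) auto
    then have \<epsilon>_TS: "\<epsilon> \<in> TS O\<tau>" unfolding TS using \<epsilon> by (auto simp: N_def)
    have "\<delta> = (\<lambda>f\<in>carrier A0. (\<lambda>f\<in>carrier A0. \<epsilon>0 (e f)) f + \<epsilon> f)"
    proof (rule extensionalityI[of _ "carrier A0"])
      show "\<delta> \<in> extensional (carrier A0)" using \<delta> unfolding Der_def by blast
    qed (simp_all add: \<epsilon>_def)
    then show "\<delta> \<in> {\<lambda>f\<in>carrier A0. \<delta> f + \<epsilon> f | \<delta> \<epsilon>. \<delta> \<in> TC \<and> \<epsilon> \<in> TS O\<tau>}"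
      using \<epsilon>0_TC \<epsilon>_TS by blast
  qed
  then show ?thesis
    unfolding transversal_at_def Let_def TS_def TC_def A0_def q_def e_def O\<tau>_def O0_def .
qed

end

section \<open>The embedded resolution\<close>

context subdivided_curve
begin

lemma chart:
  fixes \<sigma> :: "(nat \<Rightarrow> real) set"
  assumes "\<sigma> \<in> \<Sigma>"
  shows "\<exists>B G D. curve_chart R \<iota> r m P h z v \<Sigma> \<sigma> B G D"
proof -
  have "regular_cone m \<sigma>" "\<sigma> \<subseteq> orthant m"
    using subdivision assms unfolding regular_subdivision_def by blast+
  then obtain B G D where "orthant_regular_cone m \<sigma> B G D" using regular_cone_dual_basis by blast
  then have "curve_chart R \<iota> r m P h z v \<Sigma> \<sigma> B G D"
    using subdivided_curve_axioms assms unfolding curve_chart_def curve_chart_axioms_def by blast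
  then show ?thesis by blast
qed

lemma z_nonzero: "j < r \<Longrightarrow> i < m \<Longrightarrow> z i \<notin> P j"
  using order_pos[of j i] h_kernel[of j] by auto

text \<open>The cone \<open>0\<close> is a face of the ray of any branch.\<close>

lemma zero_cone: "{0} \<in> \<Sigma>"
proof -
  have j: "0 < r" using r by simp
  let ?w = "\<lambda>_. 1 :: real"
  have v_nonneg: "0 \<le> v 0 i" for i by (simp add: v[OF j])
  obtain u where "u \<in> lattice_vectors m" "int_pairing m u (v 0) = 1" using primitive[OF j] by blast
  then have "m \<noteq> 0" by (intro notI) (simp add: int_pairing_def)
  then have pos: "0 < v 0 0" using order_pos[OF j, of 0] by (simp add: v[OF j])
  define S where "S = (\<Sum>i<m. real_of_int (v 0 i))"
  have "real_of_int (v 0 0) \<le> S" unfolding S_def using v_nonneg \<open>m \<noteq> 0\<close>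
    by (intro member_le_sum) auto
  then have S: "0 < S" using pos by linarith
  have pair: "pairing m ?w (\<lambda>i. c * real_of_int (v 0 i)) = c * S" for c
    unfolding pairing_def S_def by (simp add: sum_distrib_left)
  have cone: "cone_spanned {v 0} = {\<lambda>i. c * real_of_int (v 0 i) | c. 0 \<le> c}"
    unfolding cone_spanned_def
  proof (intro equalityI subsetI)
    fix x assume "x \<in> {\<lambda>i. c * real_of_int (v 0 i) | c. 0 \<le> c}"
    then obtain c where "0 \<le> c" "x = (\<lambda>i. c * real_of_int (v 0 i))" by blast
    then show "x \<in> {x. \<exists>c. (\<forall>v\<in>{v 0}. 0 \<le> c v) \<and> x = (\<lambda>i. \<Sum>v\<in>{v 0}. c v * real_of_int (v i))}"
      by (intro CollectI exI[of _ "\<lambda>_. c"]) simp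
  qed auto
  have "is_face m {0} (cone_spanned {v 0})"
    unfolding is_face_def
  proof (intro exI[of _ ?w] conjI)
    show "\<forall>x\<in>cone_spanned {v 0}. 0 \<le> pairing m ?w x" using S pair unfolding cone by auto
    show "{0} = {x \<in> cone_spanned {v 0}. pairing m ?w x = 0}"
    proof (intro equalityI subsetI)
      fix x :: "nat \<Rightarrow> real" assume "x \<in> {0}"
      then have x: "x = (\<lambda>i. 0 * real_of_int (v 0 i))" by auto
      have "x \<in> cone_spanned {v 0}" unfolding cone x by (intro CollectI exI[of _ 0]) simp
      moreover have "pairing m ?w x = 0" unfolding x pair by simp
      ultimately show "x \<in> {x \<in> cone_spanned {v 0}. pairing m ?w x = 0}" by blast
    next
      fix x assume "x \<in> {x \<in> cone_spanned {v 0}. pairing m ?w x = 0}"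
      then obtain c where "x = (\<lambda>i. c * real_of_int (v 0 i))" "c * S = 0" using pair unfolding cone by auto
      then show "x \<in> {0}" using S by (auto simp: fun_eq_iff)
    qed
  qed
  then show ?thesis using subdivision rays[OF j] unfolding regular_subdivision_def by blast
qed

text \<open>The generic point of the branch lies in the torus, the orbit of the cone \<open>0\<close>.\<close>

lemma not_in_discriminant:
  assumes j: "j < r"
  shows "\<not> contained_in_discriminant m R z \<Sigma> (P j)"
proof
  assume "contained_in_discriminant m R z \<Sigma> (P j)"
  then obtain \<tau> where \<tau>: "is_face m \<tau> (orthant m)" "\<tau> \<notin> \<Sigma>" "in_coordinate_orbit m z \<tau> (P j)"
    using prime[OF j] unfolding contained_in_discriminant_def orthant_fan_def by blast
  obtain w where w: "\<And>x. x \<in> orthant m \<Longrightarrow> 0 \<le> pairing m w x"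
    "\<tau> = {x \<in> orthant m. pairing m w x = 0}" using \<tau>(1) unfolding is_face_def by blast
  have w_pos: "0 < w i" if i: "i < m" for i
  proof -
    have "real_vec (unit_vec i) \<notin> \<tau>" using \<tau>(3) z_nonzero[OF j] i unfolding in_coordinate_orbit_def by blast
    moreover have "real_vec (unit_vec i) \<in> orthant m" using i by (auto simp: orthant_def real_vec_def unit_vec_def)
    moreover have "pairing m w (real_vec (unit_vec i)) = w i" using i
      by (simp add: pairing_def real_vec_def unit_vec_def if_distrib cong: if_cong)
    ultimately show ?thesis using w by (metis (mono_tags, lifting) mem_Collect_eq order_le_less)
  qed
  have "x = 0" if x: "x \<in> \<tau>" for x
  proof
    have x': "(\<Sum>l<m. w l * x l) = 0" "\<And>l. 0 \<le> x l" "\<And>l. m \<le> l \<Longrightarrow> x l = 0"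
      using x w(2) by (auto simp: pairing_def orthant_def)
    then have "\<forall>l<m. w l * x l = 0" using w_pos by (subst (asm) sum_nonneg_eq_0_iff) (auto simp: less_imp_le)
    then show "x i = 0 i" for i using w_pos[of i] x'(3)[of i] by (cases "i < m") auto
  qed
  moreover have "0 \<in> \<tau>" unfolding w(2) by (simp add: orthant_def pairing_def)
  ultimately have "\<tau> = {0}" by blast
  then show False using \<tau>(2) zero_cone by simp
qed

lemma smooth: "smooth_strict_transform m R z \<Sigma>"
  unfolding smooth_strict_transform_def Let_def
proof (intro ballI allI impI)
  fix \<sigma> Q
  assume \<sigma>: "\<sigma> \<in> \<Sigma>" and Q: "primeideal Q (chart_ring m R \<sigma> Quot strict_transform_ideal m R z \<Sigma> \<sigma> {\<zero>})"
  obtain B G D where "curve_chart R \<iota> r m P h z v \<Sigma> \<sigma> B G D" using chart[OF \<sigma>] by blast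
  then interpret curve_chart R \<iota> r m P h z v \<Sigma> \<sigma> B G D .
  show "regular_local_ring (localization (A Quot strict_transform_ideal m R z \<Sigma> \<sigma> {\<zero>}) Q)"
    by (rule regular_strict_transform[OF Q])
qed

lemma transversal:
  assumes j: "j < r"
  shows "transversal_branch m R \<iota> z \<Sigma> (P j)"
proof -
  have S: "{i. i < m \<and> z i \<in> P j} = {}" using z_nonzero[OF j] by blast
  show ?thesis
    unfolding transversal_branch_def Let_def S
  proof (intro ballI impI)
    fix \<sigma> \<tau> p
    assume \<sigma>: "\<sigma> \<in> \<Sigma>" and p: "p \<in> kalg_hom (chart_ring m R \<sigma>) (\<lambda>c. alg_const R (\<iota> c)) base_field id"
      and *: "strict_transform_ideal m R z \<Sigma> \<sigma> (P j) \<subseteq> a_kernel (chart_ring m R \<sigma>) base_field p \<and>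
          in_orbit m R \<sigma> \<tau> (a_kernel (chart_ring m R \<sigma>) base_field p)"
    obtain B G D where "curve_chart R \<iota> r m P h z v \<Sigma> \<sigma> B G D" using chart[OF \<sigma>] by blast
    then interpret curve_chart R \<iota> r m P h z v \<Sigma> \<sigma> B G D .
    show "transversal_at m R \<iota> \<sigma> (coordinate_cone m {}) \<tau> (strict_transform_ideal m R z \<Sigma> \<sigma> (P j)) p"
      using transversal_strict_transform[OF j p] * unfolding strict_transform_branch[OF j] by blast
  qed
qed

end

section \<open>Curves embedded in affine space\<close>

locale embedded_curve =
  fixes R :: "'b ring" and \<iota> :: "'k::alg_closed_field \<Rightarrow> 'b" and n r :: nat and x :: "nat \<Rightarrow> 'b"
    and \<phi> :: "(nat multiset \<Rightarrow> 'k) \<Rightarrow> 'b" and P :: "nat \<Rightarrow> 'b set"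
    and \<eta> :: "nat \<Rightarrow> (nat multiset \<Rightarrow> 'k) \<Rightarrow> 'k fps"
  assumes curve: "curve R \<iota>" and reduced: "reduced_ring R" and r: "r \<ge> 1"
    and branches: "bij_betw P {..<r} (minimal_primes R)"
    and embedding: "curve_embedding R \<iota> n x \<phi>"
    and normalization: "\<forall>j<r. normalization_map n (embedded_ideal n \<phi> (P j)) (\<eta> j)"
begin

sublocale R: cring R
  using curve unfolding curve_def local_ring_def by blast

abbreviation S where "S \<equiv> mps n :: (nat multiset \<Rightarrow> 'k) ring"

lemma \<phi>_hom: "\<phi> \<in> ring_hom S R" and \<phi>_const: "\<phi> (mps_const c) = \<iota> c"
  using embedding unfolding curve_embedding_def kalg_hom_def by auto

lemma \<phi>_closed: "f \<in> carrier S \<Longrightarrow> \<phi> f \<in> carrier R"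
  using ring_hom_closed[OF \<phi>_hom] .

lemma \<phi>_surj: "a \<in> carrier R \<Longrightarrow> \<exists>f\<in>carrier S. \<phi> f = a"
  using embedding unfolding curve_embedding_def by (metis imageE)

lemma \<phi>_simps:
  "f \<in> carrier S \<Longrightarrow> g \<in> carrier S \<Longrightarrow> \<phi> (f \<otimes>\<^bsub>S\<^esub> g) = \<phi> f \<otimes>\<^bsub>R\<^esub> \<phi> g"
  "f \<in> carrier S \<Longrightarrow> g \<in> carrier S \<Longrightarrow> \<phi> (f \<oplus>\<^bsub>S\<^esub> g) = \<phi> f \<oplus>\<^bsub>R\<^esub> \<phi> g"
  "\<phi> \<one>\<^bsub>S\<^esub> = \<one>\<^bsub>R\<^esub>"
  using ring_hom_mult[OF \<phi>_hom] ring_hom_add[OF \<phi>_hom] ring_hom_one[OF \<phi>_hom] by auto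

lemma \<eta>_hom: "j < r \<Longrightarrow> \<eta> j \<in> kalg_hom S mps_const ring_of_type_algebra fps_const"
  using normalization unfolding normalization_map_def by blast

lemma \<eta>_zero_iff: "j < r \<Longrightarrow> f \<in> carrier S \<Longrightarrow> \<eta> j f = 0 \<longleftrightarrow> \<phi> f \<in> P j"
proof -
  assume j: "j < r" and f: "f \<in> carrier S"
  have "{f \<in> carrier S. \<eta> j f = 0} = {f \<in> carrier S. \<phi> f \<in> P j}"
    using normalization j unfolding normalization_map_def embedded_ideal_def by blast
  then show ?thesis using f by blast
qed

lemmas \<eta>_simps = kalg_hom_simps[OF \<eta>_hom]

lemma P_minimal: "j < r \<Longrightarrow> P j \<in> minimal_primes R"
  using branches by (auto simp: bij_betw_def)

lemma P_prime: "j < r \<Longrightarrow> primeideal (P j) R" and P_ideal: "j < r \<Longrightarrow> ideal (P j) R"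
  using P_minimal unfolding minimal_primes_def primeideal_def by blast+

lemma incomparable: "i < r \<Longrightarrow> j < r \<Longrightarrow> P i \<subseteq> P j \<Longrightarrow> i = j"
proof -
  assume ij: "i < r" "j < r" "P i \<subseteq> P j"
  then have "P i = P j" using P_minimal[of j] P_prime[of i] unfolding minimal_primes_def by blast
  then show ?thesis using branches ij unfolding bij_betw_def inj_on_def by blast
qed

section \<open>Existence of the coordinate functions\<close>

lemma no_const_mult:
  "f \<in> carrier S \<Longrightarrow> g \<in> carrier S \<Longrightarrow> f {#} = 0 \<Longrightarrow> (f \<otimes>\<^bsub>S\<^esub> g) {#} = 0"
  by (simp add: mps_mult_const_term)

text \<open>The uniformizer \<open>t\<close> is a quotient of two functions. Multiplying both by the numerator moves
  them into the maximal ideal.\<close>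

lemma consecutive_orders:
  assumes j: "j < r"
  shows "\<exists>f\<in>carrier S. \<exists>g\<in>carrier S. f {#} = 0 \<and> g {#} = 0 \<and> \<eta> j f \<noteq> 0 \<and> \<eta> j g \<noteq> 0 \<and>
    subdegree (\<eta> j f) = Suc (subdegree (\<eta> j g))"
proof -
  have "\<exists>a\<in>(\<lambda>f. fps_to_fls (\<eta> j f)) ` carrier S. \<exists>b\<in>(\<lambda>f. fps_to_fls (\<eta> j f)) ` carrier S.
      b \<noteq> 0 \<and> fls_X = a / b"
    using normalization j unfolding normalization_map_def Let_def by blast
  then obtain f g where fg: "f \<in> carrier S" "g \<in> carrier S" "fps_to_fls (\<eta> j g) \<noteq> 0"
    "fls_X = fps_to_fls (\<eta> j f) / fps_to_fls (\<eta> j g)" by blast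
  have "fls_X * fps_to_fls (\<eta> j g) = fps_to_fls (\<eta> j f)"
    using fg(4) nonzero_eq_divide_eq[OF fg(3)] by metis
  then have "fps_to_fls (\<eta> j f) = fps_to_fls (fps_X * \<eta> j g)"
    by (simp add: fls_times_fps_to_fls)
  then have eq: "\<eta> j f = fps_X * \<eta> j g" by (simp only: fps_to_fls_eq_iff)
  have g0: "\<eta> j g \<noteq> 0" using fg(3) by simp
  then have f0: "\<eta> j f \<noteq> 0" unfolding eq by simp
  have sub: "subdegree (\<eta> j f) = Suc (subdegree (\<eta> j g))" unfolding eq using g0 by simp
  have "fps_nth (\<eta> j f) 0 = 0" unfolding eq by simp
  then have f_no_const: "f {#} = 0" using kalg_hom_unit[OF \<eta>_hom[OF j] fg(1)] by blast
  have "\<eta> j (f \<otimes>\<^bsub>S\<^esub> f) = \<eta> j f * \<eta> j f" "\<eta> j (f \<otimes>\<^bsub>S\<^esub> g) = \<eta> j f * \<eta> j g"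
    using fg \<eta>_simps(1)[OF j] by blast+
  then show ?thesis
    using fg f0 g0 sub f_no_const no_const_mult
    by (intro bexI[of _ "f \<otimes>\<^bsub>S\<^esub> f"] bexI[of _ "f \<otimes>\<^bsub>S\<^esub> g"]) auto
qed

text \<open>The prime ideals of the branches are incomparable.\<close>

lemma branch_isolating_function:
  assumes j: "j < r"
  shows "\<exists>f\<in>carrier S. f {#} = 0 \<and> \<eta> j f \<noteq> 0 \<and> (\<forall>i<r. i \<noteq> j \<longrightarrow> \<eta> i f = 0)"
proof -
  have "\<exists>a\<in>carrier R. a \<notin> P j \<and> (\<forall>i\<in>{..<r} - {j}. a \<in> P i)"
    using P_ideal incomparable j by (intro R.exists_in_ideals_avoiding_prime[OF P_prime]) auto
  then obtain a where a: "a \<in> carrier R" "a \<notin> P j" "\<And>i. i < r \<Longrightarrow> i \<noteq> j \<Longrightarrow> a \<in> P i" by auto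
  obtain f where f: "f \<in> carrier S" "\<phi> f = a" using \<phi>_surj[OF a(1)] by blast
  obtain g where g: "g \<in> carrier S" "g {#} = 0" "\<eta> j g \<noteq> 0" using consecutive_orders[OF j] by blast
  have \<eta>: "\<eta> i (g \<otimes>\<^bsub>S\<^esub> f) = \<eta> i g * \<eta> i f" if "i < r" for i using f g \<eta>_simps(1)[OF that] by blast
  have "\<eta> j f \<noteq> 0" "\<And>i. i < r \<Longrightarrow> i \<noteq> j \<Longrightarrow> \<eta> i f = 0" using a f j \<eta>_zero_iff by auto
  then show ?thesis using \<eta> f g j no_const_mult by (intro bexI[of _ "g \<otimes>\<^bsub>S\<^esub> f"]) auto
qed

lemma branch_avoiding_function:
  "\<exists>f\<in>carrier S. f {#} = 0 \<and> (\<forall>j<r. \<eta> j f \<noteq> 0)"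
proof -
  have "\<exists>f\<in>carrier S. f {#} = 0 \<and> (\<forall>j<l. \<eta> j f \<noteq> 0) \<and> (\<forall>j<r. l \<le> j \<longrightarrow> \<eta> j f = 0)" if "l \<le> r" for l
    using that
  proof (induction l)
    case 0
    have "\<zero>\<^bsub>S\<^esub> {#} = 0" by (simp add: zero_mps)
    then show ?case using \<eta>_simps(5) by (intro bexI[of _ "\<zero>\<^bsub>S\<^esub>"]) auto
  next
    case (Suc l)
    then obtain f where f: "f \<in> carrier S" "f {#} = 0" "\<forall>j<l. \<eta> j f \<noteq> 0" "\<forall>j<r. l \<le> j \<longrightarrow> \<eta> j f = 0"
      by auto
    obtain g where g: "g \<in> carrier S" "g {#} = 0" "\<eta> l g \<noteq> 0" "\<forall>i<r. i \<noteq> l \<longrightarrow> \<eta> i g = 0"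
      using branch_isolating_function[of l] Suc.prems by auto
    have \<eta>: "\<eta> j (f \<oplus>\<^bsub>S\<^esub> g) = \<eta> j f + \<eta> j g" if "j < r" for j using f g \<eta>_simps(2)[OF that] by blast
    have "\<eta> j (f \<oplus>\<^bsub>S\<^esub> g) \<noteq> 0" if "j < Suc l" for j
    proof (cases "j = l")
      case True
      then show ?thesis using \<eta>[of j] f(4) g(3) Suc.prems by simp
    next
      case False
      then show ?thesis using \<eta>[of j] f(3) g(4) that Suc.prems by simp
    qed
    moreover have "\<eta> j (f \<oplus>\<^bsub>S\<^esub> g) = 0" if "j < r" "Suc l \<le> j" for j using \<eta> f(4) g(4) that by simp
    moreover have "(f \<oplus>\<^bsub>S\<^esub> g) {#} = 0" using f g by (simp add: add_mps)
    ultimately show ?case using f g by (intro bexI[of _ "f \<oplus>\<^bsub>S\<^esub> g"]) auto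
  qed
  from this[of r] show ?thesis by auto
qed

text \<open>The function \<open>E\<close> vanishes on no branch. The functions \<open>f j\<close> and \<open>g j\<close> have consecutive orders along the
  branch \<open>j\<close>, so their orders generate the integers. The function \<open>e j\<close> vanishes on all branches but \<open>j\<close>,
  so that, after \<open>E\<^sup>N\<close> is added, its order is small along \<open>j\<close> and large along the other branches.\<close>

lemma torifying_functions_exist:
  "\<exists>m\<ge>1. \<exists>y. torifying_functions n r (\<lambda>j. embedded_ideal n \<phi> (P j)) \<eta> m y"
proof -
  obtain E where E: "E \<in> carrier S" "E {#} = 0" "\<And>j. j < r \<Longrightarrow> \<eta> j E \<noteq> 0"
    using branch_avoiding_function by blast
  have "\<forall>j. \<exists>f g e. j < r \<longrightarrow> {f, g, e} \<subseteq> carrier S \<and> f {#} = 0 \<and> g {#} = 0 \<and> e {#} = 0 \<and>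
      \<eta> j f \<noteq> 0 \<and> \<eta> j g \<noteq> 0 \<and> subdegree (\<eta> j f) = Suc (subdegree (\<eta> j g)) \<and>
      \<eta> j e \<noteq> 0 \<and> (\<forall>i<r. i \<noteq> j \<longrightarrow> \<eta> i e = 0)"
    using consecutive_orders branch_isolating_function by blast
  then obtain f g e where "\<forall>j. j < r \<longrightarrow> {f j, g j, e j} \<subseteq> carrier S \<and> f j {#} = 0 \<and> g j {#} = 0 \<and>
      e j {#} = 0 \<and> \<eta> j (f j) \<noteq> 0 \<and> \<eta> j (g j) \<noteq> 0 \<and>
      subdegree (\<eta> j (f j)) = Suc (subdegree (\<eta> j (g j))) \<and>
      \<eta> j (e j) \<noteq> 0 \<and> (\<forall>i<r. i \<noteq> j \<longrightarrow> \<eta> i (e j) = 0)"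
    by metis
  then have fge: "{f j, g j, e j} \<subseteq> carrier S" "f j {#} = 0" "g j {#} = 0" "e j {#} = 0"
    "\<eta> j (f j) \<noteq> 0" "\<eta> j (g j) \<noteq> 0" "subdegree (\<eta> j (f j)) = Suc (subdegree (\<eta> j (g j)))"
    "\<eta> j (e j) \<noteq> 0" "\<And>i. i < r \<Longrightarrow> i \<noteq> j \<Longrightarrow> \<eta> i (e j) = 0" if "j < r" for j
    using that by blast+
  define F where "F = mps_var ` {..<n} \<union> f ` {..<r} \<union> g ` {..<r} \<union> e ` {..<r}"
  have "mps_var i {#} = (0 :: 'k)" for i by (simp add: mps_var_def)
  then have F: "finite F" "F \<subseteq> carrier S" "\<And>a. a \<in> F \<Longrightarrow> a {#} = 0"
    unfolding F_def using fge by auto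
  have "finite ((\<lambda>(j, a). subdegree (\<eta> j a)) ` ({..<r} \<times> F))" using F(1) by blast
  then obtain N where "\<forall>d\<in>(\<lambda>(j, a). subdegree (\<eta> j a)) ` ({..<r} \<times> F). d < N"
    using finite_nat_set_iff_bounded by blast
  then have N: "subdegree (\<eta> j a) < N" if "j < r" "a \<in> F" for j a using that by auto
  \<comment> \<open>Adding a high power of \<open>E\<close> changes no finite order and makes the infinite ones finite.\<close>
  define q where "q a = a \<oplus>\<^bsub>S\<^esub> E [^]\<^bsub>S\<^esub> N" for a
  have E_pos: "0 < subdegree (\<eta> j E)" if "j < r" for j
    using kalg_hom_local[OF \<eta>_hom[OF that] E(1,2)] E(3)[OF that] by (metis gr0I nth_subdegree_nonzero)
  have EN: "E [^]\<^bsub>S\<^esub> N \<in> carrier S" using E by simp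
  have q_closed: "q a \<in> carrier S" if "a \<in> F" for a using that F EN by (auto simp: q_def)
  have \<eta>q: "\<eta> j (q a) = \<eta> j a + \<eta> j E ^ N" if "j < r" "a \<in> F" for j a
    using \<eta>_simps(2)[OF that(1) _ EN] kalg_hom_pow[OF \<eta>_hom[OF that(1)] E(1)] that F by (auto simp: q_def)
  have sub_EN: "N \<le> subdegree (\<eta> j E ^ N)" if "j < r" for j using E_pos[OF that] by simp
  have q_finite: "subdegree (\<eta> j (q a)) = subdegree (\<eta> j a)" "\<eta> j (q a) \<noteq> 0"
    if "j < r" "a \<in> F" "\<eta> j a \<noteq> 0" for j a
  proof -
    have lt: "subdegree (\<eta> j a) < subdegree (\<eta> j E ^ N)" using N sub_EN that by (meson less_le_trans)
    then show 1: "subdegree (\<eta> j (q a)) = subdegree (\<eta> j a)"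
      unfolding \<eta>q[OF that(1,2)] using that(3) by (intro subdegree_add_eq1)
    show "\<eta> j (q a) \<noteq> 0"
    proof
      assume "\<eta> j (q a) = 0"
      then have "\<eta> j E ^ N = - \<eta> j a" using \<eta>q[OF that(1,2)] by (simp add: eq_neg_iff_add_eq_0 add.commute)
      then show False using lt by (metis less_irrefl subdegree_uminus)
    qed
  qed
  have q_infinite: "N \<le> subdegree (\<eta> j (q a))" "\<eta> j (q a) \<noteq> 0"
    if "j < r" "a \<in> F" "\<eta> j a = 0" for j a
    using \<eta>q[OF that(1,2)] that(3) sub_EN[OF that(1)] E(3)[OF that(1)] by simp_all
  have q_nz: "\<eta> j (q a) \<noteq> 0" if "j < r" "a \<in> F" for j a using q_finite(2) q_infinite(2) that by blast
  have N0: "0 < N" using N[of 0 "e 0"] r by (auto simp: F_def)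
  have EN0: "(E [^]\<^bsub>S\<^esub> N) {#} = 0" using mps_pow_eq_0[where F = E and a = "{#}" and l = N, OF E(2)] N0 by simp
  obtain as where as: "set as = F" using finite_list[OF F(1)] by blast
  define ys where "ys = E # map q as"
  define m where "m = length ys"
  define y where "y i = ys ! i" for i
  have y_image: "y ` {..<m} = insert E (q ` F)"
  proof -
    have "y ` {..<m} = set ys" unfolding y_def m_def by (auto simp: set_conv_nth)
    then show ?thesis using as by (simp add: ys_def)
  qed
  have y_in: "y s \<in> insert E (q ` F)" if "s < m" for s using y_image that by blast
  have y_closed: "y ` {..<m} \<subseteq> carrier S" unfolding y_image using E(1) q_closed by auto
  have y0: "y s {#} = 0" if "s < m" for s
    using y_in[OF that] E(2) F(3) EN0 by (auto simp: q_def add_mps)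
  have y_nz: "\<eta> j (y s) \<noteq> 0" if "j < r" "s < m" for j s
    using y_in[OF that(2)] E(3)[OF that(1)] q_nz[OF that(1)] by auto
  have order: "ord_vector m (\<eta> j) y s = int (subdegree (\<eta> j (y s)))" if "s < m" for j s
    using that by (simp add: ord_vector_def)
  have attained: "int (subdegree (\<eta> j a)) \<in> ord_vector m (\<eta> j) y ` {..<m}"
    if "j < r" "a \<in> F" "\<eta> j a \<noteq> 0" for j a
  proof -
    have "q a \<in> y ` {..<m}" unfolding y_image using that by blast
    then obtain s where s: "s < m" "y s = q a" by (metis imageE lessThan_iff)
    then have "int (subdegree (\<eta> j a)) = ord_vector m (\<eta> j) y s"
      using order[OF s(1), of j] q_finite(1)[OF that] by simp
    then show ?thesis using s(1) by blast
  qed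
  have "torifying_functions n r (\<lambda>j. embedded_ideal n \<phi> (P j)) \<eta> m y"
    unfolding torifying_functions_def
  proof (intro conjI allI impI)
    show "y ` {..<m} \<subseteq> carrier S" by (rule y_closed)
    show "genideal S (y ` {..<m}) = max_ideal S"
    proof
      show "genideal S (y ` {..<m}) \<subseteq> max_ideal S"
        unfolding max_ideal_mps using y0 y_closed by (intro mps.genideal_minimal[OF ideal_mps_no_const]) auto
      interpret Y: ideal "genideal S (y ` {..<m})" S by (rule mps.genideal_ideal[OF y_closed])
      have sub: "y ` {..<m} \<subseteq> genideal S (y ` {..<m})" by (rule mps.genideal_self[OF y_closed])
      have "E \<in> genideal S (y ` {..<m})" using sub y_image by blast
      then have "E [^]\<^bsub>S\<^esub> N \<in> genideal S (y ` {..<m})"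
        using N0 E(1) by (cases N) (auto intro: Y.I_l_closed)
      moreover have "q (mps_var i) \<in> genideal S (y ` {..<m})" if "i < n" for i
        using sub y_image that unfolding F_def by blast
      moreover have "q (mps_var i) \<ominus>\<^bsub>S\<^esub> E [^]\<^bsub>S\<^esub> N = mps_var i" if "i < n" for i
        using a_minus_mps[OF q_closed EN, of "mps_var i"] that by (auto simp: F_def q_def add_mps)
      ultimately have "mps_var i \<in> genideal S (y ` {..<m})" if "i < n" for i
        using that Y.a_closed Y.a_inv_closed unfolding mps.minus_eq by metis
      then have "genideal S (mps_var ` {..<n}) \<subseteq> genideal S (y ` {..<m})"
        by (intro mps.genideal_minimal[OF Y.is_ideal]) auto
      then show "max_ideal S \<subseteq> genideal S (y ` {..<m})"
        unfolding max_ideal_mps using genideal_mps_vars by blast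
    qed
    fix j assume j: "j < r"
    show "y s \<notin> embedded_ideal n \<phi> (P j)" if "s < m" for s
      using y_nz[OF j that] \<eta>_zero_iff[OF j] by (auto simp: embedded_ideal_def)
    show "0 < ord_vector m (\<eta> j) y s" if "s < m" for s
    proof -
      have "y s \<in> carrier S" using y_closed that by blast
      then have "fps_nth (\<eta> j (y s)) 0 = 0" using kalg_hom_local[OF \<eta>_hom[OF j]] y0[OF that] by blast
      then show ?thesis using y_nz[OF j that] order[OF that] nth_subdegree_nonzero by (metis gr0I of_nat_0_less_iff)
    qed
    show "generate integer_group (ord_vector m (\<eta> j) y ` {..<m}) = carrier integer_group"
    proof -
      let ?V = "ord_vector m (\<eta> j) y ` {..<m}"
      let ?a = "int (subdegree (\<eta> j (g j)))"
      have "g j \<in> F" "f j \<in> F" using j unfolding F_def by auto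
      then have "?a \<in> ?V" "int (subdegree (\<eta> j (f j))) \<in> ?V"
        using attained[OF j] fge(5,6)[OF j] by blast+
      then have "?a \<in> ?V" "?a + 1 \<in> ?V" using fge(7)[OF j] by (simp_all add: add.commute)
      then have "(?a + 1) \<otimes>\<^bsub>integer_group\<^esub> (inv\<^bsub>integer_group\<^esub> ?a) \<in> generate integer_group ?V"
        by (intro generate.eng generate.incl generate.inv)
      then have one: "1 \<in> generate integer_group ?V" by simp
      have "z \<in> generate integer_group ?V" for z
      proof (induction z rule: int_induct[of _ 0])
        case base
        then show ?case using generate.one[of integer_group ?V] by simp
      next
        case (step1 i)
        then show ?case using generate.eng[OF step1(2) one] by simp
      next
        case (step2 i)
        have minus_one: "- 1 \<in> generate integer_group ?V"
          using group.generate_m_inv_closed[OF group_integer_group _ one] by simp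
        show ?case using generate.eng[OF step2(2) minus_one] by simp
      qed
      then show ?thesis by auto
    qed
    fix j' assume j': "j' < r" "j \<noteq> j'"
    have eF: "e j \<in> F" using j by (auto simp: F_def)
    have "q (e j) \<in> y ` {..<m}" unfolding y_image using eF by blast
    then obtain s where s: "s < m" "y s = q (e j)" by (metis imageE lessThan_iff)
    have "subdegree (\<eta> j (q (e j))) < N" using q_finite(1)[OF j eF] fge(8)[OF j] N[OF j eF] by simp
    moreover have "N \<le> subdegree (\<eta> j' (q (e j)))" using q_infinite(1)[OF j'(1) eF] fge(9)[OF j j'(1)] j'(2) by simp
    ultimately have "ord_vector m (\<eta> j) y s \<noteq> ord_vector m (\<eta> j') y s" using order[OF s(1)] s(2) by simp
    then show "ord_vector m (\<eta> j) y \<noteq> ord_vector m (\<eta> j') y" by metis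
  qed
  moreover have "1 \<le> m" by (simp add: m_def ys_def)
  ultimately show ?thesis by blast
qed

section \<open>Branches as maps from the ring of the curve\<close>

text \<open>The choice of the preimage \<open>f\<close> does not matter, because the kernel of \<open>\<phi>\<close> is contained in that of
  \<open>\<eta> j\<close>.\<close>

definition h :: "nat \<Rightarrow> 'b \<Rightarrow> 'k fps" where
  "h j a = \<eta> j (SOME f. f \<in> carrier S \<and> \<phi> f = a)"

lemma h_\<phi>:
  assumes j: "j < r" and f: "f \<in> carrier S"
  shows "h j (\<phi> f) = \<eta> j f"
proof -
  define g where "g = (SOME g. g \<in> carrier S \<and> \<phi> g = \<phi> f)"
  have g: "g \<in> carrier S" "\<phi> g = \<phi> f"
    unfolding g_def using someI_ex[of "\<lambda>g. g \<in> carrier S \<and> \<phi> g = \<phi> f"] f by blast+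
  have d: "(f \<ominus>\<^bsub>S\<^esub> g) \<oplus>\<^bsub>S\<^esub> g = f" "f \<ominus>\<^bsub>S\<^esub> g \<in> carrier S"
    using f g mps.a_assoc[of f n "\<ominus>\<^bsub>S\<^esub> g" g] by (simp_all add: mps.minus_eq mps.l_neg)
  then have "\<phi> (f \<ominus>\<^bsub>S\<^esub> g) \<oplus>\<^bsub>R\<^esub> \<phi> f = \<phi> f" using \<phi>_simps(2)[OF d(2) g(1)] g(2) by simp
  then have "\<phi> (f \<ominus>\<^bsub>S\<^esub> g) = \<zero>\<^bsub>R\<^esub>" using \<phi>_closed f d(2) by (metis R.add.r_cancel_one')
  moreover have "\<zero>\<^bsub>R\<^esub> \<in> P j" using P_ideal[OF j] by (meson additive_subgroup.zero_closed ideal_def)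
  ultimately have "\<eta> j (f \<ominus>\<^bsub>S\<^esub> g) = 0" using \<eta>_zero_iff[OF j d(2)] by simp
  then have "\<eta> j f = \<eta> j g" using \<eta>_simps(2)[OF j d(2) g(1)] d(1) by simp
  then show ?thesis unfolding h_def g_def by simp
qed

lemma h_hom: "j < r \<Longrightarrow> h j \<in> ring_hom R ring_of_type_algebra"
proof (rule ring_hom_memI)
  assume j: "j < r"
  fix a b assume "a \<in> carrier R" "b \<in> carrier R"
  then obtain f g where fg: "f \<in> carrier S" "g \<in> carrier S" "a = \<phi> f" "b = \<phi> g" using \<phi>_surj by metis
  show "h j (a \<otimes>\<^bsub>R\<^esub> b) = h j a \<otimes>\<^bsub>ring_of_type_algebra\<^esub> h j b"
    using fg j \<phi>_simps(1)[OF fg(1,2), symmetric] \<eta>_simps(1)[OF j fg(1,2)] by (simp add: h_\<phi>)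
  show "h j (a \<oplus>\<^bsub>R\<^esub> b) = h j a \<oplus>\<^bsub>ring_of_type_algebra\<^esub> h j b"
    using fg j \<phi>_simps(2)[OF fg(1,2), symmetric] \<eta>_simps(2)[OF j fg(1,2)] by (simp add: h_\<phi>)
next
  assume j: "j < r"
  show "h j \<one>\<^bsub>R\<^esub> = \<one>\<^bsub>ring_of_type_algebra\<^esub>"
    using h_\<phi>[OF j mps.one_closed] \<eta>_simps(4)[OF j] \<phi>_simps(3) by simp
qed simp

lemma h_kernel: "j < r \<Longrightarrow> P j = {a \<in> carrier R. h j a = 0}"
proof -
  assume j: "j < r"
  have "a \<in> P j \<longleftrightarrow> h j a = 0" if "a \<in> carrier R" for a
    using \<phi>_surj[OF that] h_\<phi>[OF j] \<eta>_zero_iff[OF j] by metis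
  moreover have "P j \<subseteq> carrier R" using ideal.Icarr[OF P_ideal[OF j]] by blast
  ultimately show ?thesis by blast
qed

lemma max_ideal_maximal: "maximalideal (max_ideal R) R"
  using curve theI'[of "\<lambda>M. maximalideal M R"]
  unfolding curve_def local_ring_def max_ideal_def by blast

lemma \<phi>_max_ideal: "f \<in> carrier S \<Longrightarrow> f {#} = 0 \<Longrightarrow> \<phi> f \<in> max_ideal R"
proof -
  assume f: "f \<in> carrier S" "f {#} = 0"
  interpret hom: ring_hom_ring S R \<phi>
    by unfold_locales (rule \<phi>_hom)
  have "ideal (max_ideal R) R" using max_ideal_maximal by (simp add: maximalideal_def)
  then have I: "ideal {f \<in> carrier S. \<phi> f \<in> max_ideal R} S" by (rule hom.ideal_vimage)
  have "\<phi> (mps_var i) \<in> max_ideal R" if "i < n" for i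
  proof -
    have "x ` {..<n} \<subseteq> carrier R" "genideal R (x ` {..<n}) = max_ideal R" "\<phi> (mps_var i) = x i"
      using embedding that unfolding curve_embedding_def by auto
    then show ?thesis using R.genideal_self[of "x ` {..<n}"] that by auto
  qed
  then have "genideal S (mps_var ` {..<n}) \<subseteq> {f \<in> carrier S. \<phi> f \<in> max_ideal R}"
    by (intro mps.genideal_minimal[OF I]) auto
  then show ?thesis using genideal_mps_vars[OF f] by blast
qed

text \<open>Elements outside the maximal ideal are units, being images of power series with nonzero constant
  term.\<close>

lemma prime_in_max_ideal:
  assumes q: "primeideal q R"
  shows "q \<subseteq> max_ideal R"
proof
  interpret q: primeideal q R by (rule q)
  fix a assume a: "a \<in> q"
  obtain f where f: "f \<in> carrier S" "\<phi> f = a" using \<phi>_surj[OF q.Icarr[OF a]] by blast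
  show "a \<in> max_ideal R"
  proof (cases "f {#} = 0")
    case True
    then show ?thesis using \<phi>_max_ideal f by blast
  next
    case False
    then obtain g where g: "g \<in> carrier S" "f \<otimes>\<^bsub>S\<^esub> g = \<one>\<^bsub>S\<^esub>" using mps_unit[OF f(1)] by blast
    then have "a \<otimes>\<^bsub>R\<^esub> \<phi> g = \<one>\<^bsub>R\<^esub>" using \<phi>_simps(1)[OF f(1) g(1)] \<phi>_simps(3) f(2) by simp
    then have "\<one>\<^bsub>R\<^esub> \<in> q" using q.I_r_closed[OF a \<phi>_closed[OF g(1)]] by simp
    then show ?thesis using q.one_imp_carrier q.I_notcarr by blast
  qed
qed

text \<open>A prime strictly between a minimal prime and the maximal ideal would give a chain of length two.\<close>

lemma prime_cases:
  assumes q: "primeideal q R"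
  shows "\<exists>j<r. P j \<subseteq> q \<and> (q = P j \<or> q = max_ideal R)"
proof -
  have minimal: "minimal_primes R = P ` {..<r}" using branches by (simp add: bij_betw_def)
  then have "finite (minimal_primes R)" by simp
  then have "\<exists>p\<in>minimal_primes R. p \<subseteq> q" by (rule R.prime_over_minimal_prime[OF reduced _ q])
  then obtain j where j: "j < r" "P j \<subseteq> q" unfolding minimal by blast
  have "q = P j \<or> q = max_ideal R"
  proof (rule ccontr)
    assume "\<not> ?thesis"
    then have chain: "P j \<subset> q" "q \<subset> max_ideal R" using j(2) prime_in_max_ideal[OF q] by auto
    define p where "p i = (if i = 0 then P j else if i = 1 then q else max_ideal R)" for i :: nat
    have "primeideal (max_ideal R) R" using R.maximalideal_prime[OF max_ideal_maximal] .
    then have "\<forall>i\<le>2. primeideal (p i) R" using q P_prime[OF j(1)] by (simp add: p_def)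
    moreover have "\<forall>i<2. p i \<subset> p (Suc i)" using chain by (auto simp: p_def less_Suc_eq numeral_2_eq_2)
    ultimately have "enat 2 \<le> krull_dim R" unfolding krull_dim_def by (intro Sup_upper) blast
    moreover have "krull_dim R = 1" using curve unfolding curve_def by blast
    ultimately show False by (simp add: one_enat_def)
  qed
  then show ?thesis using j by blast
qed

lemma toric_embedded_resolution:
  assumes m: "1 \<le> m" and y: "torifying_functions n r (\<lambda>j. embedded_ideal n \<phi> (P j)) \<eta> m y"
    and \<Sigma>: "regular_subdivision m \<Sigma>" "\<forall>j<r. cone_spanned {ord_vector m (\<eta> j) y} \<in> \<Sigma>"
  shows "toric_embedded_resolution R \<iota> m (\<phi> \<circ> mps_subst m n y) \<Sigma>"
proof -
  note y = y[unfolded torifying_functions_def]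
  have y_closed: "y ` {..<m} \<subseteq> carrier S" using y by blast
  have y_gen: "genideal S (y ` {..<m}) = max_ideal S" using y by blast
  have y_pos: "0 < ord_vector m (\<eta> j) y s" if "j < r" "s < m" for j s using y that by blast
  have y_group: "generate integer_group (ord_vector m (\<eta> j) y ` {..<m}) = UNIV" if "j < r" for j
    using y that by simp
  have y_distinct: "i = j" if "i < r" "j < r" "ord_vector m (\<eta> i) y = ord_vector m (\<eta> j) y" for i j
    using y that by blast
  have yc: "y s \<in> carrier S" if "s < m" for s using y_closed that by blast
  have "y s \<in> max_ideal S" if "s < m" for s
    using mps.genideal_self[OF y_closed] that unfolding y_gen by blast
  then have y0: "y s {#} = 0" if "s < m" for s using that unfolding max_ideal_mps by blast
  define z where "z i = (\<phi> \<circ> mps_subst m n y) (mps_var i)" for i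
  have z: "z i = \<phi> (y i)" if "i < m" for i
    using mps_subst_var[of m y n i] yc y0 that by (simp add: z_def)
  define v where "v j = ord_vector m (\<eta> j) y" for j
  have v: "v j = (\<lambda>i. if i < m then int (subdegree (h j (z i))) else 0)" if "j < r" for j
    unfolding v_def ord_vector_def using that by (auto simp: z h_\<phi> yc)
  interpret subdivided_curve R \<iota> r m P h z v \<Sigma>
  proof (intro subdivided_curve.intro parametrized_curve.intro parametrized_curve_axioms.intro
      subdivided_curve_axioms.intro)
    show "cring R" by (rule R.is_cring)
    show "\<iota> \<in> ring_hom base_field R" using curve unfolding curve_def by blast
    show "1 \<le> r" by (rule r)
    fix j assume j: "j < r"
    show "h j \<in> ring_hom R ring_of_type_algebra" by (rule h_hom[OF j])
    show "h j (\<iota> c) = fps_const c" for c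
      using h_\<phi>[OF j mps_const_closed] \<phi>_const \<eta>_simps(3)[OF j] by metis
    show "P j = {a \<in> carrier R. h j a = 0}" by (rule h_kernel[OF j])
    show "primeideal (P j) R" by (rule P_prime[OF j])
    show "v j = (\<lambda>i. if i < m then int (subdegree (h j (z i))) else 0)" by (rule v[OF j])
    show "0 < subdegree (h j (z i))" if "i < m" for i
      using y_pos[OF j that] v[OF j] that by (simp add: v_def)
    show "cone_spanned {v j} \<in> \<Sigma>" using \<Sigma>(2) j by (simp add: v_def)
    show "\<exists>u\<in>lattice_vectors m. int_pairing m u (v j) = 1"
    proof -
      define V where "V = (\<lambda>u. int_pairing m u (v j)) ` lattice_vectors m"
      have "subgroup V integer_group"
      proof (rule group.subgroupI[OF group_integer_group])
        show "V \<noteq> {}" using lattice_vectors_closed(1) unfolding V_def by blast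
        fix a assume "a \<in> V"
        then obtain u where u: "u \<in> lattice_vectors m" "a = int_pairing m u (v j)" unfolding V_def by blast
        have "- a = int_pairing m (- u) (v j)" unfolding u(2) by (simp only: int_pairing_linear)
        then show "inv\<^bsub>integer_group\<^esub> a \<in> V"
          using lattice_vectors_closed(4)[OF u(1)] unfolding V_def by simp
        fix b assume "b \<in> V"
        then obtain u' where u': "u' \<in> lattice_vectors m" "b = int_pairing m u' (v j)" unfolding V_def by blast
        have "a + b = int_pairing m (u + u') (v j)" unfolding u(2) u'(2) by (simp only: int_pairing_linear)
        then show "a \<otimes>\<^bsub>integer_group\<^esub> b \<in> V"
          using lattice_vectors_closed(2)[OF u(1) u'(1)] unfolding V_def by simp
      qed simp
      moreover have "v j ` {..<m} \<subseteq> V"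
      proof
        fix a assume "a \<in> v j ` {..<m}"
        then obtain i where i: "i < m" "a = v j i" by blast
        then have "a = int_pairing m (unit_vec i) (v j)" using int_pairing_unit_vec by simp
        then show "a \<in> V" using unit_vec_lattice[OF i(1)] unfolding V_def by blast
      qed
      ultimately have "generate integer_group (v j ` {..<m}) \<subseteq> V"
        by (rule group.generate_subgroup_incl[OF group_integer_group, rotated])
      then have "1 \<in> V" using y_group[OF j] unfolding v_def by blast
      then show ?thesis unfolding V_def by force
    qed
    show "\<exists>(e::nat) c. (\<forall>i. c i \<in> carrier R) \<and> g = (\<Sum>i<e. h j (c i) * s ^ i)"
      if s: "subdegree s = 1" for s g
    proof -
      have m0: "0 < m" using m by simp
      have "\<eta> j (y 0) \<noteq> 0" using y_pos[OF j m0] m0 by (auto simp: ord_vector_def)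
      then obtain C where C: "\<forall>i. C i \<in> carrier S"
        "g = (\<Sum>i<subdegree (\<eta> j (y 0)). \<eta> j (C i) * s ^ i)"
        using powers_of_uniformizer_generate[OF \<eta>_hom[OF j] yc[OF m0] y0[OF m0] _ s] by blast
      then have "g = (\<Sum>i<subdegree (\<eta> j (y 0)). h j (\<phi> (C i)) * s ^ i)" by (simp add: h_\<phi>[OF j])
      then show ?thesis using C(1) \<phi>_closed by (intro exI[of _ "subdegree (\<eta> j (y 0))"] exI[of _ "\<lambda>i. \<phi> (C i)"]) auto
    qed
  next
    show "i = j" if "i < r" "j < r" "P i \<subseteq> P j" for i j using that by (rule incomparable)
    show "i = j" if "i < r" "j < r" "v i = v j" for i j using that y_distinct by (simp add: v_def)
    show "z i \<in> carrier R" if "i < m" for i using that by (simp add: z yc \<phi>_closed)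
    show "\<exists>j<r. P j \<subseteq> q \<and> (q = P j \<or> (\<forall>i<m. z i \<in> q))" if "primeideal q R" for q
    proof -
      have "z i \<in> max_ideal R" if "i < m" for i using that \<phi>_max_ideal yc y0 by (simp add: z)
      then show ?thesis using prime_cases[OF that] by blast
    qed
    show "regular_subdivision m \<Sigma>" by (rule \<Sigma>(1))
  qed
  have "minimal_primes R = P ` {..<r}" using branches by (simp add: bij_betw_def)
  moreover have "(\<lambda>i. (\<phi> \<circ> mps_subst m n y) (mps_var i)) = z" by (rule ext) (simp add: z_def)
  ultimately show ?thesis
    unfolding toric_embedded_resolution_def Let_def
    using not_in_discriminant smooth transversal by simp
qed

end

theorem corollary1p19:
  fixes R :: "'b ring"
    and \<iota> :: "'k::alg_closed_field \<Rightarrow> 'b"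
    and n r :: nat
    and x :: "nat \<Rightarrow> 'b"
    and \<phi> :: "(nat multiset \<Rightarrow> 'k) \<Rightarrow> 'b"
    and P :: "nat \<Rightarrow> 'b set"
    and \<eta> :: "nat \<Rightarrow> (nat multiset \<Rightarrow> 'k) \<Rightarrow> 'k fps"
  assumes "curve R \<iota>"
    and "reduced_ring R"
    and "r \<ge> 1"
    and "bij_betw P {..<r} (minimal_primes R)"
    and "curve_embedding R \<iota> n x \<phi>"
    and "\<forall>j<r. normalization_map n (embedded_ideal n \<phi> (P j)) (\<eta> j)"
  shows "(\<exists>m\<ge>1. \<exists>y. torifying_functions n r (\<lambda>j. embedded_ideal n \<phi> (P j)) \<eta> m y) \<and>
    (\<forall>m\<ge>1. \<forall>y. torifying_functions n r (\<lambda>j. embedded_ideal n \<phi> (P j)) \<eta> m y \<longrightarrow>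
      (\<forall>\<Sigma>. regular_subdivision m \<Sigma> \<and>
        (\<forall>j<r. cone_spanned {ord_vector m (\<eta> j) y} \<in> \<Sigma>) \<longrightarrow>
        toric_embedded_resolution R \<iota> m (\<phi> \<circ> mps_subst m n y) \<Sigma>))"
proof -
  interpret embedded_curve R \<iota> n r x \<phi> P \<eta> by unfold_locales (fact assms)+
  show ?thesis using torifying_functions_exist toric_embedded_resolution by blast
qed

end
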